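(* Let $\tau$ be the twisted full toroidal Lie algebra described in the context, let $V$ be an irreducible $\tau$-module in the category $\mathcal{B}_\psi$ such that $K_0$ acts on $V$ by a non-zero scalar $C_0$, and let $T=\{v\in V:\tau^{+}v=0\}$. Let $W_1$ (a finite dimensional irreducible $\mathfrak{gl}_n$-module), $W_2=\bigoplus_{\overline{k}\in\Lambda}W_{2,\overline{k}}$ (a finite dimensional $\Lambda$-graded irreducible $\overset{\circ}{\mathfrak{g}}$-module), $\underline{\alpha}\in\mathbb{C}^n$ and $d\in\mathbb{C}$ be data such that $T\cong T'$ as $\tau^0$-modules, where $T'=\bigoplus_{\underline{k}\in\mathbb{Z}^n}W_1\otimes W_{2,\overline{k}}\otimes\mathbb{C}t^{\underline{k}}$ is the $\tau^0$-module defined in the context from these data. Let $S'=\bigoplus_{\underline{k}\in\mathbb{Z}^n}W_1\otimes W_2(\sigma_0)_{\overline{k}}\otimes\mathbb{C}t^{\underline{k}}$, with the action of $\tau_0$ given in the context. Then: (1) $S'$ is a $\tau_0$-module, and it is irreducible. (2) The top space of $S'$ with respect to the triangular decomposition $\tau_0=\tau_0(-)\oplus\tau^0\oplus\tau_0(+)$ is $T'$; that is, $\{v\in S':\tau_0(+)v=0\}=T'$.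
   Context: Everything is over $\mathbb{C}$. The algebra $\tau$. Let $\mathfrak{g}$ be a finite dimensional simple Lie algebra with a non-degenerate invariant symmetric bilinear form $(\cdot,\cdot)$; fix $n\ge 1$ and commuting automorphisms $\sigma_0,\dots,\sigma_n$ of $\mathfrak{g}$ of finite orders $m_0,\dots,m_n$. Put $\underline{m}=(m_1,\dots,m_n)$, $\Gamma=m_1\mathbb{Z}\oplus\cdots\oplus m_n\mathbb{Z}$, $\Gamma_0=m_0\mathbb{Z}$, $\Lambda=\mathbb{Z}^n/\Gamma$, $\Lambda_0=\mathbb{Z}/\Gamma_0$; bars denote images in $\Lambda$ or $\Lambda_0$. For $\underline{k}=(k_1,\dots,k_n)\in\mathbb{Z}^n$ write $t^{\underline{k}}=t_1^{k_1}\cdots t_n^{k_n}$. Let $\xi_i$ be a primitive $m_i$-th root of unity, and $\mathfrak{g}(\overline{k_0},\overline{k})=\{x\in\mathfrak{g}:\sigma_i x=\xi_i^{k_i}x,\ 0\le i\le n\}$. The multiloop algebra is $L(\mathfrak{g},\sigma)=\bigoplus_{(k_0,\underline{k})\in\mathbb{Z}^{n+1}}\mathfrak{g}(\overline{k_0},\overline{k})\otimes\mathbb{C}t_0^{k_0}t^{\underline{k}}$. Let $A(\underline{m})=\mathbb{C}[t_1^{\pm m_1},\dots,t_n^{\pm m_n}]$ and $A(m_0,\underline{m})=\mathbb{C}[t_0^{\pm m_0},\dots,t_n^{\pm m_n}]$. Let $Z(m_0,\underline{m})$ be the space spanned by symbols $t_0^{r_0}t^{\underline{r}}K_i$ ($r_0\in\Gamma_0$,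 $\underline{r}\in\Gamma$, $0\le i\le n$) modulo the relations $\sum_{i=0}^n r_i t_0^{r_0}t^{\underline{r}}K_i=0$. Let $D(m_0,\underline{m})$ be the derivation algebra of $A(m_0,\underline{m})$, with basis $t_0^{r_0}t^{\underline{r}}d_i$, $d_i=t_i\frac{d}{dt_i}$ ($r_0\in\Gamma_0$, $\underline{r}\in\Gamma$, $0\le i\le n$). The twisted full toroidal Lie algebra is $\tau=L(\mathfrak{g},\sigma)\oplus Z(m_0,\underline{m})\oplus D(m_0,\underline{m})$ with brackets, for $X(k_0,\underline{k})=X\otimes t_0^{k_0}t^{\underline{k}}$ and $r_0,s_0\in\Gamma_0$, $\underline{r},\underline{s}\in\Gamma$, $0\le a,b\le n$: $[X(k_0,\underline{k}),Y(l_0,\underline{l})]=[X,Y](k_0+l_0,\underline{k}+\underline{l})+(X,Y)\sum_{i=0}^n k_i t_0^{k_0+l_0}t^{\underline{k}+\underline{l}}K_i$; $[L(\mathfrak{g},\sigma)\oplus Z(m_0,\underline{m}),Z(m_0,\underline{m})]=0$; $[t_0^{r_0}t^{\underline{r}}d_a,X(k_0,\underline{k})]=k_aX(k_0+r_0,\underline{k}+\underline{r})$; $[t_0^{r_0}t^{\underline{r}}d_a,t_0^{s_0}t^{\underline{s}}K_b]=s_at_0^{r_0+s_0}t^{\underline{r}+\underline{s}}K_b+\delta_{ab}\sum_{p=0}^n r_pt_0^{r_0+s_0}t^{\underline{r}+\underline{s}}K_p$; $[t_0^{r_0}t^{\underline{r}}d_a,t_0^{s_0}t^{\underline{s}}d_b]=s_at_0^{r_0+s_0}t^{\underline{r}+\underline{s}}d_b-r_bt_0^{r_0+s_0}t^{\underline{r}+\underline{s}}d_a+\phi(t_0^{r_0}t^{\underline{r}}d_a,t_0^{s_0}t^{\underline{s}}d_b)$,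 where $\phi$ is a fixed arbitrary linear combination of the cocycles $\phi_1(t_0^{r_0}t^{\underline{r}}d_a,t_0^{s_0}t^{\underline{s}}d_b)=-s_ar_b\sum_{p=0}^n r_pt_0^{r_0+s_0}t^{\underline{r}+\underline{s}}K_p$ and $\phi_2(t_0^{r_0}t^{\underline{r}}d_a,t_0^{s_0}t^{\underline{s}}d_b)=r_as_b\sum_{p=0}^n r_pt_0^{r_0+s_0}t^{\underline{r}+\underline{s}}K_p$. The centre $Z(\tau)$ is spanned by $K_0,\dots,K_n$. Standing assumptions. (i) $\mathfrak{g}(\overline{0},\overline{0})$ is a simple Lie algebra. (ii) Cartan subalgebras $\mathfrak{h}(\overline{0})$ of $\mathfrak{g}(\overline{0},\overline{0})$ and $\mathfrak{h}$ of $\mathfrak{g}$ are chosen with $\mathfrak{h}(\overline{0})\subseteq\mathfrak{h}$. (iii) Let $\Delta_0^\times$ be the set of non-zero roots of $\mathfrak{g}(\overline{0},\overline{0})$ with respect to $\mathfrak{h}(\overline{0})$ and $\Delta_{0,sh}^\times$ its short roots; let $\Delta_{0,en}^\times=\Delta_0^\times\cup 2\Delta_{0,sh}^\times$ if $\Delta_0^\times$ is of type $B_l$, and $\Delta_{0,en}^\times=\Delta_0^\times$ otherwise; $\Delta_{0,en}=\Delta_{0,en}^\times\cup\{0\}$. It is assumed that the set of weights (including $0$) of $\mathfrak{h}(\overline{0})$ on $\mathfrak{g}$ equals $\Delta_{0,en}$. Fix a choice of positive roots in $\Delta_{0,en}$. Write $\mathfrak{g}(\overline{k_0},\overline{k},\alpha)$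 for the $\alpha$-weight space of $\mathfrak{h}(\overline{0})$ in $\mathfrak{g}(\overline{k_0},\overline{k})$. Triangular decompositions. (a) $\tau_q=\{X\in\tau:[d_0,X]=qX\}$, $\tau_\pm=\bigoplus_{\pm q>0}\tau_q$, so $\tau=\tau_-\oplus\tau_0\oplus\tau_+$, where $\tau_0$ is the $q=0$ part. (b) $\tau_0=\tau_0(-)\oplus\tau^0\oplus\tau_0(+)$, with $\tau_0(\pm)=\bigoplus_{\pm\alpha>0,\ \underline{k}\in\mathbb{Z}^n}\mathfrak{g}(\overline{0},\overline{k},\alpha)\otimes\mathbb{C}t^{\underline{k}}$ and $\tau^0$ the $\mathfrak{h}(\overline{0})$-weight $0$ part of $\tau_0$. (c) $\tau=\tau^-\oplus\tau^0\oplus\tau^+$, with $\tau^{\pm}$ the sum of root spaces for roots $\alpha+k_0\delta_0+\delta_{\underline{k}}$ (i.e. $\mathfrak{h}(\overline{0})$-weight $\alpha$, $d_0$-weight $k_0$, $(d_1,\dots,d_n)$-weight $\underline{k}$) with $\pm(\alpha+k_0\delta_0)>0$ in the affine root system $\{\alpha+k_0\delta_0\}$ (positive means $k_0>0$, or $k_0=0$ and $\alpha>0$); thus $\tau^\pm=\tau_\pm\oplus\tau_0(\pm)$. Category $\mathcal{B}_\psi$. For a linear map $\psi:Z(\tau)\to\mathbb{C}$, a $\tau$-module $V$ is in $\mathcal{B}_\psi$ if: $V=\bigoplus_{\underline{\lambda}\in\mathbb{C}^{n+1}}V_{\underline{\lambda}}$ with $V_{\underline{\lambda}}=\{v:d_iv=\lambda_iv,\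 0\le i\le n\}$; all $V_{\underline{\lambda}}$ are finite dimensional; $K_iv=\psi(K_i)v$ for all $v\in V$ and $0\le i\le n$; the real parts of the eigenvalues of $d_0$ on $V$ are bounded above. The modules. Let $\mathfrak{g}(\sigma_0)=\{X\in\mathfrak{g}:\sigma_0X=X\}$ and $\overset{\circ}{\mathfrak{g}}=\{X\in\mathfrak{g}(\sigma_0):[\mathfrak{h}(\overline{0}),X]=0\}$; both are $\Lambda$-graded by the eigenspaces of $\sigma_1,\dots,\sigma_n$. One has $\tau_0=\bigoplus_{\underline{k}\in\mathbb{Z}^n}\mathfrak{g}(\sigma_0)_{\overline{k}}\otimes\mathbb{C}t^{\underline{k}}\oplus\mathrm{Der}(A(\underline{m}))\oplus\bigoplus_{\underline{r}\in\Gamma}\mathbb{C}t^{\underline{r}}d_0\oplus\sum_{\underline{r}\in\Gamma,\,0\le p\le n}\mathbb{C}t^{\underline{r}}K_p$, and $\tau^0$ is given by the same formula with $\overset{\circ}{\mathfrak{g}}$ in place of $\mathfrak{g}(\sigma_0)$. "$\Lambda$-graded irreducible" means non-zero, $\Lambda$-graded, with no proper non-zero graded submodule. Let $\{E_{ij}\}$ be the standard basis of $\mathfrak{gl}_n$ and for $\underline{u}\in\mathbb{C}^n$, $\underline{r}=(r_1,\dots,r_n)\in\Gamma$ put $D(\underline{u},\underline{r})=\sum_{i=1}^n u_it^{\underline{r}}d_i$. Given $W_1,W_2,\underline{\alpha},d$ as in the claim, $\tau^0$ acts on $T'$, for $v_1\in W_1$, $v_2\in W_{2,\overline{k}}$,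 $X\in\overset{\circ}{\mathfrak{g}}_{\overline{l}}$, $\underline{r}\in\Gamma$, by $D(\underline{u},\underline{r})(v_1\otimes v_2\otimes t^{\underline{k}})=\big(\sum_i u_i(k_i+\alpha_i)\big)v_1\otimes v_2\otimes t^{\underline{k}+\underline{r}}+\sum_{i,j}u_ir_j(E_{ji}v_1)\otimes v_2\otimes t^{\underline{k}+\underline{r}}$; $X\otimes t^{\underline{l}}(v_1\otimes v_2\otimes t^{\underline{k}})=v_1\otimes Xv_2\otimes t^{\underline{k}+\underline{l}}$; $t^{\underline{r}}d_0(v_1\otimes v_2\otimes t^{\underline{k}})=d\,v_1\otimes v_2\otimes t^{\underline{k}+\underline{r}}$; $t^{\underline{r}}K_0(v_1\otimes v_2\otimes t^{\underline{k}})=C_0\,v_1\otimes v_2\otimes t^{\underline{k}+\underline{r}}$; $t^{\underline{r}}K_p(v_1\otimes v_2\otimes t^{\underline{k}})=0$ for $1\le p\le n$. It is known (a result from the literature on which the setting relies) that data with $T\cong T'$ exist. Decompose $\mathfrak{g}(\sigma_0)=\mathfrak{g}(\sigma_0)_-\oplus\overset{\circ}{\mathfrak{g}}\oplus\mathfrak{g}(\sigma_0)_+$ by negative, zero, positive $\mathfrak{h}(\overline{0})$-weights. $W_2(\sigma_0)=\bigoplus_{\overline{k}\in\Lambda}W_2(\sigma_0)_{\overline{k}}$ denotes the unique $\Lambda$-graded irreducible quotient of the induced module $U(\mathfrak{g}(\sigma_0))\otimes_{U(\overset{\circ}{\mathfrak{g}}\oplus\mathfrak{g}(\sigma_0)_+)}W_2$,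 where $\mathfrak{g}(\sigma_0)_+$ acts trivially on $W_2$. The action of $\tau_0$ on $S'$ is given by the same five formulas, now with $v_2\in W_2(\sigma_0)_{\overline{k}}$ and $X\in\mathfrak{g}(\sigma_0)_{\overline{l}}$. $T'$ is regarded as a subspace of $S'$ via $W_2\subseteq W_2(\sigma_0)$. *)

theory Defs
  imports "HOL-Library.Poly_Mapping" "HOL-Analysis.Finite_Cartesian_Product"
begin

section \<open>Complex vector spaces\<close>

class scaleC =
  fixes scaleC :: "complex \<Rightarrow> 'a \<Rightarrow> 'a" (infixr \<open>*\<^sub>C\<close> 75)

class complex_vector = scaleC + ab_group_add +
  assumes scaleC_add_right: "a *\<^sub>C (x + y) = a *\<^sub>C x + a *\<^sub>C y"
    and scaleC_add_left: "(a + b) *\<^sub>C x = a *\<^sub>C x + b *\<^sub>C x"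
    and scaleC_scaleC: "a *\<^sub>C (b *\<^sub>C x) = (a * b) *\<^sub>C x"
    and scaleC_one: "1 *\<^sub>C x = x"

global_interpretation complex_vector: vector_space "scaleC :: complex \<Rightarrow> 'a \<Rightarrow> 'a::complex_vector"
  defines csubspace = complex_vector.subspace
    and cspan = complex_vector.span
  by unfold_locales (simp_all add: scaleC_add_right scaleC_add_left scaleC_scaleC scaleC_one)

lemma scaleC_zero_right [simp]: "a *\<^sub>C (0 :: 'a::complex_vector) = 0"
  by (fact complex_vector.scale_zero_right)

lemma scaleC_zero_left [simp]: "0 *\<^sub>C (x :: 'a::complex_vector) = 0"
  by (fact complex_vector.scale_zero_left)

abbreviation clinear :: "('a::complex_vector \<Rightarrow> 'b::complex_vector) \<Rightarrow> bool" where
  "clinear \<equiv> Vector_Spaces.linear scaleC scaleC"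

lemma clinear_iff:
  "clinear f \<longleftrightarrow> (\<forall>x y. f (x + y) = f x + f y) \<and> (\<forall>c x. f (c *\<^sub>C x) = c *\<^sub>C f x)"
  by (simp add: Vector_Spaces.linear_def module_hom_def module_hom_axioms_def
      complex_vector.vector_space_axioms complex_vector.module_axioms)

definition cbilinear :: "('a::complex_vector \<Rightarrow> 'b::complex_vector \<Rightarrow> 'c::complex_vector) \<Rightarrow> bool" where
  "cbilinear h \<longleftrightarrow> (\<forall>a. clinear (h a)) \<and> (\<forall>b. clinear (\<lambda>a. h a b))"

definition clinear_on :: "'a::complex_vector set \<Rightarrow> ('a \<Rightarrow> 'b::complex_vector) \<Rightarrow> bool" where
  "clinear_on M f \<longleftrightarrow> (\<forall>x\<in>M. \<forall>y\<in>M. f (x + y) = f x + f y) \<and> (\<forall>c. \<forall>x\<in>M. f (c *\<^sub>C x) = c *\<^sub>C f x)"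

definition fin_dim :: "'a::complex_vector set \<Rightarrow> bool" where
  "fin_dim M \<longleftrightarrow> (\<exists>B. finite B \<and> M \<subseteq> cspan B)"

definition direct_sum :: "'a::complex_vector set \<Rightarrow> 'i set \<Rightarrow> ('i \<Rightarrow> 'a set) \<Rightarrow> bool" where
  "direct_sum M I G \<longleftrightarrow> csubspace M \<and> (\<forall>i\<in>I. csubspace (G i) \<and> G i \<subseteq> M) \<and>
     (\<forall>v\<in>M. \<exists>!f. (\<forall>i\<in>I. f i \<in> G i) \<and> (\<forall>i. i \<notin> I \<longrightarrow> f i = 0) \<and>
        finite {i. f i \<noteq> 0} \<and> v = (\<Sum>i | f i \<noteq> 0. f i))"

instantiation complex :: complex_vector
begin
definition scaleC_complex :: "complex \<Rightarrow> complex \<Rightarrow> complex" where "scaleC_complex a x = a * x"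
instance by standard (simp_all add: scaleC_complex_def algebra_simps)
end

instantiation vec :: (complex_vector, finite) complex_vector
begin
definition scaleC_vec :: "complex \<Rightarrow> 'a ^ 'b \<Rightarrow> 'a ^ 'b" where "scaleC_vec a x = (\<chi> i. a *\<^sub>C (x $ i))"
instance
  by standard (simp_all add: scaleC_vec_def vec_eq_iff scaleC_add_right scaleC_add_left scaleC_scaleC scaleC_one)
end

instantiation prod :: (complex_vector, complex_vector) complex_vector
begin
definition scaleC_prod :: "complex \<Rightarrow> 'a \<times> 'b \<Rightarrow> 'a \<times> 'b" where
  "scaleC_prod a x = (a *\<^sub>C fst x, a *\<^sub>C snd x)"
instance
  by standard (simp_all add: scaleC_prod_def prod_eq_iff scaleC_add_right scaleC_add_left scaleC_scaleC scaleC_one)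
end

instantiation poly_mapping :: (type, complex_vector) complex_vector
begin
lift_definition scaleC_poly_mapping :: "complex \<Rightarrow> ('a \<Rightarrow>\<^sub>0 'b) \<Rightarrow> ('a \<Rightarrow>\<^sub>0 'b)"
  is "\<lambda>c f k. c *\<^sub>C f k"
  by (erule finite_subset [rotated]) auto
instance
  by standard (transfer; simp add: scaleC_add_right scaleC_add_left scaleC_scaleC scaleC_one)+
end

lemma lookup_scaleC: "Poly_Mapping.lookup (c *\<^sub>C f) k = c *\<^sub>C Poly_Mapping.lookup f k"
  by transfer simp


subsection \<open>Linear and bilinear extension from homogeneous elements\<close>

definition pm_sum :: "('k \<Rightarrow> 'a::zero \<Rightarrow> 'c::comm_monoid_add) \<Rightarrow> ('k \<Rightarrow>\<^sub>0 'a) \<Rightarrow> 'c" where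
  "pm_sum F f = (\<Sum>k\<in>Poly_Mapping.keys f. F k (Poly_Mapping.lookup f k))"

definition pm_conv :: "('k \<Rightarrow> 'a::zero \<Rightarrow> 'l \<Rightarrow> 'b::zero \<Rightarrow> 'c::comm_monoid_add) \<Rightarrow>
    ('k \<Rightarrow>\<^sub>0 'a) \<Rightarrow> ('l \<Rightarrow>\<^sub>0 'b) \<Rightarrow> 'c" where
  "pm_conv F f g = pm_sum (\<lambda>k x. pm_sum (F k x) g) f"

lemma pm_sum_superset:
  assumes "\<And>k. F k 0 = 0" "finite A" "Poly_Mapping.keys f \<subseteq> A"
  shows "pm_sum F f = (\<Sum>k\<in>A. F k (Poly_Mapping.lookup f k))"
  unfolding pm_sum_def using assms by (intro sum.mono_neutral_left) (auto simp: in_keys_iff)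

lemma pm_sum_zero [simp]: "pm_sum F 0 = 0"
  by (simp add: pm_sum_def)

lemma pm_sum_single:
  assumes "F k 0 = 0"
  shows "pm_sum F (Poly_Mapping.single k x) = F k x"
  using assms by (cases "x = 0") (simp_all add: pm_sum_def)

lemma pm_sum_add:
  assumes "\<And>k. F k 0 = 0" "\<And>k x y. F k (x + y) = F k x + F k y"
  shows "pm_sum F (f + g) = pm_sum F f + pm_sum F g"
proof -
  let ?A = "Poly_Mapping.keys f \<union> Poly_Mapping.keys g"
  have "pm_sum F h = (\<Sum>k\<in>?A. F k (Poly_Mapping.lookup h k))" if "h \<in> {f, g, f + g}" for h
    using that Poly_Mapping.keys_add [of f g] by (intro pm_sum_superset assms) auto
  then show ?thesis
    by (simp add: lookup_add assms(2) sum.distrib)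
qed

lemma pm_sum_scaleC:
  fixes F :: "'k \<Rightarrow> 'a::complex_vector \<Rightarrow> 'c::complex_vector"
  assumes "\<And>k. F k 0 = 0" "\<And>k x. F k (c *\<^sub>C x) = c *\<^sub>C F k x"
  shows "pm_sum F (c *\<^sub>C f) = c *\<^sub>C pm_sum F f"
proof -
  have "pm_sum F h = (\<Sum>k\<in>Poly_Mapping.keys f. F k (Poly_Mapping.lookup h k))" if "h \<in> {f, c *\<^sub>C f}" for h
    using that by (intro pm_sum_superset assms) (auto simp: in_keys_iff lookup_scaleC)
  then show ?thesis
    by (simp add: lookup_scaleC assms(2) complex_vector.scale_sum_right)
qed

lemma clinear_pm_sum:
  fixes F :: "'k \<Rightarrow> 'a::complex_vector \<Rightarrow> 'c::complex_vector"
  assumes "\<And>k. clinear (F k)"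
  shows "clinear (pm_sum F)"
proof -
  have 0: "F k 0 = 0" for k
    using assms [of k] unfolding clinear_iff by (metis scaleC_zero_left)
  show ?thesis
    unfolding clinear_iff using 0 assms
    by (auto simp: clinear_iff intro!: pm_sum_add pm_sum_scaleC)
qed

lemma pm_sum_zero_fun [simp]: "pm_sum (\<lambda>k x. 0) g = 0"
  by (simp add: pm_sum_def)

lemma pm_conv_zero [simp]: "pm_conv F 0 g = 0" "pm_conv F f 0 = 0"
  by (simp_all add: pm_conv_def)

lemma pm_conv_single:
  assumes "\<And>l y. F k 0 l y = 0" "F k x l 0 = 0"
  shows "pm_conv F (Poly_Mapping.single k x) (Poly_Mapping.single l y) = F k x l y"
  unfolding pm_conv_def by (subst pm_sum_single) (simp_all add: assms pm_sum_def)

lemma clinear_pm_conv: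
  fixes F :: "'k \<Rightarrow> 'a::zero \<Rightarrow> 'l \<Rightarrow> 'b::complex_vector \<Rightarrow> 'c::complex_vector"
  assumes "\<And>k x l. clinear (F k x l)"
  shows "clinear (pm_conv F f)"
proof -
  have "clinear (pm_sum (F k x))" for k x
    by (rule clinear_pm_sum) (rule assms)
  then show ?thesis
    unfolding clinear_iff pm_conv_def pm_sum_def [of "\<lambda>k x. pm_sum (F k x) _"]
    by (simp add: sum.distrib complex_vector.scale_sum_right)
qed


subsection \<open>Tensor products\<close>

definition tensor_rel :: "('a::complex_vector \<times> 'b::complex_vector \<Rightarrow>\<^sub>0 complex) set" where
  "tensor_rel = (let e = (\<lambda>a b. Poly_Mapping.single (a, b) 1) in
     {e (a + a') b - e a b - e a' b | a a' b. True} \<union>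
     {e a (b + b') - e a b - e a b' | a b b'. True} \<union>
     {e (c *\<^sub>C a) b - c *\<^sub>C e a b | c a b. True} \<union>
     {e a (c *\<^sub>C b) - c *\<^sub>C e a b | c a b. True})"

lemma equivp_cspan: "equivp (\<lambda>x y. x - y \<in> cspan R)" for R :: "'a::complex_vector set"
proof (rule equivpI)
  show "reflp (\<lambda>x y. x - y \<in> cspan R)"
    by (rule reflpI) (simp add: complex_vector.span_zero)
  show "symp (\<lambda>x y. x - y \<in> cspan R)"
    by (rule sympI) (metis complex_vector.span_neg minus_diff_eq)
  show "transp (\<lambda>x y. x - y \<in> cspan R)"
    by (rule transpI) (metis complex_vector.span_add diff_add_cancel add_diff_eq)
qed

quotient_type (overloaded) ('a, 'b) tensor =
  "('a::complex_vector \<times> 'b::complex_vector) \<Rightarrow>\<^sub>0 complex" / "\<lambda>x y. x - y \<in> cspan tensor_rel"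
  by (rule equivp_cspan)

lemma cspan_diff_add:
  "x - y \<in> cspan R \<Longrightarrow> x' - y' \<in> cspan R \<Longrightarrow> (x + x') - (y + y') \<in> cspan R"
  for x :: "'a::complex_vector"
  using complex_vector.span_add by (metis add_diff_add)

lemma cspan_diff_diff:
  "x - y \<in> cspan R \<Longrightarrow> x' - y' \<in> cspan R \<Longrightarrow> (x - x') - (y - y') \<in> cspan R"
  for x :: "'a::complex_vector"
  using complex_vector.span_diff [of "x - y" R "x' - y'"] by (simp add: algebra_simps)

lemma cspan_diff_neg: "x - y \<in> cspan R \<Longrightarrow> (- x) - (- y) \<in> cspan R"
  for x :: "'a::complex_vector"
  using complex_vector.span_neg [of "x - y" R] by (simp add: algebra_simps)

lemma cspan_diff_scale: "x - y \<in> cspan R \<Longrightarrow> (c *\<^sub>C x) - (c *\<^sub>C y) \<in> cspan R"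
  for x :: "'a::complex_vector"
  using complex_vector.span_scale [of "x - y" R c] by (simp add: complex_vector.scale_right_diff_distrib)

lemma cspan_diff_eq: "x = y \<Longrightarrow> x - y \<in> cspan R" for x :: "'a::complex_vector"
  by (simp add: complex_vector.span_zero)

instantiation tensor :: (complex_vector, complex_vector) complex_vector
begin
lift_definition zero_tensor :: "('a, 'b) tensor" is 0 .
lift_definition plus_tensor :: "('a, 'b) tensor \<Rightarrow> ('a, 'b) tensor \<Rightarrow> ('a, 'b) tensor" is "(+)"
  by (rule cspan_diff_add)
lift_definition minus_tensor :: "('a, 'b) tensor \<Rightarrow> ('a, 'b) tensor \<Rightarrow> ('a, 'b) tensor" is "(-)"
  by (rule cspan_diff_diff)
lift_definition uminus_tensor :: "('a, 'b) tensor \<Rightarrow> ('a, 'b) tensor" is uminus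
  by (rule cspan_diff_neg)
lift_definition scaleC_tensor :: "complex \<Rightarrow> ('a, 'b) tensor \<Rightarrow> ('a, 'b) tensor" is scaleC
  by (rule cspan_diff_scale)
instance
  by (standard; transfer; rule cspan_diff_eq)
     (simp_all add: scaleC_add_right scaleC_add_left scaleC_scaleC scaleC_one)
end

lift_definition tensor :: "'a::complex_vector \<Rightarrow> 'b::complex_vector \<Rightarrow> ('a, 'b) tensor" (infixl \<open>\<otimes>\<^sub>C\<close> 70)
  is "\<lambda>a b. Poly_Mapping.single (a, b) 1" .

lemma tensor_sum_wd:
  fixes h :: "'a::complex_vector \<Rightarrow> 'b::complex_vector \<Rightarrow> 'c::complex_vector"
  assumes h: "cbilinear h" and xy: "x - y \<in> cspan tensor_rel"
  shows "pm_sum (\<lambda>(a, b) c. c *\<^sub>C h a b) x = pm_sum (\<lambda>(a, b) c. c *\<^sub>C h a b) y"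
proof -
  let ?F = "\<lambda>(a, b) c. c *\<^sub>C h a b"
  have lin: "clinear (pm_sum ?F)"
    by (rule clinear_pm_sum) (auto simp: clinear_iff scaleC_add_left scaleC_scaleC scaleC_complex_def)
  interpret L: Vector_Spaces.linear scaleC scaleC "pm_sum ?F" by (fact lin)
  have hl: "h (a + a') b = h a b + h a' b" "h a (b + b') = h a b + h a b'"
     "h (c *\<^sub>C a) b = c *\<^sub>C h a b" "h a (c *\<^sub>C b) = c *\<^sub>C h a b" for a a' b b' c
    using h unfolding cbilinear_def clinear_iff by auto
  have e: "pm_sum ?F (Poly_Mapping.single (a, b) 1) = h a b" for a b
    by (subst pm_sum_single) (auto simp: scaleC_one)
  have "pm_sum ?F z = 0" if "z \<in> tensor_rel" for z
    using that unfolding tensor_rel_def Let_def by (auto simp: L.diff L.scale e hl)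
  moreover have "csubspace {z. pm_sum ?F z = 0}"
    by (rule complex_vector.subspaceI) (simp_all add: L.add L.scale)
  ultimately have "pm_sum ?F (x - y) = 0"
    using complex_vector.span_minimal [of tensor_rel "{z. pm_sum ?F z = 0}"] xy by blast
  then show ?thesis by (simp add: L.diff)
qed

text \<open>The linear map on the tensor product induced by a bilinear map \<open>h\<close>; the value for
  non-bilinear \<open>h\<close> is a dummy.\<close>

lift_definition tensor_lift ::
    "('a::complex_vector \<Rightarrow> 'b::complex_vector \<Rightarrow> 'c::complex_vector) \<Rightarrow> ('a, 'b) tensor \<Rightarrow> 'c"
  is "\<lambda>h x. if cbilinear h then pm_sum (\<lambda>(a, b) c. c *\<^sub>C h a b) x else 0"
  using tensor_sum_wd by auto

lemma tensor_lift_tensor: "cbilinear h \<Longrightarrow> tensor_lift h (a \<otimes>\<^sub>C b) = h a b"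
  by transfer (simp, subst pm_sum_single, auto simp: scaleC_one)

lemma clinear_tensor_lift: "clinear (tensor_lift h)"
proof (cases "cbilinear h")
  case True
  have "clinear (pm_sum (\<lambda>(a, b) c. c *\<^sub>C h a b))"
    by (rule clinear_pm_sum) (auto simp: clinear_iff scaleC_add_left scaleC_scaleC scaleC_complex_def)
  with True show ?thesis
    unfolding clinear_iff by transfer auto
next
  case False
  then show ?thesis
    unfolding clinear_iff by transfer auto
qed

lemma tensor_rel_mem:
  "Poly_Mapping.single (a + a', b) 1 - Poly_Mapping.single (a, b) 1 - Poly_Mapping.single (a', b) 1 \<in> tensor_rel"
  "Poly_Mapping.single (a, b + b') 1 - Poly_Mapping.single (a, b) 1 - Poly_Mapping.single (a, b') 1 \<in> tensor_rel"
  "Poly_Mapping.single (c *\<^sub>C a, b) 1 - c *\<^sub>C Poly_Mapping.single (a, b) 1 \<in> tensor_rel"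
  "Poly_Mapping.single (a, c *\<^sub>C b) 1 - c *\<^sub>C Poly_Mapping.single (a, b) 1 \<in> tensor_rel"
  unfolding tensor_rel_def Let_def by blast+

lemma cbilinear_tensor: "cbilinear (\<otimes>\<^sub>C)"
  unfolding cbilinear_def clinear_iff
  by (intro conjI allI; transfer)
     (use tensor_rel_mem [THEN complex_vector.span_base] in \<open>simp_all add: diff_diff_eq\<close>)

lemma tensor_linear:
  "(a + a') \<otimes>\<^sub>C b = a \<otimes>\<^sub>C b + a' \<otimes>\<^sub>C b" "a \<otimes>\<^sub>C (b + b') = a \<otimes>\<^sub>C b + a \<otimes>\<^sub>C b'"
  "(c *\<^sub>C a) \<otimes>\<^sub>C b = c *\<^sub>C (a \<otimes>\<^sub>C b)" "a \<otimes>\<^sub>C (c *\<^sub>C b) = c *\<^sub>C (a \<otimes>\<^sub>C b)"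
  using cbilinear_tensor unfolding cbilinear_def clinear_iff by metis+

definition tensor_map :: "('a::complex_vector \<Rightarrow> 'c::complex_vector) \<Rightarrow> ('b::complex_vector \<Rightarrow> 'd::complex_vector) \<Rightarrow>
    ('a, 'b) tensor \<Rightarrow> ('c, 'd) tensor" where
  "tensor_map f g = tensor_lift (\<lambda>a b. f a \<otimes>\<^sub>C g b)"

lemma tensor_map_tensor:
  assumes "clinear f" "clinear g"
  shows "tensor_map f g (a \<otimes>\<^sub>C b) = f a \<otimes>\<^sub>C g b"
  unfolding tensor_map_def
  by (rule tensor_lift_tensor)
     (use assms in \<open>simp add: cbilinear_def clinear_iff tensor_linear\<close>)

lemma clinear_tensor_map: "clinear (tensor_map f g)"
  unfolding tensor_map_def by (rule clinear_tensor_lift)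


section \<open>Lie algebras and their modules\<close>

text \<open>Algebras and modules are subspaces (carriers) of an ambient vector space, so that one
  bracket or action can be restricted to subalgebras and submodules.\<close>

definition lie_algebra :: "('l::complex_vector \<Rightarrow> 'l \<Rightarrow> 'l) \<Rightarrow> 'l set \<Rightarrow> bool" where
  "lie_algebra br L \<longleftrightarrow> csubspace L \<and> (\<forall>x\<in>L. \<forall>y\<in>L. br x y \<in> L) \<and>
     (\<forall>x\<in>L. clinear_on L (br x)) \<and> (\<forall>y\<in>L. clinear_on L (\<lambda>x. br x y)) \<and>
     (\<forall>x\<in>L. br x x = 0) \<and>
     (\<forall>x\<in>L. \<forall>y\<in>L. \<forall>z\<in>L. br x (br y z) + br y (br z x) + br z (br x y) = 0)"

definition simple_lie_algebra :: "('l::complex_vector \<Rightarrow> 'l \<Rightarrow> 'l) \<Rightarrow> 'l set \<Rightarrow> bool" where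
  "simple_lie_algebra br L \<longleftrightarrow> lie_algebra br L \<and> (\<exists>x\<in>L. \<exists>y\<in>L. br x y \<noteq> 0) \<and>
     (\<forall>J. csubspace J \<and> J \<subseteq> L \<and> (\<forall>x\<in>L. \<forall>y\<in>J. br x y \<in> J) \<longrightarrow> J = {0} \<or> J = L)"

definition lie_centre :: "('l::complex_vector \<Rightarrow> 'l \<Rightarrow> 'l) \<Rightarrow> 'l set \<Rightarrow> 'l set" where
  "lie_centre br L = {x\<in>L. \<forall>y\<in>L. br x y = 0}"

definition invariant_form :: "('l::complex_vector \<Rightarrow> 'l \<Rightarrow> 'l) \<Rightarrow> ('l \<Rightarrow> 'l \<Rightarrow> complex) \<Rightarrow> bool" where
  "invariant_form br B \<longleftrightarrow> cbilinear B \<and> (\<forall>x y. B x y = B y x) \<and>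
     (\<forall>x y z. B (br x y) z = B x (br y z)) \<and> (\<forall>x. (\<forall>y. B x y = 0) \<longrightarrow> x = 0)"

definition lie_automorphism :: "('l::complex_vector \<Rightarrow> 'l \<Rightarrow> 'l) \<Rightarrow> ('l \<Rightarrow> 'l) \<Rightarrow> bool" where
  "lie_automorphism br s \<longleftrightarrow> clinear s \<and> bij s \<and> (\<forall>x y. s (br x y) = br (s x) (s y))"

text \<open>A Cartan subalgebra of a complex (semi)simple Lie algebra: a maximal abelian subalgebra
  all of whose elements are ad-diagonalizable.\<close>

definition cartan_subalgebra :: "('l::complex_vector \<Rightarrow> 'l \<Rightarrow> 'l) \<Rightarrow> 'l set \<Rightarrow> 'l set \<Rightarrow> bool" where
  "cartan_subalgebra br L h \<longleftrightarrow>
     (let abelian = (\<lambda>a. csubspace a \<and> a \<subseteq> L \<and> (\<forall>x\<in>a. \<forall>y\<in>a. br x y = 0)) in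
      abelian h \<and> (\<forall>a. abelian a \<and> h \<subseteq> a \<longrightarrow> a = h) \<and>
      (\<forall>x\<in>h. L \<subseteq> cspan {y\<in>L. \<exists>c. br x y = c *\<^sub>C y}))"

text \<open>An element of the dual of \<open>h\<close> is a function that is linear on \<open>h\<close> and, to be determined by
  its values on \<open>h\<close>, zero off \<open>h\<close>.\<close>

definition dual_space :: "'l::complex_vector set \<Rightarrow> ('l \<Rightarrow> complex) set" where
  "dual_space h = {a. clinear_on h a \<and> (\<forall>x. x \<notin> h \<longrightarrow> a x = 0)}"

definition weight_space :: "('l::complex_vector \<Rightarrow> 'l \<Rightarrow> 'l) \<Rightarrow> 'l set \<Rightarrow> ('l \<Rightarrow> complex) \<Rightarrow> 'l set \<Rightarrow> 'l set" where
  "weight_space br h a L = {x\<in>L. \<forall>y\<in>h. br y x = a y *\<^sub>C x}"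

definition weights :: "('l::complex_vector \<Rightarrow> 'l \<Rightarrow> 'l) \<Rightarrow> 'l set \<Rightarrow> 'l set \<Rightarrow> ('l \<Rightarrow> complex) set" where
  "weights br h L = {a \<in> dual_space h. weight_space br h a L \<noteq> {0}}"

definition lie_module :: "('l::complex_vector \<Rightarrow> 'l \<Rightarrow> 'l) \<Rightarrow> 'l set \<Rightarrow>
    ('l \<Rightarrow> 'm::complex_vector \<Rightarrow> 'm) \<Rightarrow> 'm set \<Rightarrow> bool" where
  "lie_module br L act M \<longleftrightarrow> csubspace M \<and> (\<forall>x\<in>L. \<forall>v\<in>M. act x v \<in> M) \<and>
     (\<forall>x\<in>L. clinear_on M (act x)) \<and> (\<forall>v\<in>M. clinear_on L (\<lambda>x. act x v)) \<and>
     (\<forall>x\<in>L. \<forall>y\<in>L. \<forall>v\<in>M. act (br x y) v = act x (act y v) - act y (act x v))"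

definition submodule :: "'l set \<Rightarrow> ('l \<Rightarrow> 'm::complex_vector \<Rightarrow> 'm) \<Rightarrow> 'm set \<Rightarrow> 'm set \<Rightarrow> bool" where
  "submodule L act M N \<longleftrightarrow> csubspace N \<and> N \<subseteq> M \<and> (\<forall>x\<in>L. \<forall>v\<in>N. act x v \<in> N)"

definition irreducible_module :: "('l::complex_vector \<Rightarrow> 'l \<Rightarrow> 'l) \<Rightarrow> 'l set \<Rightarrow>
    ('l \<Rightarrow> 'm::complex_vector \<Rightarrow> 'm) \<Rightarrow> 'm set \<Rightarrow> bool" where
  "irreducible_module br L act M \<longleftrightarrow> lie_module br L act M \<and> M \<noteq> {0} \<and>
     (\<forall>N. submodule L act M N \<longrightarrow> N = {0} \<or> N = M)"

definition lie_module_iso :: "('l::complex_vector \<Rightarrow> 'l \<Rightarrow> 'l) \<Rightarrow> 'l set \<Rightarrow>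
    ('l \<Rightarrow> 'm::complex_vector \<Rightarrow> 'm) \<Rightarrow> 'm set \<Rightarrow> ('l \<Rightarrow> 'p::complex_vector \<Rightarrow> 'p) \<Rightarrow> 'p set \<Rightarrow> bool" where
  "lie_module_iso br L act M act' M' \<longleftrightarrow> lie_module br L act M \<and> lie_module br L act' M' \<and>
     (\<exists>\<theta>. bij_betw \<theta> M M' \<and> clinear_on M \<theta> \<and> (\<forall>x\<in>L. \<forall>v\<in>M. \<theta> (act x v) = act' x (\<theta> v)))"

definition gl_bracket :: "complex ^ 'n ^ 'n \<Rightarrow> complex ^ 'n ^ 'n \<Rightarrow> complex ^ 'n ^ 'n" where
  "gl_bracket A B = A ** B - B ** A"

definition matrix_unit :: "'n \<Rightarrow> 'n \<Rightarrow> complex ^ 'n ^ 'n" where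
  "matrix_unit i j = (\<chi> a b. if a = i \<and> b = j then 1 else 0)"


section \<open>The full toroidal Lie algebra\<close>

text \<open>Indices \<open>0, 1, \<dots>, n\<close> are the elements of \<^typ>\<open>'n option\<close>: \<^term>\<open>None\<close> stands for \<open>0\<close> and
  the \<^term>\<open>Some i\<close> for \<open>1, \<dots>, n\<close>.  An exponent vector \<open>(k\<^sub>0, k)\<close> is thus an element of
  \<^typ>\<open>int ^ 'n option\<close>; \<open>emb\<close> sends \<open>k\<close> to \<open>(0, k)\<close>.\<close>

definition emb :: "int ^ 'n \<Rightarrow> int ^ 'n option" where
  "emb k = (\<chi> i. case i of None \<Rightarrow> 0 | Some j \<Rightarrow> k $ j)"

lemma inj_emb: "inj emb"
  by (rule injI) (auto simp: emb_def vec_eq_iff split: option.splits)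

definition cvec :: "int ^ 'i \<Rightarrow> complex ^ 'i" where
  "cvec r = (\<chi> i. of_int (r $ i))"

definition dot :: "complex ^ 'i \<Rightarrow> complex ^ 'i \<Rightarrow> complex" where
  "dot u v = (\<Sum>i\<in>UNIV. u $ i * v $ i)"

lemma dot_linear:
  "dot (u + u') v = dot u v + dot u' v" "dot u (v + v') = dot u v + dot u v'"
  "dot (c *\<^sub>C u) v = c * dot u v" "dot u (c *\<^sub>C v) = c * dot u v"
  "dot 0 v = 0" "dot u 0 = 0"
  by (simp_all add: dot_def scaleC_vec_def scaleC_complex_def algebra_simps sum.distrib sum_distrib_left)

lemma cvec_add: "cvec (r + s) = cvec r + cvec s"
  by (simp add: cvec_def vec_eq_iff)

text \<open>The space spanned by the symbols \<open>t\<^sup>r K\<^sub>i\<close> modulo \<open>\<Sum>\<^sub>i r\<^sub>i t\<^sup>r K\<^sub>i = 0\<close>, for \<^emph>\<open>all\<close> exponents \<open>r\<close>.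
  The relations are homogeneous, so \<open>Z(m\<^sub>0, m)\<close> is the subspace spanned by the symbols with
  \<open>r \<in> \<Gamma>\<^sub>0 \<oplus> \<Gamma>\<close>.  In the free space, \<open>\<Sum>\<^sub>i w\<^sub>i t\<^sup>r K\<^sub>i\<close> is represented by the vector \<open>w\<close> at exponent \<open>r\<close>.\<close>

definition K_rel :: "(int ^ 'i \<Rightarrow>\<^sub>0 complex ^ 'i) set" where
  "K_rel = {Poly_Mapping.single r (cvec r) | r. True}"

quotient_type 'i kspace = "(int ^ 'i) \<Rightarrow>\<^sub>0 (complex ^ 'i::finite)" / "\<lambda>x y. x - y \<in> cspan K_rel"
  by (rule equivp_cspan)

instantiation kspace :: (finite) complex_vector
begin
lift_definition zero_kspace :: "'a kspace" is 0 .
lift_definition plus_kspace :: "'a kspace \<Rightarrow> 'a kspace \<Rightarrow> 'a kspace" is "(+)"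
  by (rule cspan_diff_add)
lift_definition minus_kspace :: "'a kspace \<Rightarrow> 'a kspace \<Rightarrow> 'a kspace" is "(-)"
  by (rule cspan_diff_diff)
lift_definition uminus_kspace :: "'a kspace \<Rightarrow> 'a kspace" is uminus
  by (rule cspan_diff_neg)
lift_definition scaleC_kspace :: "complex \<Rightarrow> 'a kspace \<Rightarrow> 'a kspace" is scaleC
  by (rule cspan_diff_scale)
instance
  by (standard; transfer; rule cspan_diff_eq)
     (simp_all add: scaleC_add_right scaleC_add_left scaleC_scaleC scaleC_one)
end

text \<open>\<open>tK r w\<close> is the class of \<open>\<Sum>\<^sub>i w\<^sub>i t\<^sup>r K\<^sub>i\<close>.\<close>

lift_definition tK :: "int ^ 'i::finite \<Rightarrow> complex ^ 'i \<Rightarrow> 'i kspace"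
  is "Poly_Mapping.single" .

lemma tK_relation: "tK r (cvec r) = 0"
  by transfer (auto simp: K_rel_def intro: complex_vector.span_base)

lemma single_clinear:
  "Poly_Mapping.single k (x + y) = Poly_Mapping.single k x + Poly_Mapping.single k y"
  "Poly_Mapping.single k (c *\<^sub>C z) = c *\<^sub>C Poly_Mapping.single k z"
  for z :: "'a::complex_vector"
  by (rule single_add) (rule poly_mapping_eqI, simp add: lookup_scaleC lookup_single when_def)

text \<open>Derivations are finite sums of \<open>D(u, r) = \<Sum>\<^sub>i u\<^sub>i t\<^sup>r d\<^sub>i\<close>, with \<open>u\<close> stored at exponent \<open>r\<close>.\<close>

type_synonym 'i derivations = "(int ^ 'i) \<Rightarrow>\<^sub>0 (complex ^ 'i)"

text \<open>By linearity, \<open>[D(u, r), \<Sum>\<^sub>b w\<^sub>b t\<^sup>s K\<^sub>b] = (\<Sum>\<^sub>a u\<^sub>a s\<^sub>a) \<Sum>\<^sub>b w\<^sub>b t\<^bsup>r+s\<^esup> K\<^sub>b + (\<Sum>\<^sub>a u\<^sub>a w\<^sub>a) \<Sum>\<^sub>p r\<^sub>p t\<^bsup>r+s\<^esup> K\<^sub>p\<close>.\<close>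

definition der_K_rep :: "'i::finite derivations \<Rightarrow> (int ^ 'i \<Rightarrow>\<^sub>0 complex ^ 'i) \<Rightarrow> (int ^ 'i \<Rightarrow>\<^sub>0 complex ^ 'i)" where
  "der_K_rep = pm_conv (\<lambda>r u s w. Poly_Mapping.single (r + s) (dot u (cvec s) *\<^sub>C w + dot u w *\<^sub>C cvec r))"

lemma clinear_der_K_rep: "clinear (der_K_rep D)"
  unfolding der_K_rep_def
  by (rule clinear_pm_conv)
     (auto simp: clinear_iff dot_linear scaleC_add_right scaleC_add_left scaleC_scaleC
        algebra_simps single_clinear(1) single_clinear(2) [symmetric])

lemma der_K_rep_wd:
  assumes "x - y \<in> cspan K_rel"
  shows "der_K_rep D x - der_K_rep D y \<in> cspan K_rel"
proof -
  interpret L: Vector_Spaces.linear scaleC scaleC "der_K_rep D" by (rule clinear_der_K_rep)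
  have "der_K_rep D z \<in> cspan K_rel" if z: "z \<in> K_rel" for z
  proof -
    from z obtain s where z: "z = Poly_Mapping.single s (cvec s)" unfolding K_rel_def by blast
    have "pm_sum (\<lambda>s w. Poly_Mapping.single (r + s) (dot u (cvec s) *\<^sub>C w + dot u w *\<^sub>C cvec r)) z
        = dot u (cvec s) *\<^sub>C Poly_Mapping.single (r + s) (cvec (r + s))" for r u
      unfolding z
      by (subst pm_sum_single) (simp_all add: dot_linear cvec_add scaleC_add_right add.commute
            flip: single_clinear(2))
    then have "der_K_rep D z =
        (\<Sum>k\<in>Poly_Mapping.keys D. dot (Poly_Mapping.lookup D k) (cvec s) *\<^sub>C Poly_Mapping.single (k + s) (cvec (k + s)))"
      by (simp add: der_K_rep_def pm_conv_def) (simp add: pm_sum_def)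
    also have "\<dots> \<in> cspan K_rel"
      by (intro complex_vector.span_sum complex_vector.span_scale complex_vector.span_base)
         (auto simp: K_rel_def)
    finally show ?thesis .
  qed
  moreover have "csubspace {z. der_K_rep D z \<in> cspan K_rel}"
    by (rule complex_vector.subspaceI)
       (simp_all add: L.add L.scale complex_vector.span_zero complex_vector.span_add complex_vector.span_scale)
  ultimately have "der_K_rep D (x - y) \<in> cspan K_rel"
    using complex_vector.span_minimal [of K_rel "{z. der_K_rep D z \<in> cspan K_rel}"] assms by blast
  then show ?thesis
    by (simp add: L.diff)
qed

lift_definition der_K :: "'i::finite derivations \<Rightarrow> 'i kspace \<Rightarrow> 'i kspace" is der_K_rep
  by (rule der_K_rep_wd)

lemma der_K_single:
  "der_K (Poly_Mapping.single r u) (tK s w) = dot u (cvec s) *\<^sub>C tK (r + s) w + dot u w *\<^sub>C tK (r + s) (cvec r)"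
  by transfer
     (simp add: der_K_rep_def pm_conv_single dot_linear complex_vector.span_zero
        single_clinear(1) single_clinear(2) [symmetric])

lemma K_rel_K0: "z \<in> cspan K_rel \<Longrightarrow> Poly_Mapping.lookup z (emb k) $ None = 0"
proof (erule complex_vector.span_induct)
  let ?A = "{z. Poly_Mapping.lookup z (emb k) $ None = (0::complex)}"
  show "csubspace ?A"
    by (rule complex_vector.subspaceI) (simp_all add: lookup_add lookup_scaleC scaleC_vec_def)
  show "Poly_Mapping.lookup z (emb k) $ None = 0" if "z \<in> K_rel" for z
    using that by (auto simp: K_rel_def lookup_single when_def cvec_def emb_def)
qed

lemma lookup_map_key_emb: "Poly_Mapping.lookup (Poly_Mapping.map_key emb z) k = Poly_Mapping.lookup z (emb k)"
  by (simp add: map_key.rep_eq inj_emb)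

text \<open>The coefficients of the symbols \<open>t\<^sup>r K\<^sub>0\<close> with \<open>r\<close> in \<open>\<int>\<^sup>n\<close>, i.e. with \<open>r\<^sub>0 = 0\<close>; these are the
  ones on which the relations impose nothing.\<close>

lift_definition K0_part :: "('n::finite option) kspace \<Rightarrow> (int ^ 'n \<Rightarrow>\<^sub>0 complex)"
  is "\<lambda>z. Poly_Mapping.map (\<lambda>w. w $ None) (Poly_Mapping.map_key emb z)"
proof (rule poly_mapping_eqI)
  fix x y :: "int ^ 'n option \<Rightarrow>\<^sub>0 complex ^ 'n option" and k
  assume "x - y \<in> cspan K_rel"
  then have "Poly_Mapping.lookup x (emb k) $ None = Poly_Mapping.lookup y (emb k) $ None"
    using K_rel_K0 [of "x - y" k] by (simp add: lookup_minus)
  then show "Poly_Mapping.lookup (Poly_Mapping.map (\<lambda>w. w $ None) (Poly_Mapping.map_key emb x)) k =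
      Poly_Mapping.lookup (Poly_Mapping.map (\<lambda>w. w $ None) (Poly_Mapping.map_key emb y)) k"
    by (auto simp: lookup_map_key_emb map.rep_eq when_def)
qed

subsection \<open>The defining data\<close>

record ('g, 'n) toroidal_data =
  brk :: "'g \<Rightarrow> 'g \<Rightarrow> 'g"             \<comment> \<open>Lie bracket of \<open>\<gg>\<close>\<close>
  frm :: "'g \<Rightarrow> 'g \<Rightarrow> complex"        \<comment> \<open>invariant form on \<open>\<gg>\<close>\<close>
  aut :: "'n option \<Rightarrow> 'g \<Rightarrow> 'g"       \<comment> \<open>\<open>\<sigma>\<^sub>i\<close>\<close>
  per :: "'n option \<Rightarrow> nat"            \<comment> \<open>\<open>m\<^sub>i\<close>\<close>
  rou :: "'n option \<Rightarrow> complex"        \<comment> \<open>\<open>\<xi>\<^sub>i\<close>\<close>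
  coc1 :: complex                      \<comment> \<open>\<open>\<phi> = coc1 \<cdot> \<phi>\<^sub>1 + coc2 \<cdot> \<phi>\<^sub>2\<close>\<close>
  coc2 :: complex
  csa0 :: "'g set"                     \<comment> \<open>Cartan subalgebra of \<open>\<gg>(0, 0)\<close>\<close>
  csa :: "'g set"                      \<comment> \<open>Cartan subalgebra of \<open>\<gg>\<close>\<close>
  pos :: "('g \<Rightarrow> complex) set"         \<comment> \<open>the positive roots\<close>

definition eigen :: "('g::complex_vector, 'n::finite) toroidal_data \<Rightarrow> int ^ 'n option \<Rightarrow> 'g set" where
  "eigen S k = {x. \<forall>i. aut S i x = (rou S i powi (k $ i)) *\<^sub>C x}"

definition fixed00 :: "('g::complex_vector, 'n::finite) toroidal_data \<Rightarrow> 'g set" where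
  "fixed00 S = eigen S 0"

definition full_lattice :: "('g, 'n::finite) toroidal_data \<Rightarrow> (int ^ 'n option) set" where
  "full_lattice S = {r. \<forall>i. int (per S i) dvd r $ i}"

text \<open>\<open>\<Lambda> = \<int>\<^sup>n / \<Gamma>\<close> is the set of cosets of \<open>\<Gamma> = m\<^sub>1\<int> \<oplus> \<dots> \<oplus> m\<^sub>n\<int>\<close>.\<close>

definition coset :: "('g, 'n::finite) toroidal_data \<Rightarrow> int ^ 'n \<Rightarrow> (int ^ 'n) set" where
  "coset S k = {l. \<forall>i. int (per S (Some i)) dvd l $ i - k $ i}"

definition Lambda :: "('g, 'n::finite) toroidal_data \<Rightarrow> (int ^ 'n) set set" where
  "Lambda S = {coset S k | k. True}"


subsection \<open>Roots\<close>

definition roots0 :: "('g::complex_vector, 'n::finite) toroidal_data \<Rightarrow> ('g \<Rightarrow> complex) set" where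
  "roots0 S = weights (brk S) (csa0 S) (fixed00 S) - {\<lambda>x. 0}"

text \<open>The squared length \<open>(\<alpha>, \<alpha>) = \<alpha>(t\<^sub>\<alpha>)\<close>, where \<open>t\<^sub>\<alpha> \<in> \<hh>(0)\<close> represents \<open>\<alpha>\<close> through the form.  The
  invariant form is only determined up to a complex factor, hence lengths are compared by their
  ratios.\<close>

definition root_norm :: "('g::complex_vector, 'n::finite) toroidal_data \<Rightarrow> ('g \<Rightarrow> complex) \<Rightarrow> complex" where
  "root_norm S a = a (THE t. t \<in> csa0 S \<and> (\<forall>y\<in>csa0 S. frm S t y = a y))"

definition short_roots0 :: "('g::complex_vector, 'n::finite) toroidal_data \<Rightarrow> ('g \<Rightarrow> complex) set" where
  "short_roots0 S = {a \<in> roots0 S. \<forall>b\<in>roots0 S. Re (root_norm S b / root_norm S a) \<ge> 1}"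

text \<open>Type \<open>B\<^sub>l\<close>: the roots are \<open>\<plusminus>e\<^sub>i\<close> and \<open>\<plusminus>e\<^sub>i \<plusminus> e\<^sub>j\<close> (\<open>i \<noteq> j\<close>) for linearly independent
  \<open>e\<^sub>1, \<dots>, e\<^sub>l\<close>.  For \<open>l = 1\<close> this is the root system of type \<open>A\<^sub>1\<close>.\<close>

definition root_type_B :: "nat \<Rightarrow> ('g \<Rightarrow> complex) set \<Rightarrow> bool" where
  "root_type_B l R \<longleftrightarrow> (\<exists>e :: nat \<Rightarrow> 'g \<Rightarrow> complex.
     (\<forall>c. (\<forall>x. (\<Sum>i<l. c i * e i x) = 0) \<longrightarrow> (\<forall>i<l. c i = 0)) \<and>
     R = {\<lambda>x. s * e i x | s i. s \<in> {1, -1} \<and> i < l} \<union>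
         {\<lambda>x. s * e i x + t * e j x | s t i j. s \<in> {1, -1} \<and> t \<in> {1, -1} \<and> i < l \<and> j < l \<and> i \<noteq> j})"

text \<open>\<open>\<Delta>\<^sub>0\<^sub>,\<^sub>e\<^sub>n\<close>, where \<open>B\<^sub>l\<close> is understood to mean \<open>l \<ge> b\<close>: \<open>b = 2\<close> is the usual list of types,
  and \<open>b = 1\<close> is the convention \<open>B\<^sub>1 = A\<^sub>1\<close>.\<close>

definition enlarged_roots0 :: "nat \<Rightarrow> ('g::complex_vector, 'n::finite) toroidal_data \<Rightarrow> ('g \<Rightarrow> complex) set" where
  "enlarged_roots0 b S = insert (\<lambda>x. 0)
     (if \<exists>l\<ge>b. root_type_B l (roots0 S)
      then roots0 S \<union> {\<lambda>x. 2 * a x | a. a \<in> short_roots0 S} else roots0 S)"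

text \<open>A choice of positive elements: those on one side of a hyperplane which avoids all
  non-zero elements of \<open>R\<close>, given by a real linear functional.\<close>

definition positive_choice :: "('g \<Rightarrow> complex) set \<Rightarrow> ('g \<Rightarrow> complex) set \<Rightarrow> bool" where
  "positive_choice R P \<longleftrightarrow> (\<exists>f :: ('g \<Rightarrow> complex) \<Rightarrow> real.
     (\<forall>a b. f (\<lambda>x. a x + b x) = f a + f b) \<and> (\<forall>c a. f (\<lambda>x. of_real c * a x) = c * f a) \<and>
     (\<forall>a\<in>R - {\<lambda>x. 0}. f a \<noteq> 0) \<and> P = {a \<in> R. f a > 0})"

definition toroidal_setting :: "nat \<Rightarrow> ('g::complex_vector, 'n::finite) toroidal_data \<Rightarrow> bool" where
  "toroidal_setting b S \<longleftrightarrow>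
     simple_lie_algebra (brk S) UNIV \<and> fin_dim (UNIV :: 'g set) \<and>
     invariant_form (brk S) (frm S) \<and>
     (\<forall>i. lie_automorphism (brk S) (aut S i)) \<and>
     (\<forall>i j x. aut S i (aut S j x) = aut S j (aut S i x)) \<and>
     (\<forall>i. 0 < per S i \<and> (\<forall>k>0. (\<forall>x. (aut S i ^^ k) x = x) \<longleftrightarrow> per S i dvd k)) \<and>
     (\<forall>i. \<forall>k>0. rou S i ^ k = 1 \<longleftrightarrow> per S i dvd k) \<and>
     simple_lie_algebra (brk S) (fixed00 S) \<and>
     cartan_subalgebra (brk S) (fixed00 S) (csa0 S) \<and>
     cartan_subalgebra (brk S) UNIV (csa S) \<and> csa0 S \<subseteq> csa S \<and>
     weights (brk S) (csa0 S) UNIV = enlarged_roots0 b S \<and>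
     positive_choice (enlarged_roots0 b S) (pos S)"


subsection \<open>The twisted full toroidal Lie algebra\<close>

text \<open>Triples in \<open>\<gg> \<otimes> \<complex>[t\<^sub>0\<^sup>\<plusminus>, \<dots>, t\<^sub>n\<^sup>\<plusminus>] \<oplus> Z \<oplus> D\<close>; the twisted algebra \<open>tau\<close> is a subspace.\<close>

type_synonym ('g, 'n) toroidal =
  "(int ^ 'n option \<Rightarrow>\<^sub>0 'g) \<times> 'n option kspace \<times> 'n option derivations"

definition loopX :: "int ^ 'n option \<Rightarrow> 'g::complex_vector \<Rightarrow> ('g, 'n::finite) toroidal" where
  "loopX k x = (Poly_Mapping.single k x, 0, 0)"

definition tKi :: "int ^ 'n option \<Rightarrow> 'n option \<Rightarrow> ('g::complex_vector, 'n::finite) toroidal" where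
  "tKi r i = (0, tK r (axis i 1), 0)"

definition tdi :: "int ^ 'n option \<Rightarrow> 'n option \<Rightarrow> ('g::complex_vector, 'n::finite) toroidal" where
  "tdi r i = (0, 0, Poly_Mapping.single r (axis i 1))"

definition tau :: "('g::complex_vector, 'n::finite) toroidal_data \<Rightarrow> ('g, 'n) toroidal set" where
  "tau S = {(f, z, D). (\<forall>k. Poly_Mapping.lookup f k \<in> eigen S k) \<and>
     z \<in> cspan {tK r (axis i 1) | r i. r \<in> full_lattice S} \<and> Poly_Mapping.keys D \<subseteq> full_lattice S}"

definition der_L :: "'i::finite derivations \<Rightarrow> (int ^ 'i \<Rightarrow>\<^sub>0 'g::complex_vector) \<Rightarrow> (int ^ 'i \<Rightarrow>\<^sub>0 'g)" where
  "der_L = pm_conv (\<lambda>r u k x. Poly_Mapping.single (r + k) (dot u (cvec k) *\<^sub>C x))"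

fun tau_bracket :: "('g::complex_vector, 'n::finite) toroidal_data \<Rightarrow>
    ('g, 'n) toroidal \<Rightarrow> ('g, 'n) toroidal \<Rightarrow> ('g, 'n) toroidal" where
  "tau_bracket S (f, z, D) (f', z', D') =
    (pm_conv (\<lambda>k x l y. Poly_Mapping.single (k + l) (brk S x y)) f f' + der_L D f' - der_L D' f,
     pm_conv (\<lambda>k x l y. frm S x y *\<^sub>C tK (k + l) (cvec k)) f f' + der_K D z' - der_K D' z +
       pm_conv (\<lambda>r u s v. (coc2 S * (dot u (cvec r) * dot v (cvec s)) - coc1 S * (dot u (cvec s) * dot v (cvec r)))
          *\<^sub>C tK (r + s) (cvec r)) D D',
     pm_conv (\<lambda>r u s v. Poly_Mapping.single (r + s) (dot u (cvec s) *\<^sub>C v - dot v (cvec r) *\<^sub>C u)) D D')"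

lemma tK_linear:
  shows tK_add: "tK r (w + w') = tK r w + tK r w'"
    and tK_scaleC: "tK r (c *\<^sub>C w) = c *\<^sub>C tK r w"
proof -
  show "tK r (w + w') = tK r w + tK r w'"
    by transfer (simp add: single_clinear complex_vector.span_zero)
  show "tK r (c *\<^sub>C w) = c *\<^sub>C tK r w"
    by transfer (simp add: single_clinear complex_vector.span_zero)
qed

lemma tK_0 [simp]: "tK r 0 = 0"
  using tK_linear(2) [of r 0 0] by simp

lemma der_K_zero [simp]: "der_K 0 z = 0" "der_K D 0 = 0"
proof -
  show "der_K 0 z = 0" by transfer (simp add: der_K_rep_def complex_vector.span_zero)
  show "der_K D 0 = 0" by transfer (simp add: der_K_rep_def complex_vector.span_zero)
qed

lemma der_L_zero [simp]: "der_L 0 f = 0" "der_L D 0 = 0"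
  by (simp_all add: der_L_def)

lemma cvec_expand: "tK r (cvec k) = (\<Sum>i\<in>UNIV. of_int (k $ i) *\<^sub>C tK r (axis i 1))"
proof -
  have "cvec k = (\<Sum>i\<in>UNIV. of_int (k $ i) *\<^sub>C axis i (1::complex))"
    by (simp add: vec_eq_iff cvec_def scaleC_vec_def scaleC_complex_def axis_def if_distrib [of "(*) _"] cong: if_cong)
  moreover have "tK r (\<Sum>i\<in>A. w i) = (\<Sum>i\<in>A. tK r (w i))" if "finite A" for w and A :: "'a set"
    using that by induction (simp_all add: tK_linear)
  ultimately show ?thesis by (simp add: tK_linear)
qed

lemma dot_axis: "dot (axis i 1) v = v $ i"
  by (simp add: dot_def axis_def if_distrib [of "\<lambda>x. x * _"] cong: if_cong)

lemma sum_tKi: "(\<Sum>i\<in>UNIV. of_int (k $ i) *\<^sub>C tKi r i) = (0, tK r (cvec k), 0)"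
  unfolding cvec_expand by (simp add: prod_eq_iff tKi_def fst_sum snd_sum scaleC_prod_def)

lemma tau_bracket_LL:
  assumes "cbilinear (brk S)" "cbilinear (frm S)"
  shows "tau_bracket S (loopX k x) (loopX l y) = loopX (k + l) (brk S x y) +
    frm S x y *\<^sub>C (\<Sum>i\<in>UNIV. of_int (k $ i) *\<^sub>C tKi (k + l) i)"
proof -
  have "brk S 0 y = 0" "brk S x 0 = 0" "frm S 0 y = 0" "frm S x 0 = 0" for x y
    using assms unfolding cbilinear_def clinear_iff by (metis scaleC_zero_left)+
  then show ?thesis
    unfolding sum_tKi by (simp add: loopX_def pm_conv_single scaleC_prod_def)
qed

lemma tau_bracket_LZ: "tau_bracket S (loopX k x) (tKi s b) = 0" "tau_bracket S (tKi s b) (tKi r a) = 0"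
  by (simp_all add: loopX_def tKi_def zero_prod_def)

lemma tau_bracket_DL: "tau_bracket S (tdi r a) (loopX k x) = of_int (k $ a) *\<^sub>C loopX (k + r) x"
  by (simp add: tdi_def loopX_def der_L_def pm_conv_single dot_linear dot_axis scaleC_prod_def
      cvec_def add.commute single_clinear)

lemma tau_bracket_DZ:
  "tau_bracket S (tdi r a) (tKi s b :: ('g::complex_vector, 'n::finite) toroidal) = of_int (s $ a) *\<^sub>C tKi (r + s) b +
    (if a = b then (\<Sum>p\<in>UNIV. of_int (r $ p) *\<^sub>C tKi (r + s) p) else 0)"
  unfolding sum_tKi
  by (simp add: tdi_def tKi_def der_K_single dot_axis scaleC_prod_def scaleC_one)
     (simp add: axis_def cvec_def scaleC_one zero_prod_def)

lemma tau_bracket_DD: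
  "tau_bracket S (tdi r a) (tdi s b :: ('g::complex_vector, 'n::finite) toroidal) =
    of_int (s $ a) *\<^sub>C tdi (r + s) b - of_int (r $ b) *\<^sub>C tdi (r + s) a
    + coc1 S *\<^sub>C (of_int (- (s $ a * r $ b)) *\<^sub>C (\<Sum>p\<in>UNIV. of_int (r $ p) *\<^sub>C tKi (r + s) p))
    + coc2 S *\<^sub>C (of_int (r $ a * s $ b) *\<^sub>C (\<Sum>p\<in>UNIV. of_int (r $ p) *\<^sub>C tKi (r + s) p))"
proof -
  have sd: "Poly_Mapping.single k (x - y) = Poly_Mapping.single k x - Poly_Mapping.single k y"
    for k and x y :: "complex ^ 'n option"
    by (rule poly_mapping_eqI) (simp add: lookup_minus lookup_single when_def)
  show ?thesis
    unfolding sum_tKi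
    by (simp add: tdi_def pm_conv_single dot_linear dot_axis scaleC_prod_def sd cvec_def
        scaleC_scaleC algebra_simps flip: single_clinear(2) scaleC_add_left)
qed


subsection \<open>Triangular decompositions\<close>

text \<open>\<open>tau0\<close> is the degree zero part \<open>\<tau>\<^sub>0\<close> for \<open>d\<^sub>0\<close>, \<open>tau0_plus\<close> is \<open>\<tau>\<^sub>0(+)\<close>, \<open>tau0_weight0\<close> is
  \<open>\<tau>\<^sup>0\<close> (degree zero and \<open>\<hh>(0)\<close>-weight zero), \<open>tau_plus\<close> is \<open>\<tau>\<^sup>+ = \<tau>\<^sub>+ \<oplus> \<tau>\<^sub>0(+)\<close>.\<close>

definition g_sigma0 :: "('g::complex_vector, 'n::finite) toroidal_data \<Rightarrow> 'g set" where
  "g_sigma0 S = {x. aut S None x = x}"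

definition g_circ :: "('g::complex_vector, 'n::finite) toroidal_data \<Rightarrow> 'g set" where
  "g_circ S = {x \<in> g_sigma0 S. \<forall>h\<in>csa0 S. brk S h x = 0}"

definition g_sigma0_plus :: "('g::complex_vector, 'n::finite) toroidal_data \<Rightarrow> 'g set" where
  "g_sigma0_plus S = cspan (\<Union>a\<in>pos S. weight_space (brk S) (csa0 S) a (g_sigma0 S))"

text \<open>The joint eigenspace of \<open>\<sigma>\<^sub>1, \<dots>, \<sigma>\<^sub>n\<close> giving the component of degree \<open>k\<close> mod \<open>\<Gamma>\<close>.\<close>

definition eigen_n :: "('g::complex_vector, 'n::finite) toroidal_data \<Rightarrow> int ^ 'n \<Rightarrow> 'g set" where
  "eigen_n S k = {x. \<forall>i. aut S (Some i) x = (rou S (Some i) powi (k $ i)) *\<^sub>C x}"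

definition tau0 :: "('g::complex_vector, 'n::finite) toroidal_data \<Rightarrow> ('g, 'n) toroidal set" where
  "tau0 S = {X \<in> tau S. tau_bracket S (tdi 0 None) X = 0}"

definition tau0_plus :: "('g::complex_vector, 'n::finite) toroidal_data \<Rightarrow> ('g, 'n) toroidal set" where
  "tau0_plus S = cspan {loopX (emb k) x | k x.
     \<exists>a\<in>pos S. x \<in> weight_space (brk S) (csa0 S) a (eigen S (emb k))}"

definition tau0_weight0 :: "('g::complex_vector, 'n::finite) toroidal_data \<Rightarrow> ('g, 'n) toroidal set" where
  "tau0_weight0 S = {X \<in> tau0 S. \<forall>h\<in>csa0 S. tau_bracket S (loopX 0 h) X = 0}"

definition root_space :: "('g::complex_vector, 'n::finite) toroidal_data \<Rightarrow>
    ('g \<Rightarrow> complex) \<Rightarrow> int ^ 'n option \<Rightarrow> ('g, 'n) toroidal set" where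
  "root_space S a k = {X \<in> tau S. (\<forall>h\<in>csa0 S. tau_bracket S (loopX 0 h) X = a h *\<^sub>C X) \<and>
     (\<forall>i. tau_bracket S (tdi 0 i) X = of_int (k $ i) *\<^sub>C X)}"

definition tau_plus :: "nat \<Rightarrow> ('g::complex_vector, 'n::finite) toroidal_data \<Rightarrow> ('g, 'n) toroidal set" where
  "tau_plus b S = cspan (\<Union>{root_space S a k | a k.
     a \<in> enlarged_roots0 b S \<and> (k $ None > 0 \<or> k $ None = 0 \<and> a \<in> pos S)})"


section \<open>Modules\<close>

definition category_B :: "('g::complex_vector, 'n::finite) toroidal_data \<Rightarrow> (('g, 'n) toroidal \<Rightarrow> complex) \<Rightarrow>
    (('g, 'n) toroidal \<Rightarrow> 'v::complex_vector \<Rightarrow> 'v) \<Rightarrow> bool" where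
  "category_B S \<psi> \<rho> \<longleftrightarrow> lie_module (tau_bracket S) (tau S) \<rho> UNIV \<and>
     (let V = (\<lambda>c :: complex ^ 'n option. {v. \<forall>i. \<rho> (tdi 0 i) v = (c $ i) *\<^sub>C v}) in
      direct_sum UNIV UNIV V \<and> (\<forall>c. fin_dim (V c))) \<and>
     (\<forall>i v. \<rho> (tKi 0 i) v = \<psi> (tKi 0 i) *\<^sub>C v) \<and>
     (\<exists>B. \<forall>c v. v \<noteq> 0 \<and> \<rho> (tdi 0 None) v = c *\<^sub>C v \<longrightarrow> Re c \<le> B)"

definition top_space :: "nat \<Rightarrow> ('g::complex_vector, 'n::finite) toroidal_data \<Rightarrow>
    (('g, 'n) toroidal \<Rightarrow> 'v::complex_vector \<Rightarrow> 'v) \<Rightarrow> 'v set" where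
  "top_space b S \<rho> = {v. \<forall>X\<in>tau_plus b S. \<rho> X v = 0}"

text \<open>\<open>\<Lambda>\<close>-graded modules (on the whole type) over a subalgebra \<open>L\<close> of \<open>\<gg>(\<sigma>\<^sub>0)\<close>.\<close>

definition graded_module :: "('g::complex_vector, 'n::finite) toroidal_data \<Rightarrow> 'g set \<Rightarrow>
    ('g \<Rightarrow> 'm::complex_vector \<Rightarrow> 'm) \<Rightarrow> ((int ^ 'n) set \<Rightarrow> 'm set) \<Rightarrow> bool" where
  "graded_module S L act G \<longleftrightarrow> lie_module (brk S) L act UNIV \<and> direct_sum UNIV (Lambda S) G \<and>
     (\<forall>k l. \<forall>x\<in>L \<inter> eigen_n S k. \<forall>v\<in>G (coset S l). act x v \<in> G (coset S (k + l)))"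

definition graded_irreducible :: "('g::complex_vector, 'n::finite) toroidal_data \<Rightarrow> 'g set \<Rightarrow>
    ('g \<Rightarrow> 'm::complex_vector \<Rightarrow> 'm) \<Rightarrow> ((int ^ 'n) set \<Rightarrow> 'm set) \<Rightarrow> bool" where
  "graded_irreducible S L act G \<longleftrightarrow> graded_module S L act G \<and> (UNIV :: 'm set) \<noteq> {0} \<and>
     (\<forall>N. submodule L act UNIV N \<and> N = cspan (\<Union>q\<in>Lambda S. N \<inter> G q) \<longrightarrow> N = {0} \<or> N = UNIV)"


subsection \<open>The induced module and its graded irreducible quotient\<close>

text \<open>\<open>U(\<gg>(\<sigma>\<^sub>0)) \<otimes>\<^bsub>U(\<pp>)\<^esub> W\<^sub>2\<close>, where \<open>\<pp>\<close> is the sum of \<open>g_circ\<close> and \<open>g_sigma0_plus\<close>, is the quotient of the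
  space freely spanned by the \<open>x\<^sub>1 \<dots> x\<^sub>p \<otimes> w\<close> (\<open>ind_gen [x\<^sub>1, \<dots>, x\<^sub>p] w\<close>) by the span of \<open>ind_rel\<close>: the
  first four families express multilinearity, the fifth \<open>xy - yx = [x, y]\<close> in \<open>U(\<gg>(\<sigma>\<^sub>0))\<close>, the last
  two \<open>ux \<otimes> w = u \<otimes> xw\<close> for \<open>x\<close> in \<open>\<pp>\<close>.\<close>

definition ind_gen :: "'g list \<Rightarrow> 'w \<Rightarrow> ('g list \<times> 'w \<Rightarrow>\<^sub>0 complex)" where
  "ind_gen xs w = Poly_Mapping.single (xs, w) 1"

definition ind_free :: "('g::complex_vector, 'n::finite) toroidal_data \<Rightarrow> ('g list \<times> 'w \<Rightarrow>\<^sub>0 complex) set" where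
  "ind_free S = cspan {ind_gen xs w | xs w. set xs \<subseteq> g_sigma0 S}"

definition ind_rel :: "('g::complex_vector, 'n::finite) toroidal_data \<Rightarrow> ('g \<Rightarrow> 'w::complex_vector \<Rightarrow> 'w) \<Rightarrow>
    ('g list \<times> 'w \<Rightarrow>\<^sub>0 complex) set" where
  "ind_rel S act = (let U = {xs. set xs \<subseteq> g_sigma0 S} in
     {ind_gen (xs @ [x + y] @ ys) w - ind_gen (xs @ [x] @ ys) w - ind_gen (xs @ [y] @ ys) w | xs ys x y w.
        xs \<in> U \<and> ys \<in> U \<and> x \<in> g_sigma0 S \<and> y \<in> g_sigma0 S} \<union>
     {ind_gen (xs @ [c *\<^sub>C x] @ ys) w - c *\<^sub>C ind_gen (xs @ [x] @ ys) w | xs ys c x w.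
        xs \<in> U \<and> ys \<in> U \<and> x \<in> g_sigma0 S} \<union>
     {ind_gen xs (w + w') - ind_gen xs w - ind_gen xs w' | xs w w'. xs \<in> U} \<union>
     {ind_gen xs (c *\<^sub>C w) - c *\<^sub>C ind_gen xs w | xs c w. xs \<in> U} \<union>
     {ind_gen (xs @ [x, y] @ ys) w - ind_gen (xs @ [y, x] @ ys) w - ind_gen (xs @ [brk S x y] @ ys) w | xs ys x y w.
        xs \<in> U \<and> ys \<in> U \<and> x \<in> g_sigma0 S \<and> y \<in> g_sigma0 S} \<union>
     {ind_gen (xs @ [x]) w - ind_gen xs (act x w) | xs x w. xs \<in> U \<and> x \<in> g_circ S} \<union>
     {ind_gen (xs @ [x]) w | xs x w. xs \<in> U \<and> x \<in> g_sigma0_plus S})"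

definition ind_act :: "'g \<Rightarrow> ('g list \<times> 'w \<Rightarrow>\<^sub>0 complex) \<Rightarrow> ('g list \<times> 'w \<Rightarrow>\<^sub>0 complex)" where
  "ind_act x = pm_sum (\<lambda>(xs, w) c. Poly_Mapping.single (x # xs, w) c)"

definition ind_grade :: "('g::complex_vector, 'n::finite) toroidal_data \<Rightarrow> ((int ^ 'n) set \<Rightarrow> 'w::complex_vector set) \<Rightarrow>
    (int ^ 'n) set \<Rightarrow> ('g list \<times> 'w \<Rightarrow>\<^sub>0 complex) set" where
  "ind_grade S G q = cspan {ind_gen xs w | xs ks l w.
     list_all2 (\<lambda>x k. x \<in> g_sigma0 S \<inter> eigen_n S k) xs ks \<and> w \<in> G (coset S l) \<and>
     q = coset S (sum_list ks + l)}"

text \<open>The \<open>\<Lambda>\<close>-graded \<open>\<gg>(\<sigma>\<^sub>0)\<close>-module \<open>(act', G')\<close> is, through the projection \<open>\<pi>\<close>, an irreducible graded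
  quotient of the module induced from \<open>(act, G)\<close>.  Homomorphisms on the induced module are given
  as maps on the free space which kill the relations.\<close>

definition irreducible_quotient :: "('g::complex_vector, 'n::finite) toroidal_data \<Rightarrow>
    ('g \<Rightarrow> 'w::complex_vector \<Rightarrow> 'w) \<Rightarrow> ((int ^ 'n) set \<Rightarrow> 'w set) \<Rightarrow>
    ('g \<Rightarrow> 'u::complex_vector \<Rightarrow> 'u) \<Rightarrow> ((int ^ 'n) set \<Rightarrow> 'u set) \<Rightarrow>
    (('g list \<times> 'w \<Rightarrow>\<^sub>0 complex) \<Rightarrow> 'u) \<Rightarrow> bool" where
  "irreducible_quotient S act G act' G' \<pi> \<longleftrightarrow>
     graded_irreducible S (g_sigma0 S) act' G' \<and>
     clinear_on (ind_free S) \<pi> \<and> (\<forall>r\<in>ind_rel S act. \<pi> r = 0) \<and> \<pi> ` ind_free S = UNIV \<and>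
     (\<forall>x\<in>g_sigma0 S. \<forall>f\<in>ind_free S. \<pi> (ind_act x f) = act' x (\<pi> f)) \<and>
     (\<forall>q\<in>Lambda S. \<pi> ` ind_grade S G q = G' q)"


subsection \<open>The modules \<open>T'\<close> and \<open>S'\<close>\<close>

text \<open>\<open>\<Oplus>\<^sub>k W\<^sub>1 \<otimes> G(k + \<Gamma>) \<otimes> \<complex>t\<^sup>k\<close>\<close>

definition loop_space :: "('g, 'n::finite) toroidal_data \<Rightarrow> ((int ^ 'n) set \<Rightarrow> 'w::complex_vector set) \<Rightarrow>
    (int ^ 'n \<Rightarrow>\<^sub>0 ('w1::complex_vector, 'w) tensor) set" where
  "loop_space S G = {s. \<forall>k. Poly_Mapping.lookup s k \<in> cspan {v1 \<otimes>\<^sub>C v2 | v1 v2. v2 \<in> G (coset S k)}}"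

text \<open>The action of degree zero elements; exponents are read off through \<open>emb\<close>.\<close>

fun loop_act :: "(complex ^ 'n ^ 'n \<Rightarrow> 'w1::complex_vector \<Rightarrow> 'w1) \<Rightarrow>
    ('g::complex_vector \<Rightarrow> 'w::complex_vector \<Rightarrow> 'w) \<Rightarrow> complex ^ 'n \<Rightarrow> complex \<Rightarrow> complex \<Rightarrow>
    ('g, 'n::finite) toroidal \<Rightarrow> (int ^ 'n \<Rightarrow>\<^sub>0 ('w1, 'w) tensor) \<Rightarrow> (int ^ 'n \<Rightarrow>\<^sub>0 ('w1, 'w) tensor)" where
  "loop_act gl act \<alpha> d C0 (f, z, D) s =
     pm_conv (\<lambda>l x k v. Poly_Mapping.single (k + l) (tensor_map id (act x) v)) (Poly_Mapping.map_key emb f) s +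
     pm_conv (\<lambda>r c k v. Poly_Mapping.single (k + r) ((C0 * c) *\<^sub>C v)) (K0_part z) s +
     pm_conv (\<lambda>r u k v. Poly_Mapping.single (k + r)
         ((\<Sum>i\<in>UNIV. u $ Some i * (of_int (k $ i) + \<alpha> $ i)) *\<^sub>C v
          + (\<Sum>i\<in>UNIV. \<Sum>j\<in>UNIV. (u $ Some i * of_int (r $ j)) *\<^sub>C tensor_map (gl (matrix_unit j i)) id v)
          + (d * u $ None) *\<^sub>C v))
       (Poly_Mapping.map_key emb D) s"

text \<open>The map \<open>T' \<rightarrow> S'\<close> induced by a map \<open>\<iota> : W\<^sub>2 \<rightarrow> W\<^sub>2(\<sigma>\<^sub>0)\<close>.\<close>

definition loop_map :: "('w::complex_vector \<Rightarrow> 'u::complex_vector) \<Rightarrow>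
    (int ^ 'n \<Rightarrow>\<^sub>0 ('w1::complex_vector, 'w) tensor) \<Rightarrow> (int ^ 'n \<Rightarrow>\<^sub>0 ('w1, 'u) tensor)" where
  "loop_map \<iota> = Poly_Mapping.map (tensor_map id \<iota>)"

abbreviation tvec :: "'w1::complex_vector \<Rightarrow> 'w::complex_vector \<Rightarrow> int ^ 'n \<Rightarrow> (int ^ 'n \<Rightarrow>\<^sub>0 ('w1, 'w) tensor)" where
  "tvec v1 v2 k \<equiv> Poly_Mapping.single k (v1 \<otimes>\<^sub>C v2)"

lemma clinear_id: "clinear id"
  by (simp add: clinear_iff)

lemma map_key_emb_single: "Poly_Mapping.map_key emb (Poly_Mapping.single (emb k) x) = Poly_Mapping.single k x"
  by (rule poly_mapping_eqI) (auto simp: lookup_map_key_emb lookup_single when_def inj_eq [OF inj_emb])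

lemma map_key_emb_zero [simp]: "Poly_Mapping.map_key emb 0 = 0"
  by (rule poly_mapping_eqI) (simp add: lookup_map_key_emb)

lemma K0_part_zero [simp]: "K0_part 0 = 0"
  by transfer (rule poly_mapping_eqI, simp add: map.rep_eq)

lemma K0_part_tK: "K0_part (tK (emb r) w) = Poly_Mapping.single r (w $ None)"
  by transfer (rule poly_mapping_eqI, simp add: map_key_emb_single map.rep_eq lookup_single when_def)

lemma tensor_map_zero:
  assumes "\<And>a b. f a \<otimes>\<^sub>C g b = 0"
  shows "tensor_map f g v = 0"
  unfolding tensor_map_def assms by transfer (auto simp: pm_sum_def)

lemma tensor_0: "0 \<otimes>\<^sub>C b = 0" "a \<otimes>\<^sub>C 0 = 0"
  using tensor_linear(3) [of 0 0 b] tensor_linear(4) [of a 0 0] by simp_all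

lemma tensor_map_0 [simp]: "tensor_map f g 0 = 0"
  using clinear_tensor_map [of f g] unfolding clinear_iff by (metis scaleC_zero_left)

lemma loop_act_X:
  assumes "clinear (act x)" "\<And>v. act 0 v = 0"
  shows "loop_act gl act \<alpha> d C0 (loopX (emb l) x) (tvec v1 v2 k) = tvec v1 (act x v2) (k + l)"
  using assms
  by (simp add: loopX_def map_key_emb_single pm_conv_single tensor_map_zero tensor_0 tensor_map_tensor clinear_id)

lemma single_sum: "Poly_Mapping.single m (\<Sum>j\<in>A. w j) = (\<Sum>j\<in>A. Poly_Mapping.single m (w j))"
  by (induction A rule: infinite_finite_induct) (simp_all add: single_add)

lemma loop_act_D:
  assumes "\<And>A. clinear (gl A)"
  shows "loop_act gl act \<alpha> d C0 (tdi (emb r) (Some i)) (tvec v1 v2 k) =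
    (of_int (k $ i) + \<alpha> $ i) *\<^sub>C tvec v1 v2 (k + r) +
    (\<Sum>j\<in>UNIV. of_int (r $ j) *\<^sub>C tvec (gl (matrix_unit j i) v1) v2 (k + r))"
proof -
  have e: "axis (Some i) (1::complex) $ Some j = (if j = i then 1 else 0)" for j
    by (simp add: axis_def)
  show ?thesis
    by (simp add: tdi_def map_key_emb_single pm_conv_single e tensor_map_tensor assms clinear_id single_add
        single_clinear(2) if_distrib [of "\<lambda>c. c * _"] if_distrib [of "\<lambda>c. c *\<^sub>C _"] cong: if_cong)
       ((simp add: axis_def)?, subst sum.swap, simp add: single_sum single_clinear(2))
qed

lemma loop_act_d0:
  "loop_act gl act \<alpha> d C0 (tdi (emb r) None) (tvec v1 v2 k) = d *\<^sub>C tvec v1 v2 (k + r)"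
  by (simp add: tdi_def map_key_emb_single pm_conv_single axis_def single_clinear(2))

lemma loop_act_K0:
  "loop_act gl act \<alpha> d C0 (tKi (emb r) None) (tvec v1 v2 k) = C0 *\<^sub>C tvec v1 v2 (k + r)"
  by (simp add: tKi_def K0_part_tK pm_conv_single axis_def single_clinear(2))

lemma loop_act_K:
  "loop_act gl act \<alpha> d C0 (tKi (emb r) (Some p)) (tvec v1 v2 k) = 0"
  by (simp add: tKi_def K0_part_tK axis_def)

end

theory Submission
  imports Defs "HOL-Computational_Algebra.Fundamental_Theorem_Algebra"
begin

text \<open>
  Both claims are about the \<open>\<tau>\<^sub>0\<close>-module \<open>S' = \<Oplus>\<^sub>k W\<^sub>1 \<otimes> W\<^sub>2(\<sigma>\<^sub>0)\<^sub>k \<otimes> t\<^sup>k\<close> and follow from the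
  irreducibility of its two factors.

  \<^emph>\<open>Module.\<close>  \<open>\<tau>\<^sub>0\<close> is spanned by the elements \<open>X t\<^sup>l\<close>, \<open>t\<^sup>r K\<^sub>p\<close> and \<open>D(u, r)\<close> with exponents in \<open>\<int>\<^sup>n\<close>, because
  \<open>d\<^sub>0\<close> acts on the generators of \<open>\<tau>\<close> by their first exponent (\<open>tau0_span_deg_gens\<close>).  The bracket
  and the action are bilinear, so the module axiom is checked on pairs of such elements
  (\<open>deg_gens_defect\<close>).  The terms that the form and the cocycles add to the brackets are
  multiples of \<open>\<Sum>\<^sub>p r\<^sub>p t\<^sup>s K\<^sub>p\<close> with \<open>r\<^sub>0 = 0\<close>: they contain no \<open>K\<^sub>0\<close> and hence act by zero.  On the first factor
  \<open>D(u, r)\<close> acts by the matrix \<open>r u\<^sup>T\<close>, and the commutator of two such matrices is again a combination of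
  matrices of this form.

  \<^emph>\<open>Irreducibility.\<close>  Let \<open>N\<close> be a submodule.  The \<open>d\<^sub>i\<close> make it \<open>\<int>\<^sup>n\<close>-graded (\<open>N_components\<close>).  Since
  \<open>C\<^sub>0 \<noteq> 0\<close>, the \<open>t\<^sup>r K\<^sub>0\<close> make it stable under multiplication with \<open>t\<^sup>r\<close>, \<open>r \<in> \<Gamma>\<close> (\<open>N_shift\<close>); comparing
  this with the \<open>D(u, r)\<close> shows that each \<open>N\<^sub>k \<subseteq> W\<^sub>1 \<otimes> W\<^sub>2(\<sigma>\<^sub>0)\<close> is stable under \<open>gl\<^sub>n\<close> acting on \<open>W\<^sub>1\<close> alone
  (\<open>N_gl\<close>).  By the density theorem for the irreducible module \<open>W\<^sub>1\<close>, \<open>N\<^sub>k = W\<^sub>1 \<otimes> P\<^sub>k\<close>.  The \<open>P\<^sub>k\<close> depend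
  only on \<open>k\<close> modulo \<open>\<Gamma>\<close> and form a graded submodule of \<open>W\<^sub>2(\<sigma>\<^sub>0)\<close>, which is zero or everything
  (\<open>N_trivial\<close>).

  \<^emph>\<open>Top space.\<close>  In coordinates with respect to a basis of \<open>W\<^sub>1\<close>, a vector of \<open>S'\<close> is killed by
  \<open>\<tau>\<^sub>0(+)\<close> iff its coordinates in \<open>W\<^sub>2(\<sigma>\<^sub>0)\<close> are killed by all positive weight vectors.  So the point
  is that homogeneous singular vectors of \<open>W\<^sub>2(\<sigma>\<^sub>0)\<close> lie in the image of \<open>W\<^sub>2\<close>
  (\<open>singular_vectors_are_incl\<close>).  Let \<open>R\<close> be the span of everything that a negative weight vector
  produces.  Modulo \<open>R\<close> every vector comes from \<open>W\<^sub>2\<close>, so a singular vector may be assumed to lie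
  in \<open>R\<close>; such a vector generates a graded submodule inside \<open>R\<close>.  But \<open>R\<close> is proper, because
  \<open>\<hh>(0)\<close> acts on \<open>W\<^sub>2\<close> by a single weight (graded Schur lemma, \<open>csa0_scalar\<close>) while \<open>R\<close> has only
  strictly lower weights.  Irreducibility leaves only zero.
\<close>

section \<open>Joint eigenvectors\<close>

lemmas csubspace_scale = complex_vector.subspace_scale
lemmas csubspace_add = complex_vector.subspace_add
lemmas csubspace_zero = complex_vector.subspace_0
lemmas csubspaceI = complex_vector.subspaceI
lemmas cspan_base = complex_vector.span_base
lemmas cspan_zero = complex_vector.span_zero
lemmas cspan_minimal = complex_vector.span_minimal
lemmas cspan_sum = complex_vector.span_sum
lemmas cspan_add = complex_vector.span_add
lemmas cspan_mono = complex_vector.span_mono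

abbreviation "single \<equiv> Poly_Mapping.single"
abbreviation "lookup \<equiv> Poly_Mapping.lookup"
abbreviation "keys \<equiv> Poly_Mapping.keys"

lemma clinear_0: "clinear f \<Longrightarrow> f 0 = 0"
  unfolding clinear_iff by (metis scaleC_zero_left)

text \<open>Applying \<open>T\<^sub>j - \<mu>\<^sub>p\<^sub>j\<close> to a sum of joint eigenvectors removes the \<open>p\<close>-th summand and rescales the
  others, the \<open>i\<close>-th one by a non-zero factor if \<open>j\<close> separates \<open>i\<close> from \<open>p\<close>; so the number of
  summands can be lowered without leaving \<open>N\<close>.  With \<open>N = {0}\<close> this is the linear independence of
  joint eigenspaces; with a submodule \<open>N\<close> it says that \<open>N\<close> is graded.\<close>

lemma stable_subspace_components:
  fixes T :: "'j \<Rightarrow> 'a::complex_vector \<Rightarrow> 'a"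
  assumes "finite F" and "csubspace N"
    and "\<And>j w. j \<in> J \<Longrightarrow> w \<in> N \<Longrightarrow> T j w \<in> N"
    and "\<And>j. j \<in> J \<Longrightarrow> clinear (T j)"
    and "\<And>i j. i \<in> F \<Longrightarrow> j \<in> J \<Longrightarrow> T j (v i) = \<mu> i j *\<^sub>C v i"
    and "\<And>i i'. i \<in> F \<Longrightarrow> i' \<in> F \<Longrightarrow> i \<noteq> i' \<Longrightarrow> \<exists>j\<in>J. \<mu> i j \<noteq> \<mu> i' j"
    and "(\<Sum>i\<in>F. v i) \<in> N"
  shows "\<forall>i\<in>F. v i \<in> N"
  using assms(1,5-7)
proof (induction F arbitrary: v rule: finite_induct)
  case empty
  then show ?case by simp
next
  case (insert p F)
  have rest: "v i \<in> N" if i: "i \<in> F" for i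
  proof -
    obtain j where j: "j \<in> J" "\<mu> i j \<noteq> \<mu> p j"
      using insert.prems(2) [of i p] insert.hyps i by auto
    interpret Tj: Vector_Spaces.linear scaleC scaleC "T j" by (rule assms(4)) (rule j)
    define w where "w k = (\<mu> k j - \<mu> p j) *\<^sub>C v k" for k
    have "T j (\<Sum>k\<in>insert p F. v k) - \<mu> p j *\<^sub>C (\<Sum>k\<in>insert p F. v k) = (\<Sum>k\<in>insert p F. w k)"
      using insert.prems(1) j
      by (simp add: Tj.sum w_def complex_vector.scale_sum_right complex_vector.scale_left_diff_distrib sum_subtractf
          del: sum.insert)
    also have "\<dots> = (\<Sum>k\<in>F. w k)"
      using insert.hyps by (simp add: w_def)
    finally have "(\<Sum>k\<in>F. w k) \<in> N"
      using insert.prems(3) assms(2,3) j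
      by (metis complex_vector.subspace_diff csubspace_scale)
    moreover have "T k (w l) = \<mu> l k *\<^sub>C w l" if "l \<in> F" "k \<in> J" for l k
    proof -
      interpret Tk: Vector_Spaces.linear scaleC scaleC "T k" by (rule assms(4)) (rule that)
      show ?thesis using insert.prems(1) [of l k] that
        by (simp add: w_def Tk.scale scaleC_scaleC mult.commute)
    qed
    ultimately have "w i \<in> N"
      using insert.IH [of w] insert.prems(2) i by blast
    then have "inverse (\<mu> i j - \<mu> p j) *\<^sub>C w i \<in> N"
      using assms(2) by (rule csubspace_scale [rotated])
    then show ?thesis using j by (simp add: w_def scaleC_scaleC scaleC_one)
  qed
  have "v p = (\<Sum>i\<in>insert p F. v i) - (\<Sum>i\<in>F. v i)"
    using insert.hyps by simp
  also have "\<dots> \<in> N"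
    by (rule complex_vector.subspace_diff [OF assms(2) insert.prems(3)])
       (rule complex_vector.subspace_sum [OF assms(2) rest])
  finally show ?case using rest by blast
qed

lemma span_UN_finite_sum:
  fixes X :: "'i \<Rightarrow> 'a::complex_vector set"
  assumes "v \<in> cspan (\<Union>i\<in>I. X i)"
  obtains F e where "finite F" "F \<subseteq> I" "\<And>i. i \<in> F \<Longrightarrow> e i \<in> cspan (X i)" "v = (\<Sum>i\<in>F. e i)"
proof -
  let ?P = "\<lambda>v. \<exists>F e. finite F \<and> F \<subseteq> I \<and> (\<forall>i. e i \<in> cspan (X i)) \<and> v = (\<Sum>i\<in>F. e i)"
  have "?P v"
    using assms
  proof (rule complex_vector.span_induct)
    show "csubspace (Collect ?P)"
    proof (rule csubspaceI)
      show "0 \<in> Collect ?P"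
        by (auto intro!: exI [of _ "{}"] exI [of _ "\<lambda>_. 0"] simp: cspan_zero)
      show "c *\<^sub>C x \<in> Collect ?P" if "x \<in> Collect ?P" for c x
      proof -
        from that obtain F e where F: "finite F" "F \<subseteq> I" "\<forall>i. e i \<in> cspan (X i)" "x = (\<Sum>i\<in>F. e i)"
          by auto
        show ?thesis
          by (intro CollectI exI [of _ F] exI [of _ "\<lambda>i. c *\<^sub>C e i"])
             (use F in \<open>auto simp: complex_vector.scale_sum_right complex_vector.span_scale\<close>)
      qed
      show "x + y \<in> Collect ?P" if "x \<in> Collect ?P" "y \<in> Collect ?P" for x y
      proof -
        from that obtain F e G g where F: "finite F" "F \<subseteq> I" "\<forall>i. e i \<in> cspan (X i)" "x = (\<Sum>i\<in>F. e i)"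
          and G: "finite G" "G \<subseteq> I" "\<forall>i. g i \<in> cspan (X i)" "y = (\<Sum>i\<in>G. g i)"
          by auto
        have "x = (\<Sum>i\<in>F \<union> G. if i \<in> F then e i else 0)" "y = (\<Sum>i\<in>F \<union> G. if i \<in> G then g i else 0)"
          unfolding F G by (rule sum.mono_neutral_cong_left; use F G in auto)+
        then have "x + y = (\<Sum>i\<in>F \<union> G. (if i \<in> F then e i else 0) + (if i \<in> G then g i else 0))"
          by (simp add: sum.distrib)
        then show ?thesis
          using F G
          by (intro CollectI exI [of _ "F \<union> G"] exI [of _ "\<lambda>i. (if i \<in> F then e i else 0) + (if i \<in> G then g i else 0)"])
             (auto simp: cspan_zero intro!: cspan_add)
      qed
    qed
    show "?P x" if "x \<in> (\<Union>i\<in>I. X i)" for x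
    proof -
      from that obtain i where i: "i \<in> I" "x \<in> X i" by blast
      show ?thesis
        by (intro exI [of _ "{i}"] exI [of _ "\<lambda>k. if k = i then x else 0"])
           (use i in \<open>auto simp: cspan_zero cspan_base\<close>)
    qed
  qed
  then show thesis using that by blast
qed

text \<open>The joint eigenspace for \<open>\<nu>\<close> is itself a stable subspace, so it contains every component of
  \<open>v\<close>; a component whose eigenvalues differ from \<open>\<nu>\<close> is then zero.\<close>

lemma joint_eigenvector_in_span:
  fixes T :: "'j \<Rightarrow> 'a::complex_vector \<Rightarrow> 'a"
  assumes lin: "\<And>j. j \<in> J \<Longrightarrow> clinear (T j)"
    and eig: "\<And>i j x. i \<in> I \<Longrightarrow> j \<in> J \<Longrightarrow> x \<in> X i \<Longrightarrow> T j x = \<mu> i j *\<^sub>C x"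
    and dist: "\<And>i i'. i \<in> I \<Longrightarrow> i' \<in> I \<Longrightarrow> i \<noteq> i' \<Longrightarrow> \<exists>j\<in>J. \<mu> i j \<noteq> \<mu> i' j"
    and v: "v \<in> cspan (\<Union>i\<in>I. X i)" "\<And>j. j \<in> J \<Longrightarrow> T j v = \<nu> j *\<^sub>C v"
  shows "v \<in> cspan (\<Union>i\<in>{i\<in>I. \<forall>j\<in>J. \<mu> i j = \<nu> j}. X i)"
proof -
  obtain F e where F: "finite F" "F \<subseteq> I" "\<And>i. i \<in> F \<Longrightarrow> e i \<in> cspan (X i)" "v = (\<Sum>i\<in>F. e i)"
    by (rule span_UN_finite_sum [OF v(1)]) blast
  have eigsub: "csubspace {w. \<forall>j\<in>J. T j w = a j *\<^sub>C w}" for a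
    by (rule csubspaceI)
       (use lin in \<open>auto simp: clinear_iff scaleC_add_right scaleC_scaleC mult.commute
          clinear_0\<close>)
  have e: "T j (e i) = \<mu> i j *\<^sub>C e i" if "i \<in> F" "j \<in> J" for i j
  proof -
    have "cspan (X i) \<subseteq> {w. \<forall>j\<in>J. T j w = \<mu> i j *\<^sub>C w}"
      by (rule cspan_minimal) (use eigsub eig that F in auto)
    with F(3) that show ?thesis by blast
  qed
  have distF: "\<exists>j\<in>J. \<mu> i j \<noteq> \<mu> i' j" if "i \<in> F" "i' \<in> F" "i \<noteq> i'" for i i'
    by (rule dist) (use that F in auto)
  have all: "\<forall>i\<in>F. e i \<in> {w. \<forall>j\<in>J. T j w = \<nu> j *\<^sub>C w}"
  proof (rule stable_subspace_components [where J = J and T = T and \<mu> = \<mu>])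
    fix j w assume "j \<in> J" "w \<in> {w. \<forall>j\<in>J. T j w = \<nu> j *\<^sub>C w}"
    then show "T j w \<in> {w. \<forall>j\<in>J. T j w = \<nu> j *\<^sub>C w}"
      using eigsub [of \<nu>] csubspace_scale by force
  qed (use F eigsub lin e distF v in auto)
  have zero: "e i = 0" if i: "i \<in> F" "\<not> (\<forall>j\<in>J. \<mu> i j = \<nu> j)" for i
  proof -
    from i obtain j where j: "j \<in> J" "\<mu> i j \<noteq> \<nu> j" by blast
    have "\<mu> i j *\<^sub>C e i = \<nu> j *\<^sub>C e i" using e i all j by auto
    then show ?thesis using j by simp
  qed
  have "v = (\<Sum>i\<in>{i\<in>F. \<forall>j\<in>J. \<mu> i j = \<nu> j}. e i)"
    unfolding F(4) by (rule sum.mono_neutral_right) (use F zero in auto)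
  also have "\<dots> \<in> cspan (\<Union>i\<in>{i\<in>I. \<forall>j\<in>J. \<mu> i j = \<nu> j}. X i)"
  proof (rule cspan_sum)
    fix i assume i: "i \<in> {i\<in>F. \<forall>j\<in>J. \<mu> i j = \<nu> j}"
    then have "cspan (X i) \<subseteq> cspan (\<Union>i\<in>{i\<in>I. \<forall>j\<in>J. \<mu> i j = \<nu> j}. X i)"
      using F(2) by (intro cspan_mono) auto
    then show "e i \<in> cspan (\<Union>i\<in>{i\<in>I. \<forall>j\<in>J. \<mu> i j = \<nu> j}. X i)" using F(3) i by blast
  qed
  finally show ?thesis .
qed

text \<open>The components of \<open>x\<close> in the eigenspaces of \<open>T\<close> inherit the eigenvalue equations of every
  operator that commutes with \<open>T\<close>, because those equations hold componentwise.\<close>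

lemma eigenvectors_span_within_eigenspace:
  fixes T :: "'a::complex_vector \<Rightarrow> 'a"
  assumes T: "clinear T" "x \<in> cspan {y. \<exists>c\<in>C. T y = c *\<^sub>C y}"
    and Q: "\<And>A c. (A, c) \<in> Q \<Longrightarrow> clinear A" "\<And>A c y. (A, c) \<in> Q \<Longrightarrow> A (T y) = T (A y)"
      "\<And>A c. (A, c) \<in> Q \<Longrightarrow> A x = c *\<^sub>C x"
  shows "x \<in> cspan {y. (\<exists>c\<in>C. T y = c *\<^sub>C y) \<and> (\<forall>(A, c)\<in>Q. A y = c *\<^sub>C y)}"
proof -
  interpret T: Vector_Spaces.linear scaleC scaleC T by (fact T)
  define E where "E c = {y. T y = c *\<^sub>C y}" for c
  have Esub: "csubspace (E c)" for c
    unfolding E_def by (rule csubspaceI)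
      (auto simp: T.add T.scale scaleC_add_right scaleC_scaleC mult.commute)
  have "{y. \<exists>c\<in>C. T y = c *\<^sub>C y} = (\<Union>c\<in>C. E c)" by (auto simp: E_def)
  with T(2) have "x \<in> cspan (\<Union>c\<in>C. E c)" by simp
  then obtain F e where F: "finite F" "F \<subseteq> C" "\<And>c. c \<in> F \<Longrightarrow> e c \<in> cspan (E c)" "x = (\<Sum>c\<in>F. e c)"
    by (rule span_UN_finite_sum) blast
  have e: "e c \<in> E c" if "c \<in> F" for c
    using F(3) [OF that] by (simp add: complex_vector.span_eq_iff [THEN iffD2, OF Esub])
  have "A (e c) = a *\<^sub>C e c" if A: "(A, a) \<in> Q" and c: "c \<in> F" for A a c
  proof -
    interpret A: Vector_Spaces.linear scaleC scaleC A using Q(1) A by blast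
    have "\<forall>i\<in>F. A (e i) - a *\<^sub>C e i \<in> {0}"
    proof (rule stable_subspace_components [where J = UNIV and T = "\<lambda>_. T" and \<mu> = "\<lambda>i (_::unit). i"])
      have "(\<Sum>i\<in>F. A (e i) - a *\<^sub>C e i) = A x - a *\<^sub>C x"
        unfolding F(4) by (simp add: A.sum complex_vector.scale_sum_right sum_subtractf)
      then show "(\<Sum>i\<in>F. A (e i) - a *\<^sub>C e i) \<in> {0}" using Q(3) A by simp
      show "T (A (e i) - a *\<^sub>C e i) = i *\<^sub>C (A (e i) - a *\<^sub>C e i)" if "i \<in> F" for i
        using e [OF that] Q(2) [OF A, symmetric]
        by (simp add: E_def T.diff T.scale A.scale complex_vector.scale_right_diff_distrib scaleC_scaleC mult.commute)
    qed (use F T in auto)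
    then show ?thesis using c by simp
  qed
  then show ?thesis
    unfolding F(4) using F e by (intro cspan_sum cspan_base) (auto simp: E_def)
qed

text \<open>Simultaneous diagonalization.  The set \<open>Q\<close> records eigenvalue equations which \<open>x\<close> already
  satisfies and which its components keep; for the induction it has to grow by the eigenvalues for
  the operators treated before.\<close>

lemma joint_eigenvectors_span:
  fixes T :: "'i \<Rightarrow> 'a::complex_vector \<Rightarrow> 'a"
  assumes "finite I"
    and T: "\<And>i. i \<in> I \<Longrightarrow> clinear (T i)" "\<And>i x. i \<in> I \<Longrightarrow> x \<in> cspan {y. \<exists>c\<in>C i. T i y = c *\<^sub>C y}"
      "\<And>i j x. i \<in> I \<Longrightarrow> j \<in> I \<Longrightarrow> T i (T j x) = T j (T i x)"
    and Q: "\<And>A c. (A, c) \<in> Q \<Longrightarrow> clinear A" "\<And>A c i y. (A, c) \<in> Q \<Longrightarrow> i \<in> I \<Longrightarrow> A (T i y) = T i (A y)"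
      "\<And>A c. (A, c) \<in> Q \<Longrightarrow> A x = c *\<^sub>C x"
  shows "x \<in> cspan {y. (\<forall>i\<in>I. \<exists>c\<in>C i. T i y = c *\<^sub>C y) \<and> (\<forall>(A, c)\<in>Q. A y = c *\<^sub>C y)}"
  using assms(1-4,6)
proof (induction I rule: finite_induct)
  case empty
  then show ?case using Q(3) by (intro cspan_base) auto
next
  case (insert p I)
  let ?G = "\<lambda>I. {y. (\<forall>i\<in>I. \<exists>c\<in>C i. T i y = c *\<^sub>C y) \<and> (\<forall>(A, c)\<in>Q. A y = c *\<^sub>C y)}"
  have "x \<in> cspan (?G I)"
    by (rule insert.IH; (rule insert.prems)?; simp)
  moreover have "?G I \<subseteq> cspan (?G (insert p I))"
  proof
    fix y assume y: "y \<in> ?G I"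
    then obtain c where c: "\<And>i. i \<in> I \<Longrightarrow> c i \<in> C i \<and> T i y = c i *\<^sub>C y" by simp metis
    \<comment> \<open>Decompose \<open>y\<close> further by \<open>T p\<close>, keeping all eigenvalue equations obtained so far.\<close>
    let ?Q = "Q \<union> {(T i, c i) | i. i \<in> I}"
    have "y \<in> cspan {y. (\<exists>c\<in>C p. T p y = c *\<^sub>C y) \<and> (\<forall>(A, c)\<in>?Q. A y = c *\<^sub>C y)}"
    proof (rule eigenvectors_span_within_eigenspace)
      show "clinear (T p)" by (rule insert.prems) simp
      show "y \<in> cspan {y. \<exists>c\<in>C p. T p y = c *\<^sub>C y}" by (rule insert.prems) simp
      fix A a assume A: "(A, a) \<in> ?Q"
      then consider "(A, a) \<in> Q" | i where "i \<in> I" "A = T i" "a = c i" by blast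
      note cs = this
      show "clinear A"
        using cs by cases (auto intro: Q(1) insert.prems(1))
      show "A y = a *\<^sub>C y"
        using cs by cases (use y c in auto)
      fix z show "A (T p z) = T p (A z)"
        using cs by cases (auto intro: insert.prems(3,4))
    qed
    also have "\<dots> \<subseteq> cspan (?G (insert p I))"
      using c by (intro cspan_mono) blast
    finally show "y \<in> cspan (?G (insert p I))" .
  qed
  ultimately show ?case
    by (metis (no_types, lifting) cspan_minimal complex_vector.subspace_span subsetD)
qed

section \<open>Eigenvalues, Schur's lemma and density\<close>

text \<open>The vectors \<open>T\<^sup>i v\<close> are linearly dependent, so some non-zero polynomial \<open>p\<close> satisfies \<open>p(T) v = 0\<close>.
  Take \<open>p\<close> of least degree and split off a root \<open>z\<close>: if \<open>p = (X - z) q\<close>, then \<open>q(T) v\<close> is an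
  eigenvector for \<open>z\<close>.\<close>

lemma exists_eigenvector:
  fixes T :: "'a::complex_vector \<Rightarrow> 'a"
  assumes "clinear T" "fin_dim (UNIV :: 'a set)" "(UNIV :: 'a set) \<noteq> {0}"
  obtains c v where "v \<noteq> 0" "T v = c *\<^sub>C v"
proof -
  interpret T: Vector_Spaces.linear scaleC scaleC T by (fact assms(1))
  obtain v :: 'a where v: "v \<noteq> 0" using assms(3) by blast
  obtain B :: "'a set" where B: "finite B" "cspan B = UNIV"
    using assms(2) unfolding fin_dim_def by blast
  define E where "E p = (\<Sum>i\<le>degree p. coeff p i *\<^sub>C (T ^^ i) v)" for p
  have E: "E p = (\<Sum>i\<le>n. coeff p i *\<^sub>C (T ^^ i) v)" if "degree p \<le> n" for p n
    unfolding E_def using that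
    by (intro sum.mono_neutral_left) (auto simp: coeff_eq_0 not_le)
  have E_mult: "E ([:- z, 1:] * q) = T (E q) - z *\<^sub>C E q" for z q
  proof -
    let ?n = "degree q"
    have d: "degree ([:- z, 1:] * q) \<le> Suc ?n"
      using degree_mult_le [of "[:- z, 1:]" q] by simp
    have "E ([:- z, 1:] * q) = (\<Sum>i\<le>Suc ?n. (coeff (pCons 0 q) i - z * coeff q i) *\<^sub>C (T ^^ i) v)"
      unfolding E [OF d] by (rule sum.cong) auto
    also have "\<dots> = (\<Sum>i\<le>Suc ?n. coeff (pCons 0 q) i *\<^sub>C (T ^^ i) v) - z *\<^sub>C (\<Sum>i\<le>Suc ?n. coeff q i *\<^sub>C (T ^^ i) v)"
      by (simp only: complex_vector.scale_left_diff_distrib sum_subtractf complex_vector.scale_sum_right scaleC_scaleC)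
    also have "(\<Sum>i\<le>Suc ?n. coeff q i *\<^sub>C (T ^^ i) v) = E q"
      by (rule E [symmetric]) simp
    also have "(\<Sum>i\<le>Suc ?n. coeff (pCons 0 q) i *\<^sub>C (T ^^ i) v) = T (E q)"
      unfolding sum.atMost_Suc_shift E_def by (simp add: T.sum T.scale)
    finally show ?thesis .
  qed
  \<comment> \<open>Two equal vectors \<open>T\<^sup>i v\<close> give a relation directly; otherwise there are more than \<open>card B\<close> vectors in the span of \<open>B\<close>.\<close>
  have "\<exists>p. p \<noteq> 0 \<and> E p = 0"
  proof (cases "inj_on (\<lambda>i. (T ^^ i) v) {..card B}")
    case False
    then obtain i j where ij: "i \<noteq> j" "(T ^^ i) v = (T ^^ j) v" unfolding inj_on_def by blast
    let ?p = "monom 1 i - monom (1::complex) j"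
    have "?p \<noteq> 0" using ij(1) by (metis coeff_monom diff_0_right coeff_diff coeff_0 zero_neq_one)
    moreover have "E ?p = 0"
    proof -
      have "E ?p = (\<Sum>k\<le>max i j. coeff ?p k *\<^sub>C (T ^^ k) v)"
        by (rule E) (metis degree_diff_le degree_monom_le le_trans max.cobounded1 max.cobounded2)
      also have "\<dots> = (T ^^ i) v - (T ^^ j) v"
        by (simp add: complex_vector.scale_left_diff_distrib sum_subtractf if_distrib [of "\<lambda>c. c *\<^sub>C _"]
            scaleC_one cong: if_cong)
      finally show ?thesis using ij by simp
    qed
    ultimately show ?thesis by blast
  next
    case True
    let ?I = "(\<lambda>i. (T ^^ i) v) ` {..card B}"
    have "complex_vector.dependent ?I"
    proof (rule ccontr)
      assume "\<not> complex_vector.dependent ?I"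
      from complex_vector.independent_span_bound [OF B(1) this] B(2) card_image [OF True]
      show False by simp
    qed
    then obtain u w where u: "(\<Sum>w\<in>?I. u w *\<^sub>C w) = 0" "w \<in> ?I" "u w \<noteq> 0"
      using complex_vector.dependent_finite [of ?I] by auto
    define p where "p = (\<Sum>i\<le>card B. monom (u ((T ^^ i) v)) i)"
    have cp: "coeff p i = (if i \<le> card B then u ((T ^^ i) v) else 0)" for i
      by (simp add: p_def coeff_sum if_distrib cong: if_cong)
    have "E p = (\<Sum>i\<le>card B. coeff p i *\<^sub>C (T ^^ i) v)"
      by (rule E) (simp add: degree_le cp)
    also have "\<dots> = 0"
      using u(1) by (simp add: cp sum.reindex [OF True])
    finally have "E p = 0" .
    moreover have "p \<noteq> 0" using u(2,3) cp by (metis (no_types, lifting) atMost_iff coeff_0 imageE)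
    ultimately show ?thesis by blast
  qed
  then have "\<exists>n p. degree p = n \<and> p \<noteq> 0 \<and> E p = 0" by blast
  from this [THEN LeastI_ex] obtain p where p0: "degree p = (LEAST n. \<exists>p. degree p = n \<and> p \<noteq> 0 \<and> E p = 0)"
    and p: "p \<noteq> 0" "E p = 0" by blast
  have least: "degree p \<le> degree q" if "q \<noteq> 0" "E q = 0" for q
    unfolding p0 by (rule Least_le) (use that in blast)
  have "degree p \<noteq> 0"
  proof
    assume "degree p = 0"
    then obtain a where "p = [:a:]" by (rule degree_eq_zeroE)
    with p v show False by (simp add: E_def)
  qed
  then obtain z where "poly p z = 0"
    using fundamental_theorem_of_algebra [of p] by (auto simp: constant_degree)
  then obtain q where q: "p = [:- z, 1:] * q" by (metis dvdE poly_eq_0_iff_dvd)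
  with p(1) have q0: "q \<noteq> 0" by auto
  then have "degree p = Suc (degree q)" unfolding q by (subst degree_mult_eq) auto
  with least [of q] q0 have "E q \<noteq> 0" by auto
  moreover have "T (E q) = z *\<^sub>C E q" using p(2) E_mult q by simp
  ultimately show thesis by (rule that)
qed


text \<open>The unital associative algebra generated by \<open>Ops\<close>.\<close>

inductive_set op_alg :: "('a::complex_vector \<Rightarrow> 'a) set \<Rightarrow> ('a \<Rightarrow> 'a) set" for Ops where
  op_id: "(\<lambda>v. v) \<in> op_alg Ops"
| op_gen: "f \<in> Ops \<Longrightarrow> f \<in> op_alg Ops"
| op_comp: "f \<in> op_alg Ops \<Longrightarrow> g \<in> op_alg Ops \<Longrightarrow> (\<lambda>v. f (g v)) \<in> op_alg Ops"
| op_add: "f \<in> op_alg Ops \<Longrightarrow> g \<in> op_alg Ops \<Longrightarrow> (\<lambda>v. f v + g v) \<in> op_alg Ops"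
| op_scale: "f \<in> op_alg Ops \<Longrightarrow> (\<lambda>v. c *\<^sub>C f v) \<in> op_alg Ops"

definition irreducible_ops :: "('a::complex_vector \<Rightarrow> 'a) set \<Rightarrow> bool" where
  "irreducible_ops Ops \<longleftrightarrow> (\<forall>f\<in>Ops. clinear f) \<and>
     (\<forall>N. csubspace N \<longrightarrow> (\<forall>f\<in>Ops. \<forall>v\<in>N. f v \<in> N) \<longrightarrow> N = {0} \<or> N = UNIV)"

lemma op_alg_clinear:
  assumes "irreducible_ops Ops" "f \<in> op_alg Ops" shows "clinear f"
  using assms(2)
  by induction (use assms(1) in \<open>auto simp: irreducible_ops_def clinear_iff scaleC_add_right scaleC_scaleC mult.commute\<close>)

lemma schur:
  fixes \<phi> :: "'a::complex_vector \<Rightarrow> 'a"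
  assumes irr: "irreducible_ops Ops" and fd: "fin_dim (UNIV :: 'a set)"
    and \<phi>: "clinear \<phi>" "\<And>f v. f \<in> Ops \<Longrightarrow> \<phi> (f v) = f (\<phi> v)"
  shows "\<exists>c. \<forall>v. \<phi> v = c *\<^sub>C v"
proof (cases "(UNIV :: 'a set) = {0}")
  case True
  then show ?thesis by (metis UNIV_I complex_vector.scale_zero_right singletonD)
next
  case False
  then obtain c v where v: "v \<noteq> 0" "\<phi> v = c *\<^sub>C v"
    by (rule exists_eigenvector [OF \<phi>(1) fd])
  let ?N = "{v. \<phi> v = c *\<^sub>C v}"
  have "csubspace ?N"
    by (rule csubspaceI)
       (use \<phi>(1) clinear_0 [OF \<phi>(1)] in \<open>auto simp: clinear_iff scaleC_add_right scaleC_scaleC mult.commute\<close>)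
  moreover have "f v \<in> ?N" if "f \<in> Ops" "v \<in> ?N" for f v
    using that \<phi>(2) irr by (auto simp: irreducible_ops_def clinear_iff)
  ultimately have "?N = {0} \<or> ?N = UNIV"
    using irr unfolding irreducible_ops_def by blast
  with v show ?thesis by blast
qed

text \<open>The Jacobson density theorem, by induction on \<open>F\<close>.  Suppose that every \<open>x\<close> in the left ideal \<open>J\<close> of
  operators killing \<open>F\<close> which kills \<open>a\<close> also kills \<open>v\<close>, where \<open>a\<close> is outside the span of \<open>F\<close>.  Then
  \<open>J a\<close> is the whole space and \<open>x a \<mapsto> x v\<close> is a well defined endomorphism that commutes with \<open>Ops\<close>,
  i.e. a scalar \<open>c\<close>.  So \<open>J\<close> kills \<open>v - c a\<close>, and the induction hypothesis puts \<open>v\<close> into the span of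
  \<open>a\<close> and \<open>F\<close>.\<close>

lemma density:
  fixes Ops :: "('a::complex_vector \<Rightarrow> 'a) set"
  assumes irr: "irreducible_ops Ops" and fd: "fin_dim (UNIV :: 'a set)"
    and "finite F" "v \<notin> cspan F"
  shows "\<exists>x\<in>op_alg Ops. (\<forall>w\<in>F. x w = 0) \<and> x v \<noteq> 0"
  using assms(3,4)
proof (induction F arbitrary: v rule: finite_induct)
  case empty
  then show ?case by (intro bexI [of _ "\<lambda>v. v"]) (auto simp: op_id)
next
  case (insert a F)
  define J where "J = {x \<in> op_alg Ops. \<forall>w\<in>F. x w = 0}"
  note lin = op_alg_clinear [OF irr]
  have J: "(\<lambda>v. f (x v)) \<in> J" "(\<lambda>v. x v + y v) \<in> J" "(\<lambda>v. c *\<^sub>C x v) \<in> J"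
    if "x \<in> J" "y \<in> J" "f \<in> op_alg Ops" for x y f c
    using that clinear_0 [OF lin] by (auto simp: J_def intro: op_alg.intros)
  show ?case
  proof (cases "a \<in> cspan F")
    case True
    then have "cspan (insert a F) = cspan F" by (rule complex_vector.span_redundant)
    with insert.prems obtain x where x: "x \<in> op_alg Ops" "\<forall>w\<in>F. x w = 0" "x v \<noteq> 0"
      using insert.IH [of v] by auto
    have "cspan F \<subseteq> {w. x w = 0}"
      by (rule cspan_minimal)
         (use x lin [OF x(1)] clinear_0 [OF lin [OF x(1)]] in
           \<open>auto simp: clinear_iff intro!: csubspaceI\<close>)
    with True x show ?thesis by blast
  next
    case False
    show ?thesis
    proof (rule ccontr)
      assume "\<not> ?thesis"
      then have kill: "x v = 0" if "x \<in> J" "x a = 0" for x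
        using that by (auto simp: J_def)
      obtain x0 where x0: "x0 \<in> J" "x0 a \<noteq> 0"
        using insert.IH [OF False] by (auto simp: J_def)
      have "csubspace ((\<lambda>x. x a) ` J)"
      proof (rule csubspaceI)
        show "0 \<in> (\<lambda>x. x a) ` J"
          by (rule image_eqI [of _ _ "\<lambda>v. 0 *\<^sub>C x0 v"]) (use J(3) [of x0 x0 x0 0] x0 in \<open>auto simp: J_def\<close>)
        show "p + q \<in> (\<lambda>x. x a) ` J" if "p \<in> (\<lambda>x. x a) ` J" "q \<in> (\<lambda>x. x a) ` J" for p q
          using that J(2) op_id by (auto intro!: image_eqI [of _ _ "\<lambda>v. _ v + _ v"])
        show "c *\<^sub>C p \<in> (\<lambda>x. x a) ` J" if "p \<in> (\<lambda>x. x a) ` J" for c p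
          using that J(3) [OF _ _ op_id] by (auto intro!: image_eqI [of _ _ "\<lambda>v. c *\<^sub>C _ v"])
      qed
      moreover have "\<forall>f\<in>Ops. \<forall>w\<in>(\<lambda>x. x a) ` J. f w \<in> (\<lambda>x. x a) ` J"
        using J(1) op_gen by (fastforce intro!: image_eqI [of _ _ "\<lambda>v. _ (_ v)"])
      ultimately have "(\<lambda>x. x a) ` J = {0} \<or> (\<lambda>x. x a) ` J = UNIV"
        using irr unfolding irreducible_ops_def by blast
      with x0 have onto: "(\<lambda>x. x a) ` J = UNIV" by blast
      \<comment> \<open>The choice of \<open>x\<close> does not matter, because the difference of two candidates kills \<open>a\<close>, hence \<open>v\<close>.\<close>
      define \<phi> where "\<phi> w = (SOME x. x \<in> J \<and> x a = w) v" for w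
      have \<phi>: "\<phi> (x a) = x v" if x: "x \<in> J" for x
      proof -
        let ?y = "SOME y. y \<in> J \<and> y a = x a"
        have y: "?y \<in> J \<and> ?y a = x a" by (rule someI [of _ x]) (simp add: x)
        have "(\<lambda>v. x v + (-1) *\<^sub>C ?y v) \<in> J"
          using x y op_id by (intro J(2) J(3) [where f = "\<lambda>v. v"]) auto
        from kill [OF this] y have "x v + (-1) *\<^sub>C ?y v = 0" by simp
        then show ?thesis by (simp add: \<phi>_def)
      qed
      have "clinear \<phi>"
        unfolding clinear_iff
      proof safe
        fix p q
        obtain x y where xy: "x \<in> J" "y \<in> J" "p = x a" "q = y a" using onto by blast
        show "\<phi> (p + q) = \<phi> p + \<phi> q"
          using \<phi> [OF J(2) [OF xy(1,2) op_id]] \<phi> [OF xy(1)] \<phi> [OF xy(2)] xy by simp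
      next
        fix c p
        obtain x where x: "x \<in> J" "p = x a" using onto by blast
        show "\<phi> (c *\<^sub>C p) = c *\<^sub>C \<phi> p"
          using \<phi> [OF J(3) [OF x(1) x(1) op_id]] \<phi> [OF x(1)] x by simp
      qed
      moreover have "\<phi> (f w) = f (\<phi> w)" if f: "f \<in> Ops" for f w
      proof -
        obtain x where x: "x \<in> J" "w = x a" using onto by blast
        show ?thesis using \<phi> [OF J(1) [OF x(1) x(1) op_gen [OF f]]] \<phi> [OF x(1)] x by simp
      qed
      ultimately obtain c where c: "\<And>w. \<phi> w = c *\<^sub>C w"
        using schur [OF irr fd] by blast
      have "x (v - c *\<^sub>C a) = 0" if x: "x \<in> J" for x
      proof -
        interpret x: Vector_Spaces.linear scaleC scaleC x
          using lin x by (simp add: J_def)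
        show ?thesis using \<phi> [OF x] c by (simp add: x.diff x.scale)
      qed
      then have "v - c *\<^sub>C a \<in> cspan F"
        using insert.IH [of "v - c *\<^sub>C a"] by (auto simp: J_def)
      then have "v \<in> cspan (insert a F)"
        by (auto simp: complex_vector.span_insert)
      with insert.prems show False by blast
    qed
  qed
qed

text \<open>Compose an operator which kills the other basis vectors but not \<open>b\<close> with one that moves the image of
  \<open>b\<close> to \<open>c\<close>; the latter exists because the orbit of a non-zero vector is everything.\<close>

lemma density_basis:
  fixes Ops :: "('a::complex_vector \<Rightarrow> 'a) set"
  assumes irr: "irreducible_ops Ops" and B: "finite B" "complex_vector.independent B" "cspan B = UNIV"
    and b: "b \<in> B"
  shows "\<exists>x\<in>op_alg Ops. \<forall>b'\<in>B. x b' = (if b' = b then c else 0)"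
proof -
  have fd: "fin_dim (UNIV :: 'a set)" unfolding fin_dim_def using B by blast
  have "b \<notin> cspan (B - {b})" using B b by (auto simp: complex_vector.dependent_def)
  with density [OF irr fd] B obtain x where x: "x \<in> op_alg Ops" "\<forall>w\<in>B - {b}. x w = 0" "x b \<noteq> 0"
    by (metis finite_Diff)
  let ?N = "(\<lambda>f. f (x b)) ` op_alg Ops"
  have "csubspace ?N"
  proof (rule csubspaceI)
    show "0 \<in> ?N"
      by (rule image_eqI [of _ _ "\<lambda>v. 0 *\<^sub>C v"]) (simp, rule op_scale, rule op_id)
    show "p + q \<in> ?N" if "p \<in> ?N" "q \<in> ?N" for p q
      using that by (auto intro!: image_eqI [of _ _ "\<lambda>v. _ v + _ v"] op_add)
    show "c *\<^sub>C p \<in> ?N" if "p \<in> ?N" for c p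
      using that by (auto intro!: image_eqI [of _ _ "\<lambda>v. c *\<^sub>C _ v"] op_scale)
  qed
  moreover have "f w \<in> ?N" if f: "f \<in> Ops" and "w \<in> ?N" for f w
    using that op_comp [OF op_gen [OF f]] by (auto intro!: image_eqI [of _ _ "\<lambda>v. f (_ v)"])
  moreover have "x b \<in> ?N" by (rule image_eqI [of _ _ "\<lambda>v. v"]) (auto intro: op_id)
  ultimately have "?N = UNIV" using irr x(3) unfolding irreducible_ops_def by blast
  then have "c \<in> ?N" by simp
  then obtain f where f: "f \<in> op_alg Ops" "c = f (x b)" by blast
  show ?thesis
    by (rule bexI [of _ "\<lambda>v. f (x v)"])
       (use f x clinear_0 [OF op_alg_clinear [OF irr f(1)]] in \<open>auto intro: op_comp\<close>)
qed

section \<open>Coordinates in tensor products\<close>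

lemma tensor_in_span: "w \<in> cspan {a \<otimes>\<^sub>C b | a b. True}"
proof -
  let ?P = "cspan {a \<otimes>\<^sub>C b | a b. True}"
  obtain f where w: "w = abs_tensor f" by (rule that [OF Quotient3_abs_rep [OF Quotient3_tensor, symmetric]])
  have s: "abs_tensor (single k c) \<in> ?P" for k and c :: complex
  proof -
    obtain a b where k: "k = (a, b)" by fastforce
    have "single k c = c *\<^sub>C single k (1::complex)"
      by (simp flip: single_clinear(2) add: scaleC_complex_def)
    then have "abs_tensor (single k c) = c *\<^sub>C (a \<otimes>\<^sub>C b)"
      by (simp add: k scaleC_tensor.abs_eq tensor.abs_eq)
    also have "\<dots> \<in> ?P" by (intro complex_vector.span_scale cspan_base) blast
    finally show ?thesis .
  qed
  have "abs_tensor f \<in> ?P"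
  proof (induction f rule: update_induct)
    case const
    show ?case by (simp add: cspan_zero flip: zero_tensor.abs_eq zero_tensor_def)
  next
    case (update f k c)
    have "Poly_Mapping.update k c f = single k c + f"
      using update(1) by (intro poly_mapping_eqI) (auto simp: lookup_update lookup_add lookup_single when_def in_keys_iff)
    then show ?case using update s [of k c] by (simp add: cspan_add flip: plus_tensor.abs_eq)
  qed
  then show ?thesis by (simp add: w)
qed

text \<open>Identities between linear maps on a tensor product are verified on pure tensors.\<close>

lemma clinear_eq_on_tensors:
  assumes "clinear f" "clinear g" "\<And>a b. f (a \<otimes>\<^sub>C b) = g (a \<otimes>\<^sub>C b)"
  shows "f w = g w"
proof -
  have "w \<in> {w. f w = g w}"
    using tensor_in_span
  proof (rule subsetD [OF cspan_minimal, rotated 2])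
    show "csubspace {w. f w = g w}"
      using assms(1,2) clinear_0 [OF assms(1)] clinear_0 [OF assms(2)]
      by (intro csubspaceI) (auto simp: clinear_iff)
  qed (use assms(3) in auto)
  then show ?thesis by simp
qed

text \<open>For a basis \<open>B\<close> of the first factor, \<open>w = \<Sum>\<^sub>b b \<otimes> tcoord B b w\<close>; see \<open>tensor_expand\<close>.\<close>

definition tcoord :: "'a::complex_vector set \<Rightarrow> 'a \<Rightarrow> ('a, 'b::complex_vector) tensor \<Rightarrow> 'b" where
  "tcoord B b = tensor_lift (\<lambda>a u. complex_vector.representation B a b *\<^sub>C u)"

lemma exists_basis:
  assumes "fin_dim (UNIV :: 'a::complex_vector set)"
  obtains B :: "'a::complex_vector set" where "finite B" "complex_vector.independent B" "cspan B = UNIV"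
proof -
  obtain A :: "'a set" where A: "finite A" "cspan A = UNIV" using assms by (auto simp: fin_dim_def)
  obtain B :: "'a set" where B: "complex_vector.independent B" "UNIV \<subseteq> cspan B"
    by (rule complex_vector.basis_exists [of UNIV]) auto
  have "finite B" using complex_vector.independent_span_bound [OF A(1) B(1)] A(2) by simp
  with B that show thesis by blast
qed

lemma clinear_tcoord: "clinear (tcoord B b)"
  unfolding tcoord_def by (rule clinear_tensor_lift)

lemma tensor_map_add: "tensor_map f g (x + y) = tensor_map f g x + tensor_map f g y"
  and tensor_map_scaleC: "tensor_map f g (c *\<^sub>C x) = c *\<^sub>C tensor_map f g x"
  using clinear_tensor_map unfolding clinear_iff by blast+

lemma tcoord_add: "tcoord B b (x + y) = tcoord B b x + tcoord B b y"
  and tcoord_scaleC: "tcoord B b (c *\<^sub>C x) = c *\<^sub>C tcoord B b x"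
  using clinear_tcoord unfolding clinear_iff by blast+

context
  fixes B :: "'a::complex_vector set"
  assumes B: "finite B" "complex_vector.independent B" "cspan B = UNIV"
begin

lemma tcoord_tensor: "tcoord B b (a \<otimes>\<^sub>C u) = complex_vector.representation B a b *\<^sub>C u"
  unfolding tcoord_def
  by (rule tensor_lift_tensor)
     (use B in \<open>simp add: cbilinear_def clinear_iff complex_vector.representation_add
        complex_vector.representation_scale scaleC_add_left scaleC_add_right scaleC_scaleC mult.commute\<close>)

lemma tensor_expand:
  fixes w :: "('a, 'b::complex_vector) tensor"
  shows "w = (\<Sum>b\<in>B. b \<otimes>\<^sub>C tcoord B b w)"
proof -
  have "id w = (\<Sum>b\<in>B. b \<otimes>\<^sub>C tcoord B b w)"
  proof (rule clinear_eq_on_tensors [where f = id and g = "\<lambda>w. \<Sum>b\<in>B. b \<otimes>\<^sub>C tcoord B b w"])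
    show "clinear (\<lambda>w :: ('a, 'b) tensor. \<Sum>b\<in>B. b \<otimes>\<^sub>C tcoord B b w)"
      unfolding clinear_iff
      by (simp add: tcoord_add tcoord_scaleC tensor_linear sum.distrib complex_vector.scale_sum_right)
    fix a :: 'a and u :: 'b
    have s: "(\<Sum>b\<in>A. (c b *\<^sub>C b) \<otimes>\<^sub>C u) = (\<Sum>b\<in>A. c b *\<^sub>C b) \<otimes>\<^sub>C u" for A and c :: "'a \<Rightarrow> complex"
      by (induction A rule: infinite_finite_induct) (simp_all add: tensor_linear tensor_0)
    have "(\<Sum>b\<in>B. b \<otimes>\<^sub>C tcoord B b (a \<otimes>\<^sub>C u)) = (\<Sum>b\<in>B. (complex_vector.representation B a b *\<^sub>C b) \<otimes>\<^sub>C u)"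
      by (simp add: tcoord_tensor tensor_linear)
    also have "\<dots> = (\<Sum>b\<in>B. complex_vector.representation B a b *\<^sub>C b) \<otimes>\<^sub>C u" by (rule s)
    also have "(\<Sum>b\<in>B. complex_vector.representation B a b *\<^sub>C b) = a"
      by (rule complex_vector.sum_representation_eq) (use B in auto)
    finally show "id (a \<otimes>\<^sub>C u) = (\<Sum>b\<in>B. b \<otimes>\<^sub>C tcoord B b (a \<otimes>\<^sub>C u))" by simp
  qed (rule clinear_id)
  then show ?thesis by simp
qed

text \<open>Why a subspace of \<open>W\<^sub>1 \<otimes> U\<close> which is stable under an irreducible set of operators on \<open>W\<^sub>1\<close> has the
  form \<open>W\<^sub>1 \<otimes> P\<close>: it is stable under the operator on \<open>W\<^sub>1\<close> which takes \<open>b\<close> to \<open>a\<close> and kills the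
  rest of the basis, and this operator maps \<open>w\<close> to \<open>a \<otimes> u\<close>, where \<open>u\<close> is the coordinate of \<open>w\<close> at \<open>b\<close>.\<close>

lemma tensor_stable_coordinates:
  fixes N :: "('a, 'b::complex_vector) tensor set"
  assumes irr: "irreducible_ops Ops"
    and N: "csubspace N" "\<And>f w. f \<in> Ops \<Longrightarrow> w \<in> N \<Longrightarrow> tensor_map f id w \<in> N"
    and w: "w \<in> N" and b: "b \<in> B"
  shows "a \<otimes>\<^sub>C tcoord B b w \<in> N"
proof -
  note lin = op_alg_clinear [OF irr]
  note tm = tensor_map_tensor [OF lin clinear_id]
  have stable: "tensor_map f id w \<in> N" if "f \<in> op_alg Ops" "w \<in> N" for f w
    using that
  proof (induction arbitrary: w)
    case op_id
    have "tensor_map (\<lambda>v. v) id w = id w"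
      by (rule clinear_eq_on_tensors [OF clinear_tensor_map clinear_id])
         (simp add: tm [OF op_alg.op_id])
    then show ?case using op_id by (simp add: id_def)
  next
    case (op_gen f)
    then show ?case using N(2) by blast
  next
    case (op_comp f g)
    have "tensor_map (\<lambda>v. f (g v)) id w = tensor_map f id (tensor_map g id w)"
      by (rule clinear_eq_on_tensors [where f = "tensor_map (\<lambda>v. f (g v)) id" and g = "\<lambda>w. tensor_map f id (tensor_map g id w)"])
         (use op_comp.hyps in \<open>auto simp: clinear_iff tensor_map_add tensor_map_scaleC tm [OF op_alg.op_comp] tm
            tensor_linear scaleC_add_right scaleC_scaleC mult.commute\<close>)
    then show ?case using op_comp by (simp add: id_def)
  next
    case (op_add f g)
    have "tensor_map (\<lambda>v. f v + g v) id w = tensor_map f id w + tensor_map g id w"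
      by (rule clinear_eq_on_tensors [where f = "tensor_map (\<lambda>v. f v + g v) id" and g = "\<lambda>w. tensor_map f id w + tensor_map g id w"])
         (use op_add.hyps in \<open>auto simp: clinear_iff tensor_map_add tensor_map_scaleC tm [OF op_alg.op_add] tm
            tensor_linear scaleC_add_right scaleC_scaleC mult.commute\<close>)
    then show ?case using op_add N(1) by (simp add: csubspace_add id_def)
  next
    case (op_scale f c)
    have "tensor_map (\<lambda>v. c *\<^sub>C f v) id w = c *\<^sub>C tensor_map f id w"
      by (rule clinear_eq_on_tensors [where f = "tensor_map (\<lambda>v. c *\<^sub>C f v) id" and g = "\<lambda>w. c *\<^sub>C tensor_map f id w"])
         (use op_scale.hyps in \<open>auto simp: clinear_iff tensor_map_add tensor_map_scaleC tm [OF op_alg.op_scale] tm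
            tensor_linear scaleC_add_right scaleC_scaleC mult.commute\<close>)
    then show ?case using op_scale N(1) by (simp add: csubspace_scale id_def)
  qed
  obtain x where x: "x \<in> op_alg Ops" "\<forall>b'\<in>B. x b' = (if b' = b then a else 0)"
    using density_basis [OF irr B b] by blast
  interpret x: Vector_Spaces.linear scaleC scaleC x by (rule lin) (rule x(1))
  have "tensor_map x id w = a \<otimes>\<^sub>C tcoord B b w"
  proof (rule clinear_eq_on_tensors [where f = "tensor_map x id" and g = "\<lambda>w. a \<otimes>\<^sub>C tcoord B b w"])
    show "clinear (\<lambda>w :: ('a, 'b) tensor. a \<otimes>\<^sub>C tcoord B b w)"
      by (simp add: clinear_iff tcoord_add tcoord_scaleC tensor_linear)
    fix a' :: 'a and u :: 'b
    let ?r = "complex_vector.representation B a'"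
    have "x a' = x (\<Sum>b\<in>B. ?r b *\<^sub>C b)"
      by (subst complex_vector.sum_representation_eq) (use B in auto)
    also have "\<dots> = (\<Sum>b'\<in>B. if b' = b then ?r b *\<^sub>C a else 0)"
      unfolding x.sum x.scale using x(2) by (intro sum.cong) auto
    also have "\<dots> = ?r b *\<^sub>C a" using B b by simp
    finally show "tensor_map x id (a' \<otimes>\<^sub>C u) = a \<otimes>\<^sub>C tcoord B b (a' \<otimes>\<^sub>C u)"
      by (simp add: tm x(1) tcoord_tensor tensor_linear)
  qed (rule clinear_tensor_map)
  then show ?thesis using stable [OF x(1) w] by simp
qed

end

section \<open>Direct sums and operators of finite order\<close>

lemma clinear_on_UNIV: "clinear_on UNIV f \<longleftrightarrow> clinear f"
  by (simp add: clinear_on_def clinear_iff)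

lemma direct_sum_projections:
  fixes G :: "'i \<Rightarrow> 'a::complex_vector set"
  assumes ds: "direct_sum UNIV I G"
  obtains p where "\<And>q. clinear (p q)" "\<And>q v. q \<in> I \<Longrightarrow> p q v \<in> G q"
    "\<And>q v. q \<in> I \<Longrightarrow> v \<in> G q \<Longrightarrow> p q v = v"
    "\<And>q q' v. q' \<in> I \<Longrightarrow> q \<noteq> q' \<Longrightarrow> v \<in> G q' \<Longrightarrow> p q v = 0"
    "\<And>v. v \<in> cspan ((\<lambda>q. p q v) ` I)"
proof -
  define P where "P v f \<longleftrightarrow> (\<forall>i\<in>I. f i \<in> G i) \<and> (\<forall>i. i \<notin> I \<longrightarrow> f i = 0) \<and>
        finite {i. f i \<noteq> 0} \<and> v = (\<Sum>i | f i \<noteq> 0. f i)" for v f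
  have ex: "\<exists>!f. P v f" for v using ds by (simp add: direct_sum_def P_def)
  have sub: "csubspace (G q)" if "q \<in> I" for q using ds that by (simp add: direct_sum_def)
  define c where "c v = (THE f. P v f)" for v
  have Pc: "P v (c v)" for v unfolding c_def by (rule theI' [OF ex])
  have eq: "c v = f" if "P v f" for v f using ex [of v] Pc [of v] that by blast
  have add: "c (v + w) = (\<lambda>i. c v i + c w i)" for v w
  proof (rule eq)
    let ?A = "{i. c v i \<noteq> 0} \<union> {i. c w i \<noteq> 0}"
    have fin: "finite ?A" using Pc [of v] Pc [of w] by (simp add: P_def)
    have "v = (\<Sum>i | c v i \<noteq> 0. c v i)" "w = (\<Sum>i | c w i \<noteq> 0. c w i)"
      using Pc [of v] Pc [of w] by (simp_all add: P_def)
    moreover have "(\<Sum>i | c v i \<noteq> 0. c v i) = (\<Sum>i\<in>?A. c v i)" "(\<Sum>i | c w i \<noteq> 0. c w i) = (\<Sum>i\<in>?A. c w i)"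
      by (intro sum.mono_neutral_left; use fin in auto)+
    moreover have "(\<Sum>i | c v i + c w i \<noteq> 0. c v i + c w i) = (\<Sum>i\<in>?A. c v i + c w i)"
      by (intro sum.mono_neutral_left) (use fin in auto)
    ultimately have "v + w = (\<Sum>i | c v i + c w i \<noteq> 0. c v i + c w i)"
      by (simp add: sum.distrib)
    moreover have "finite {i. c v i + c w i \<noteq> 0}"
      by (rule finite_subset [OF _ fin]) auto
    ultimately show "P (v + w) (\<lambda>i. c v i + c w i)"
      using Pc [of v] Pc [of w] sub by (auto simp: P_def csubspace_add)
  qed
  have scale: "c (a *\<^sub>C v) = (\<lambda>i. a *\<^sub>C c v i)" for a v
  proof (rule eq)
    have fin: "finite {i. c v i \<noteq> 0}" and v: "v = (\<Sum>i | c v i \<noteq> 0. c v i)"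
      using Pc [of v] by (simp_all add: P_def)
    have "a *\<^sub>C v = (\<Sum>i | c v i \<noteq> 0. a *\<^sub>C c v i)"
      by (subst v) (rule complex_vector.scale_sum_right)
    also have "\<dots> = (\<Sum>i | a *\<^sub>C c v i \<noteq> 0. a *\<^sub>C c v i)"
      by (intro sum.mono_neutral_right) (use fin in auto)
    finally show "P (a *\<^sub>C v) (\<lambda>i. a *\<^sub>C c v i)"
      using Pc [of v] sub finite_subset [OF _ fin, of "{i. a *\<^sub>C c v i \<noteq> 0}"]
      by (auto simp: P_def csubspace_scale)
  qed
  have hom: "c v = (\<lambda>i. if i = q then v else 0)" if "q \<in> I" "v \<in> G q" for q v
  proof (rule eq)
    have "{i. (if i = q then v else 0) \<noteq> 0} = (if v = 0 then {} else {q})" by auto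
    then show "P v (\<lambda>i. if i = q then v else 0)"
      using that sub csubspace_zero by (auto simp: P_def)
  qed
  show thesis
  proof (rule that [of "\<lambda>q v. c v q"])
    show "clinear (\<lambda>v. c v q)" for q by (simp add: clinear_iff add scale)
    show "c v q \<in> G q" if "q \<in> I" for q v using Pc [of v] that by (simp add: P_def)
    show "c v q = v" if "q \<in> I" "v \<in> G q" for q v using hom [OF that] by simp
    show "c v q = 0" if "q' \<in> I" "q \<noteq> q'" "v \<in> G q'" for q q' v using hom [OF that(1,3)] that by simp
    show "v \<in> cspan ((\<lambda>q. c v q) ` I)" for v
    proof -
      have "{i. c v i \<noteq> 0} \<subseteq> I" "v = (\<Sum>i | c v i \<noteq> 0. c v i)" using Pc [of v] by (auto simp: P_def)
      moreover have "(\<Sum>i | c v i \<noteq> 0. c v i) \<in> cspan ((\<lambda>q. c v q) ` I)"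
        by (intro cspan_sum cspan_base) (use calculation(1) in auto)
      ultimately show ?thesis by simp
    qed
  qed
qed

text \<open>Apply the projection to \<open>G r\<close>: it fixes \<open>v\<close> and kills all spanning vectors outside \<open>X r\<close>.\<close>

lemma direct_sum_in_span:
  fixes G :: "'i \<Rightarrow> 'a::complex_vector set"
  assumes ds: "direct_sum UNIV I G" and X: "\<And>q. q \<in> I \<Longrightarrow> X q \<subseteq> G q"
    and v: "v \<in> cspan (\<Union>q\<in>I. X q)" "v \<in> G r" "r \<in> I"
  shows "v \<in> cspan (X r)"
proof -
  obtain p where p: "\<And>q. clinear (p q)" "\<And>q v. q \<in> I \<Longrightarrow> v \<in> G q \<Longrightarrow> p q v = v"
    "\<And>q q' v. q' \<in> I \<Longrightarrow> q \<noteq> q' \<Longrightarrow> v \<in> G q' \<Longrightarrow> p q v = 0"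
    by (rule direct_sum_projections [OF ds]) blast
  have "cspan (\<Union>q\<in>I. X q) \<subseteq> {v. p r v \<in> cspan (X r)}"
  proof (rule cspan_minimal)
    show "(\<Union>q\<in>I. X q) \<subseteq> {v. p r v \<in> cspan (X r)}"
    proof safe
      fix q x assume q: "q \<in> I" "x \<in> X q"
      then have "x \<in> G q" using X by blast
      then show "p r x \<in> cspan (X r)"
        using p(2) [of r x] p(3) [of q r x] q v(3)
        by (cases "q = r") (auto simp: cspan_base cspan_zero)
    qed
    show "csubspace {v. p r v \<in> cspan (X r)}"
      using p(1) [of r] clinear_0 [OF p(1) [of r]]
      by (intro csubspaceI)
         (auto simp: clinear_iff cspan_zero cspan_add complex_vector.span_scale)
  qed
  with v p(2) [of r v] show ?thesis by auto
qed

lemma direct_sum_span_UN: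
  assumes "direct_sum UNIV I G"
  shows "cspan (\<Union>q\<in>I. G q) = (UNIV :: 'a::complex_vector set)"
proof -
  obtain p where p: "\<And>q v. q \<in> I \<Longrightarrow> p q v \<in> G q" "\<And>v. v \<in> cspan ((\<lambda>q. p q v) ` I)"
    by (rule direct_sum_projections [OF assms]) blast
  have "v \<in> cspan (\<Union>q\<in>I. G q)" for v
    by (rule subsetD [OF cspan_mono p(2)]) (use p(1) in blast)
  then show ?thesis by blast
qed

text \<open>The components of \<open>x\<close> are the discrete Fourier averages \<open>(1/m) \<Sum>\<^sub>k \<xi>\<^bsup>-jk\<^esup> T\<^sup>k x\<close>; they sum to \<open>x\<close> by
  orthogonality of the characters of \<open>\<int>/m\<close>.\<close>

lemma finite_order_eigenvectors_span:
  fixes T :: "'a::complex_vector \<Rightarrow> 'a"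
  assumes T: "clinear T" "(T ^^ m) x = x" and m: "m > 0"
    and \<xi>: "\<xi> ^ m = 1" "\<And>k. 0 < k \<Longrightarrow> k < m \<Longrightarrow> \<xi> ^ k \<noteq> 1"
  shows "x \<in> cspan {y. \<exists>c\<in>range (\<lambda>k::int. \<xi> powi k). T y = c *\<^sub>C y}"
proof -
  interpret T: Vector_Spaces.linear scaleC scaleC T by (fact T(1))
  have \<xi>0: "\<xi> \<noteq> 0" using \<xi>(1) m by (metis power_0_left not_gr_zero zero_neq_one)
  define z where "z = inverse \<xi>"
  have z: "z ^ m = 1" "\<xi> * z = 1" using \<xi>(1) \<xi>0 by (simp_all add: z_def power_inverse)
  define e where "e j = (\<Sum>k<m. (z ^ (j * k) / of_nat m) *\<^sub>C (T ^^ k) x)" for j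
  have eig: "T (e j) = \<xi> ^ j *\<^sub>C e j" for j
  proof -
    \<comment> \<open>\<open>T\<close> shifts the summation index by one, cyclically modulo \<open>m\<close>.\<close>
    define g where "g k = (z ^ (j * k) / of_nat m) *\<^sub>C (T ^^ k) x" for k
    have gm: "g m = g 0"
      using z(1) T(2) by (simp add: g_def power_mult mult.commute [of j])
    have "T (g k) = \<xi> ^ j *\<^sub>C g (Suc k)" for k
    proof -
      have "\<xi> ^ j * z ^ (j * Suc k) = (\<xi> * z) ^ j * z ^ (j * k)"
        by (simp add: power_add power_mult_distrib mult_ac)
      then show ?thesis using z(2) by (simp add: g_def T.scale scaleC_scaleC)
    qed
    then have "T (e j) = \<xi> ^ j *\<^sub>C (\<Sum>k<m. g (Suc k))"
      by (simp add: e_def T.sum complex_vector.scale_sum_right flip: g_def)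
    also have "(\<Sum>k<m. g (Suc k)) = (\<Sum>k<m. g k)"
      using gm sum.lessThan_Suc_shift [of g m] by simp
    finally show ?thesis by (simp add: e_def g_def)
  qed
  have roots: "(\<Sum>j<m. z ^ (j * k)) = (if k = 0 then of_nat m else 0)" if "k < m" for k
  proof (cases "k = 0")
    case False
    have "z ^ k \<noteq> 1"
      using \<xi>(2) [of k] that False \<xi>0 by (simp add: z_def power_inverse)
    moreover have "(z ^ k) ^ m = 1" using z(1) by (metis power_commutes power_mult power_one mult.commute)
    ultimately have "(\<Sum>j<m. (z ^ k) ^ j) = 0" by (simp add: geometric_sum)
    then show ?thesis using False by (simp add: mult.commute flip: power_mult)
  qed simp
  have "(\<Sum>j<m. e j) = (\<Sum>k<m. \<Sum>j<m. (z ^ (j * k) / of_nat m) *\<^sub>C (T ^^ k) x)"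
    unfolding e_def by (rule sum.swap)
  also have "\<dots> = (\<Sum>k<m. ((\<Sum>j<m. z ^ (j * k)) / of_nat m) *\<^sub>C (T ^^ k) x)"
    by (simp add: sum_divide_distrib complex_vector.scale_sum_left)
  also have "\<dots> = (\<Sum>k<m. if k = 0 then x else 0)"
    using m by (intro sum.cong) (auto simp: roots scaleC_one)
  also have "\<dots> = x" using m by simp
  finally have "x = (\<Sum>j<m. e j)" by simp
  also have "\<dots> \<in> cspan {y. \<exists>c\<in>range (\<lambda>k::int. \<xi> powi k). T y = c *\<^sub>C y}"
    by (intro cspan_sum cspan_base)
       (use eig in \<open>auto intro!: exI [of _ "int _"]\<close>)
  finally show ?thesis .
qed

section \<open>The weight decomposition of the fixed points of \<open>\<sigma>\<^sub>0\<close>\<close>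

locale toroidal =
  fixes b :: nat and S :: "('g::complex_vector, 'n::finite) toroidal_data"
  assumes setting: "toroidal_setting b S"
begin

lemma lie: "lie_algebra (brk S) UNIV"
  using setting by (simp add: toroidal_setting_def simple_lie_algebra_def)

lemma cbilinear_brk: "cbilinear (brk S)"
  using lie by (simp add: lie_algebra_def cbilinear_def clinear_on_UNIV)

lemma cbilinear_frm: "cbilinear (frm S)"
  using setting by (simp add: toroidal_setting_def invariant_form_def)

lemma brk_lin:
  "brk S (x + y) z = brk S x z + brk S y z" "brk S x (y + z) = brk S x y + brk S x z"
  "brk S (c *\<^sub>C x) y = c *\<^sub>C brk S x y" "brk S x (c *\<^sub>C y) = c *\<^sub>C brk S x y"
  using cbilinear_brk by (simp_all add: cbilinear_def clinear_iff)

lemma brk_0: "brk S 0 x = 0" "brk S x 0 = 0"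
  using brk_lin(3) [of 0 0 x] brk_lin(4) [of x 0 0] by simp_all

lemma clinear_brk: "clinear (brk S x)"
  by (simp add: clinear_iff brk_lin)

lemma brk_swap: "brk S y x = - brk S x y"
proof -
  have "brk S (x + y) (x + y) = 0" "brk S x x = 0" "brk S y y = 0"
    using lie by (simp_all add: lie_algebra_def)
  then show ?thesis by (simp add: brk_lin eq_neg_iff_add_eq_0 add.commute)
qed

lemma brk_jacobi: "brk S x (brk S y z) = brk S (brk S x y) z + brk S y (brk S x z)"
proof -
  have "brk S x (brk S y z) + brk S y (brk S z x) + brk S z (brk S x y) = 0"
    using lie by (simp add: lie_algebra_def)
  moreover have "brk S z (brk S x y) = - brk S (brk S x y) z" by (rule brk_swap)
  moreover have "brk S y (brk S z x) = - brk S y (brk S x z)"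
    using brk_swap [of x z] brk_lin(4) [of y "-1" "brk S x z"] by simp
  ultimately show ?thesis by (simp add: algebra_simps)
qed

lemma clinear_aut: "clinear (aut S i)"
  and aut_brk: "aut S i (brk S x y) = brk S (aut S i x) (aut S i y)"
  and aut_commute: "aut S i (aut S j x) = aut S j (aut S i x)"
  and per_pos: "0 < per S i"
  using setting by (auto simp: toroidal_setting_def lie_automorphism_def)

lemma aut_per: "(aut S i ^^ per S i) x = x"
  using setting per_pos [of i] unfolding toroidal_setting_def by (meson dvd_refl)

lemma rou_power: "k > 0 \<Longrightarrow> rou S i ^ k = 1 \<longleftrightarrow> per S i dvd k"
  using setting by (simp add: toroidal_setting_def)

lemma rou_nz: "rou S i \<noteq> 0"
  using rou_power [of "per S i" i] per_pos [of i] by (metis dvd_refl power_0_left not_gr_zero zero_neq_one)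

lemma aut_lin: "aut S i (x + y) = aut S i x + aut S i y" "aut S i (c *\<^sub>C x) = c *\<^sub>C aut S i x"
  using clinear_aut by (simp_all add: clinear_iff)

lemma aut_eigenvectors_span:
  "x \<in> cspan {y. \<exists>c\<in>range (\<lambda>k::int. rou S i powi k). aut S i y = c *\<^sub>C y}"
  by (rule finite_order_eigenvectors_span [where m = "per S i"])
     (use clinear_aut aut_per per_pos rou_power in \<open>auto dest: dvd_imp_le\<close>)

lemma csa0_subspace: "csubspace (csa0 S)"
  and csa0_abelian: "h \<in> csa0 S \<Longrightarrow> h' \<in> csa0 S \<Longrightarrow> brk S h h' = 0"
  and csa0_fixed: "h \<in> csa0 S \<Longrightarrow> h \<in> eigen S 0"
  using setting by (auto simp: toroidal_setting_def cartan_subalgebra_def Let_def fixed00_def)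

lemma csa0_diag:
  assumes "h \<in> csa0 S" shows "x \<in> cspan {y. \<exists>c\<in>UNIV. brk S h y = c *\<^sub>C y}"
proof -
  have "cartan_subalgebra (brk S) UNIV (csa S)" "csa0 S \<subseteq> csa S"
    using setting by (simp_all add: toroidal_setting_def)
  with assms have "UNIV \<subseteq> cspan {y \<in> UNIV. \<exists>c. brk S h y = c *\<^sub>C y}"
    unfolding cartan_subalgebra_def Let_def by blast
  then show ?thesis by (simp add: top.extremum_unique)
qed

lemma aut_csa0: "h \<in> csa0 S \<Longrightarrow> aut S i h = h"
  using csa0_fixed by (simp add: eigen_def scaleC_one)

lemma ad_csa0_commute: "h \<in> csa0 S \<Longrightarrow> h' \<in> csa0 S \<Longrightarrow> brk S h (brk S h' x) = brk S h' (brk S h x)"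
  using brk_jacobi [of h h' x] csa0_abelian [of h h'] by (simp add: brk_0)

lemma aut_ad_commute: "h \<in> csa0 S \<Longrightarrow> aut S i (brk S h x) = brk S h (aut S i x)"
  by (simp add: aut_brk aut_csa0)

lemma csa0_basis: obtains H where "finite H" "H \<subseteq> csa0 S" "cspan H = csa0 S"
proof -
  obtain B :: "'g set" where B: "finite B" "UNIV \<subseteq> cspan B"
    using setting by (auto simp: toroidal_setting_def fin_dim_def)
  obtain H where H: "H \<subseteq> csa0 S" "complex_vector.independent H" "csa0 S \<subseteq> cspan H"
    by (rule complex_vector.basis_exists)
  have "finite H" using complex_vector.independent_span_bound [OF B(1) H(2)] B(2) by blast
  moreover have "cspan H = csa0 S"
    using H csa0_subspace by (simp add: cspan_minimal subset_antisym)
  ultimately show thesis using H that by blast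
qed

text \<open>The homogeneous weight vectors of \<open>\<gg>(\<sigma>\<^sub>0)\<close>, of weight \<open>a\<close> and degree \<open>k\<close>: degree \<open>0\<close> in the direction
  of \<open>\<sigma>\<^sub>0\<close> is encoded by \<open>emb\<close>.\<close>

definition wvecs :: "('g \<Rightarrow> complex) \<Rightarrow> int ^ 'n \<Rightarrow> 'g set" where
  "wvecs a k = weight_space (brk S) (csa0 S) a (eigen S (emb k))"

lemma wvecs_iff:
  "x \<in> wvecs a k \<longleftrightarrow> aut S None x = x \<and> (\<forall>i. aut S (Some i) x = (rou S (Some i) powi (k $ i)) *\<^sub>C x) \<and>
     (\<forall>h\<in>csa0 S. brk S h x = a h *\<^sub>C x)"
  unfolding wvecs_def weight_space_def eigen_def
  by (auto simp: emb_def scaleC_one split: option.splits)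

lemma wvecs_sigma0: "x \<in> wvecs a k \<Longrightarrow> x \<in> g_sigma0 S"
  and wvecs_eigen_n: "x \<in> wvecs a k \<Longrightarrow> x \<in> eigen_n S k"
  and wvecs_weight: "x \<in> wvecs a k \<Longrightarrow> h \<in> csa0 S \<Longrightarrow> brk S h x = a h *\<^sub>C x"
  by (auto simp: wvecs_iff g_sigma0_def eigen_n_def)

lemma wvecs_brk:
  assumes "x \<in> wvecs a k" "y \<in> wvecs a' l"
  shows "brk S x y \<in> wvecs (\<lambda>h. a h + a' h) (k + l)"
  unfolding wvecs_iff
proof (intro conjI allI ballI)
  show "aut S None (brk S x y) = brk S x y" using assms by (simp add: wvecs_iff aut_brk)
  show "aut S (Some i) (brk S x y) = (rou S (Some i) powi ((k + l) $ i)) *\<^sub>C brk S x y" for i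
    using assms by (simp add: wvecs_iff aut_brk brk_lin scaleC_scaleC power_int_add rou_nz mult.commute)
  show "brk S h (brk S x y) = (a h + a' h) *\<^sub>C brk S x y" if "h \<in> csa0 S" for h
    using assms that brk_jacobi [of h x y] by (simp add: wvecs_iff brk_lin scaleC_add_left)
qed

lemma wvecs_zero_g_circ: "x \<in> wvecs (\<lambda>h. 0) k \<Longrightarrow> x \<in> g_circ S"
  by (auto simp: wvecs_iff g_circ_def g_sigma0_def)

lemma csa0_wvecs: "h \<in> csa0 S \<Longrightarrow> h \<in> wvecs (\<lambda>h. 0) 0"
  by (auto simp: wvecs_iff aut_csa0 csa0_abelian scaleC_one)

lemma weight_space_sigma0_span:
  assumes "x \<in> weight_space (brk S) (csa0 S) a (g_sigma0 S)"
  shows "x \<in> cspan (\<Union>k. wvecs a k)"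
proof -
  let ?Q = "insert (aut S None, 1) {(brk S h, a h) | h. h \<in> csa0 S}"
  let ?E = "{y. (\<forall>i\<in>UNIV. \<exists>c\<in>range (\<lambda>k::int. rou S i powi k). aut S i y = c *\<^sub>C y) \<and> (\<forall>(A, c)\<in>?Q. A y = c *\<^sub>C y)}"
  have "x \<in> cspan ?E"
    by (rule joint_eigenvectors_span)
       (use assms aut_eigenvectors_span clinear_aut clinear_brk aut_commute aut_ad_commute in
         \<open>auto simp: weight_space_def g_sigma0_def scaleC_one\<close>)
  also have "?E \<subseteq> (\<Union>k. wvecs a k)"
  proof
    fix y assume y: "y \<in> ?E"
    then have "\<forall>i. \<exists>k::int. aut S i y = (rou S i powi k) *\<^sub>C y" by auto
    then obtain \<kappa> :: "'n option \<Rightarrow> int" where "\<And>i. aut S i y = (rou S i powi \<kappa> i) *\<^sub>C y" by metis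
    then have "y \<in> wvecs a (\<chi> i. \<kappa> (Some i))"
      using y by (auto simp: wvecs_iff scaleC_one)
    then show "y \<in> (\<Union>k. wvecs a k)" by blast
  qed
  then have "cspan ?E \<subseteq> cspan (\<Union>k. wvecs a k)" by (rule cspan_mono)
  finally show ?thesis .
qed

text \<open>\<open>\<hh>(0)\<close> lies in a Cartan subalgebra of \<open>\<gg>\<close>, hence consists of commuting diagonalizable operators;
  it is fixed by the \<open>\<sigma>\<^sub>i\<close>, which have finite order, so all these operators are simultaneously
  diagonalizable.  A basis \<open>H\<close> of \<open>\<hh>(0)\<close> makes the family finite, and the eigenvalues of a joint
  eigenvector depend linearly on the element of \<open>\<hh>(0)\<close>, so they form a weight.\<close>

lemma g_sigma0_span:
  assumes "x \<in> g_sigma0 S"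
  shows "x \<in> cspan (\<Union>a\<in>enlarged_roots0 b S. \<Union>k. wvecs a k)"
proof -
  obtain H where H: "finite H" "H \<subseteq> csa0 S" "cspan H = csa0 S" by (rule csa0_basis)
  let ?E = "{y. (\<forall>h\<in>H. \<exists>c\<in>UNIV. brk S h y = c *\<^sub>C y) \<and> (\<forall>(A, c)\<in>{(aut S None, 1)}. A y = c *\<^sub>C y)}"
  have "x \<in> cspan ?E"
    by (rule joint_eigenvectors_span)
       (use assms H csa0_diag clinear_aut clinear_brk aut_ad_commute in
         \<open>auto simp: g_sigma0_def scaleC_one intro: ad_csa0_commute\<close>)
  moreover have "?E \<subseteq> cspan (\<Union>a\<in>enlarged_roots0 b S. \<Union>k. wvecs a k)"
  proof
    fix y assume y: "y \<in> ?E"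
    show "y \<in> cspan (\<Union>a\<in>enlarged_roots0 b S. \<Union>k. wvecs a k)"
    proof (cases "y = 0")
      case True then show ?thesis by (simp add: cspan_zero)
    next
      case False
      have "cspan H \<subseteq> {h. \<exists>c. brk S h y = c *\<^sub>C y}"
      proof (rule cspan_minimal)
        show "csubspace {h. \<exists>c. brk S h y = c *\<^sub>C y}"
        proof (rule csubspaceI)
          show "0 \<in> {h. \<exists>c. brk S h y = c *\<^sub>C y}" by (auto simp: brk_0 intro: exI [of _ 0])
          show "h + h' \<in> {h. \<exists>c. brk S h y = c *\<^sub>C y}"
            if "h \<in> {h. \<exists>c. brk S h y = c *\<^sub>C y}" "h' \<in> {h. \<exists>c. brk S h y = c *\<^sub>C y}" for h h'
            using that by (auto simp: brk_lin simp flip: scaleC_add_left)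
          show "c *\<^sub>C h \<in> {h. \<exists>c. brk S h y = c *\<^sub>C y}"
            if "h \<in> {h. \<exists>c. brk S h y = c *\<^sub>C y}" for c h
            using that by (auto simp: brk_lin scaleC_scaleC)
        qed
      qed (use y in auto)
      with H have "\<forall>h\<in>csa0 S. \<exists>c. brk S h y = c *\<^sub>C y" by auto
      then obtain a0 where a0: "\<And>h. h \<in> csa0 S \<Longrightarrow> brk S h y = a0 h *\<^sub>C y" by metis
      define a where "a h = (if h \<in> csa0 S then a0 h else 0)" for h
      have a: "brk S h y = a h *\<^sub>C y" if "h \<in> csa0 S" for h using a0 that by (simp add: a_def)
      have "a (h + h') = a h + a h'" if "h \<in> csa0 S" "h' \<in> csa0 S" for h h'
      proof -
        have "a (h + h') *\<^sub>C y = (a h + a h') *\<^sub>C y"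
          using a [of h] a [of h'] a [of "h + h'"] that csa0_subspace
          by (simp add: brk_lin scaleC_add_left csubspace_add)
        then show ?thesis using False by simp
      qed
      moreover have "a (c *\<^sub>C h) = c * a h" if "h \<in> csa0 S" for h c
      proof -
        have "a (c *\<^sub>C h) *\<^sub>C y = brk S (c *\<^sub>C h) y"
          using a that csa0_subspace by (simp add: csubspace_scale)
        also have "\<dots> = (c * a h) *\<^sub>C y" using a [OF that] by (simp add: brk_lin scaleC_scaleC)
        finally have "a (c *\<^sub>C h) *\<^sub>C y = (c * a h) *\<^sub>C y" .
        then show ?thesis using False by simp
      qed
      ultimately have "a \<in> dual_space (csa0 S)"
        by (auto simp: dual_space_def clinear_on_def scaleC_complex_def) (simp add: a_def)
      moreover have "y \<in> weight_space (brk S) (csa0 S) a UNIV" using a by (auto simp: weight_space_def)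
      ultimately have "a \<in> weights (brk S) (csa0 S) UNIV" using False by (auto simp: weights_def)
      then have "a \<in> enlarged_roots0 b S" using setting by (simp add: toroidal_setting_def)
      moreover have "y \<in> cspan (\<Union>k. wvecs a k)"
        by (rule weight_space_sigma0_span) (use y a in \<open>auto simp: weight_space_def g_sigma0_def scaleC_one\<close>)
      moreover have "cspan (\<Union>k. wvecs a k) \<subseteq> cspan (\<Union>a\<in>enlarged_roots0 b S. \<Union>k. wvecs a k)"
        by (rule cspan_mono) (use calculation(1) in blast)
      ultimately show ?thesis by blast
    qed
  qed
  ultimately show ?thesis
    by (metis (no_types, lifting) cspan_minimal complex_vector.subspace_span subsetD)
qed

lemma roots_dual: "a \<in> enlarged_roots0 b S \<Longrightarrow> h \<notin> csa0 S \<Longrightarrow> a h = 0"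
  using setting by (auto simp: toroidal_setting_def weights_def dual_space_def dest!: equalityD2)

text \<open>An additive functional whose sign decides between positive and negative weights.  It is used to order
  the weights of the induced module.\<close>

definition height :: "(('g \<Rightarrow> complex) \<Rightarrow> real) \<Rightarrow> bool" where
  "height f \<longleftrightarrow> (\<forall>a a'. f (\<lambda>x. a x + a' x) = f a + f a') \<and> f (\<lambda>x. 0) = 0 \<and>
     (\<forall>a\<in>enlarged_roots0 b S. a = (\<lambda>x. 0) \<or> a \<in> pos S \<or> f a < 0)"

lemma height_exists: "\<exists>f. height f"
proof -
  have "positive_choice (enlarged_roots0 b S) (pos S)"
    using setting by (simp add: toroidal_setting_def)
  then obtain f :: "('g \<Rightarrow> complex) \<Rightarrow> real" where "(\<forall>a a'. f (\<lambda>x. a x + a' x) = f a + f a') \<and>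
      (\<forall>c a. f (\<lambda>x. of_real c * a x) = c * f a) \<and>
      (\<forall>a\<in>enlarged_roots0 b S - {\<lambda>x. 0}. f a \<noteq> 0) \<and> pos S = {a \<in> enlarged_roots0 b S. f a > 0}"
    unfolding positive_choice_def by (rule exE)
  then have f: "f (\<lambda>x. a x + a' x) = f a + f a'"
    "a \<in> enlarged_roots0 b S \<Longrightarrow> a \<noteq> (\<lambda>x. 0) \<Longrightarrow> f a \<noteq> 0" "pos S = {a \<in> enlarged_roots0 b S. f a > 0}" for a a'
    by simp_all
  have "f (\<lambda>x. 0) = 0" using f(1) [of "\<lambda>x. 0" "\<lambda>x. 0"] by simp
  with f have "height f" by (auto simp: height_def neq_iff)
  then show ?thesis by blast
qed

lemma g_sigma0_subspace: "csubspace (g_sigma0 S)"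
  by (rule csubspaceI) (auto simp: g_sigma0_def aut_lin clinear_0 [OF clinear_aut])

lemma g_sigma0_brk: "x \<in> g_sigma0 S \<Longrightarrow> y \<in> g_sigma0 S \<Longrightarrow> brk S x y \<in> g_sigma0 S"
  by (simp add: g_sigma0_def aut_brk)

text \<open>The projection to the fixed points of \<open>\<sigma>\<^sub>0\<close>, by averaging.  Precomposition with it extends an action
  of \<open>\<gg>(\<sigma>\<^sub>0)\<close> to a map that is linear on all of \<open>\<gg>\<close>.\<close>

definition sigma0_proj :: "'g \<Rightarrow> 'g" where
  "sigma0_proj x = (1 / of_nat (per S None)) *\<^sub>C (\<Sum>k<per S None. (aut S None ^^ k) x)"

lemma clinear_sigma0_proj: "clinear sigma0_proj"
proof -
  have "(aut S None ^^ k) (x + y) = (aut S None ^^ k) x + (aut S None ^^ k) y"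
    "(aut S None ^^ k) (c *\<^sub>C x) = c *\<^sub>C (aut S None ^^ k) x" for k x y c
    by (induction k) (auto simp: aut_lin)
  then show ?thesis
    by (simp add: clinear_iff sigma0_proj_def sum.distrib scaleC_add_right scaleC_scaleC
        complex_vector.scale_sum_right mult.commute)
qed

lemma sigma0_proj_in: "sigma0_proj x \<in> g_sigma0 S"
proof -
  let ?m = "per S None" and ?T = "aut S None"
  interpret T: Vector_Spaces.linear scaleC scaleC ?T by (rule clinear_aut)
  have "?T (\<Sum>k<?m. (?T ^^ k) x) = (\<Sum>k<?m. (?T ^^ Suc k) x)" by (simp add: T.sum)
  also have "\<dots> = (\<Sum>k<?m. (?T ^^ k) x)"
    using sum.lessThan_Suc_shift [of "\<lambda>k. (?T ^^ k) x" ?m] aut_per [of None x]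
    by (simp del: funpow.simps(2))
  finally show ?thesis by (simp add: sigma0_proj_def g_sigma0_def T.scale)
qed

lemma sigma0_proj_id:
  assumes "x \<in> g_sigma0 S" shows "sigma0_proj x = x"
proof -
  have "(aut S None ^^ k) x = 1 *\<^sub>C x" for k
    using assms by (induction k) (auto simp: g_sigma0_def scaleC_one)
  then have "sigma0_proj x = (1 / of_nat (per S None)) *\<^sub>C (\<Sum>k<per S None. 1) *\<^sub>C x"
    by (simp only: sigma0_proj_def complex_vector.scale_sum_left)
  then show ?thesis
    using per_pos [of None] by (simp add: scaleC_scaleC scaleC_one)
qed

end

section \<open>Bilinear extension from homogeneous elements\<close>

lemma clinear_add: "clinear f \<Longrightarrow> f (x + y) = f x + f y"
  and clinear_scaleC: "clinear f \<Longrightarrow> f (c *\<^sub>C x) = c *\<^sub>C f x"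
  by (simp_all add: clinear_iff)

lemma cbilinearI:
  assumes "\<And>a. clinear (h a)" "\<And>b. clinear (\<lambda>a. h a b)" shows "cbilinear h"
  using assms by (simp add: cbilinear_def)

lemma cbilinear_pm_conv:
  fixes F :: "'k \<Rightarrow> 'a::complex_vector \<Rightarrow> 'l \<Rightarrow> 'b::complex_vector \<Rightarrow> 'c::complex_vector"
  assumes "\<And>k l. cbilinear (\<lambda>x y. F k x l y)"
  shows "cbilinear (pm_conv F)"
proof (rule cbilinearI)
  show "clinear (pm_conv F f)" for f
    by (rule clinear_pm_conv) (use assms in \<open>simp add: cbilinear_def\<close>)
  show "clinear (\<lambda>f. pm_conv F f g)" for g
    unfolding pm_conv_def
    by (rule clinear_pm_sum)
       (use assms in \<open>simp add: cbilinear_def clinear_iff pm_sum_def sum.distrib complex_vector.scale_sum_right\<close>)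
qed

lemma poly_mapping_in_span_singles:
  fixes f :: "'k \<Rightarrow>\<^sub>0 'a::complex_vector"
  assumes "\<And>k. lookup f k \<in> A k"
  shows "f \<in> cspan {single k x | k x. x \<in> A k}"
proof -
  have "f = (\<Sum>k\<in>keys f. single k (lookup f k))"
    by (rule poly_mapping_eqI) (simp add: lookup_sum lookup_single when_def in_keys_iff if_distrib cong: if_cong)
  also have "\<dots> \<in> cspan {single k x | k x. x \<in> A k}"
    by (intro cspan_sum cspan_base) (use assms in blast)
  finally show ?thesis .
qed

lemma clinear_span_subset:
  assumes "clinear f" "x \<in> cspan A" "csubspace N" "\<And>a. a \<in> A \<Longrightarrow> f a \<in> N"
  shows "f x \<in> N"
proof -
  have "cspan A \<subseteq> {x. f x \<in> N}"
    by (rule cspan_minimal)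
       (use assms clinear_0 [OF assms(1)] in \<open>auto simp: clinear_iff csubspace_zero
          csubspace_add csubspace_scale intro!: csubspaceI\<close>)
  with assms(2) show ?thesis by blast
qed

text \<open>The form in which bilinearity is used below: an identity or an inclusion for a bilinear map holds
  on two spans once it holds on the spanning vectors.\<close>

lemma cbilinear_span_subset:
  assumes h: "cbilinear h" and "x \<in> cspan A" "y \<in> cspan B" "csubspace N"
    and "\<And>a b. a \<in> A \<Longrightarrow> b \<in> B \<Longrightarrow> h a b \<in> N"
  shows "h x y \<in> N"
proof (rule clinear_span_subset [of "\<lambda>x. h x y"])
  fix a assume "a \<in> A"
  with h assms show "h a y \<in> N"
    by (intro clinear_span_subset [of "h a" y B]) (auto simp: cbilinear_def)
qed (use assms in \<open>auto simp: cbilinear_def\<close>)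

lemma csubspace_0: "csubspace {0}"
  by (rule complex_vector.subspace_single_0)

lemma cbilinear_scaled:
  fixes w :: "'c::complex_vector"
  assumes "cbilinear h" shows "cbilinear (\<lambda>x y. h x y *\<^sub>C w)"
  using assms by (simp add: cbilinear_def clinear_iff scaleC_add_left scaleC_scaleC scaleC_complex_def)

lemma cbilinear_single:
  assumes "cbilinear h" shows "cbilinear (\<lambda>x y. single k (h x y))"
  using assms by (simp add: cbilinear_def clinear_iff single_clinear)

lemma cbilinear_der_L: "cbilinear der_L"
  unfolding der_L_def
  by (rule cbilinear_pm_conv, rule cbilinear_single)
     (simp add: cbilinear_def clinear_iff dot_linear scaleC_add_left scaleC_add_right scaleC_scaleC mult.commute)

lemma cbilinear_der_K: "cbilinear der_K"
proof (rule cbilinearI)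
  have b: "cbilinear (der_K_rep :: 'a derivations \<Rightarrow> _)"
    unfolding der_K_rep_def
    by (rule cbilinear_pm_conv, rule cbilinear_single)
       (simp add: cbilinear_def clinear_iff dot_linear scaleC_add_left scaleC_add_right scaleC_scaleC mult.commute)
  show "clinear (der_K D)" for D :: "'a derivations"
    unfolding clinear_iff
    by (intro conjI allI; transfer) (use b in \<open>auto simp: cbilinear_def clinear_iff cspan_zero\<close>)
  show "clinear (\<lambda>D :: 'a derivations. der_K D z)" for z
    unfolding clinear_iff
    by (intro conjI allI; transfer) (use b in \<open>auto simp: cbilinear_def clinear_iff cspan_zero\<close>)
qed

lemma K0_part_linear:
  "K0_part (x + y) = K0_part x + K0_part y" "K0_part (c *\<^sub>C x) = c *\<^sub>C K0_part x"
proof -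
  show "K0_part (x + y) = K0_part x + K0_part y"
    by transfer (rule poly_mapping_eqI, auto simp: map.rep_eq lookup_map_key_emb lookup_add when_def vec_eq_iff)
  show "K0_part (c *\<^sub>C x) = c *\<^sub>C K0_part x"
    by transfer (rule poly_mapping_eqI, auto simp: map.rep_eq lookup_map_key_emb lookup_scaleC when_def
        scaleC_vec_def scaleC_complex_def vec_eq_iff)
qed

lemma map_key_emb_linear:
  "Poly_Mapping.map_key emb (f + g) = Poly_Mapping.map_key emb f + Poly_Mapping.map_key emb g"
  "Poly_Mapping.map_key emb (c *\<^sub>C h) = c *\<^sub>C Poly_Mapping.map_key emb h"
  for h :: "int ^ ('n::finite option) \<Rightarrow>\<^sub>0 'a::complex_vector"
  by (rule poly_mapping_eqI, simp add: lookup_map_key_emb lookup_add lookup_scaleC)+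

lemma cbilinear_add:
  assumes "cbilinear h" "cbilinear h'" shows "cbilinear (\<lambda>x y. h x y + h' x y)"
  using assms by (simp add: cbilinear_def clinear_iff scaleC_add_right)

lemma cbilinear_diff:
  assumes "cbilinear h" "cbilinear h'" shows "cbilinear (\<lambda>x y. h x y - h' x y)"
  using assms by (simp add: cbilinear_def clinear_iff complex_vector.scale_right_diff_distrib)

lemma cbilinear_compose:
  assumes "cbilinear h" "clinear f" "clinear g" shows "cbilinear (\<lambda>x y. h (f x) (g y))"
  using assms by (simp add: cbilinear_def clinear_iff)

lemma cbilinear_swap:
  assumes "cbilinear h" shows "cbilinear (\<lambda>x y. h y x)"
  using assms by (simp add: cbilinear_def)

lemma clinear_projections:
  "clinear fst" "clinear snd" "clinear (\<lambda>x. fst (snd x))" "clinear (\<lambda>x. snd (snd x))"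
  by (simp_all add: clinear_iff scaleC_prod_def)

lemma clinear_plus: "clinear f \<Longrightarrow> clinear g \<Longrightarrow> clinear (\<lambda>x. f x + g x)"
  by (simp add: clinear_iff scaleC_add_right)

lemma clinear_diff:
  "clinear f \<Longrightarrow> clinear g \<Longrightarrow> clinear (\<lambda>x. f x - g x)"
  by (simp add: clinear_iff complex_vector.scale_right_diff_distrib)

lemma clinear_single: "clinear (single k)"
  by (simp add: clinear_iff single_clinear)

lemma single_diff:
  "single k (p - q) = single k p - single k (q :: 'a::ab_group_add)"
  by (rule poly_mapping_eqI) (simp add: lookup_minus lookup_single when_def)

lemma clinear_single_comp: "clinear f \<Longrightarrow> clinear (\<lambda>x. single k (f x))"
  by (simp add: clinear_iff single_clinear)

lemma tK_expand: "tK r w = (\<Sum>i\<in>UNIV. w $ i *\<^sub>C tK r (axis i 1))"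
proof -
  have "w = (\<Sum>i\<in>UNIV. w $ i *\<^sub>C axis i (1::complex))"
    by (simp add: vec_eq_iff scaleC_vec_def scaleC_complex_def axis_def if_distrib [of "(*) _"] cong: if_cong)
  then have "tK r w = tK r (\<Sum>i\<in>UNIV. w $ i *\<^sub>C axis i 1)" by simp
  also have "\<dots> = (\<Sum>i\<in>UNIV. tK r (w $ i *\<^sub>C axis i 1))"
    using sum_comp_morphism [of "tK r" "\<lambda>i. w $ i *\<^sub>C axis i 1" UNIV] by (simp add: tK_linear o_def)
  finally show ?thesis by (simp add: tK_linear)
qed

lemma cvec_0 [simp]: "cvec 0 = 0"
  by (simp add: cvec_def vec_eq_iff)

lemma cvec_nth: "cvec r $ i = of_int (r $ i)"
  by (simp add: cvec_def)

lemma loop_act_linear_vector: "clinear (loop_act gl act \<alpha> d C0 X)"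
proof -
  obtain f z D where X: "X = (f, z, D)" by (cases X)
  show ?thesis
    unfolding X loop_act.simps
  proof (rule clinear_plus; (rule clinear_plus)?; rule clinear_pm_conv; rule clinear_single_comp)
    show "clinear (tensor_map id (act x))" for x by (rule clinear_tensor_map)
  qed (simp_all add: clinear_iff scaleC_add_right scaleC_scaleC mult.commute tensor_map_add tensor_map_scaleC
        sum.distrib complex_vector.scale_sum_right)
qed

context toroidal
begin

lemma cbilinear_tau_bracket: "cbilinear (tau_bracket S)"
proof -
  have eq: "tau_bracket S = (\<lambda>X Y.
    (pm_conv (\<lambda>k x l y. single (k + l) (brk S x y)) (fst X) (fst Y) + der_L (snd (snd X)) (fst Y) - der_L (snd (snd Y)) (fst X),
     pm_conv (\<lambda>k x l y. frm S x y *\<^sub>C tK (k + l) (cvec k)) (fst X) (fst Y) + der_K (snd (snd X)) (fst (snd Y)) - der_K (snd (snd Y)) (fst (snd X)) +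
       pm_conv (\<lambda>r u s v. (coc2 S * (dot u (cvec r) * dot v (cvec s)) - coc1 S * (dot u (cvec s) * dot v (cvec r)))
          *\<^sub>C tK (r + s) (cvec r)) (snd (snd X)) (snd (snd Y)),
     pm_conv (\<lambda>r u s v. single (r + s) (dot u (cvec s) *\<^sub>C v - dot v (cvec r) *\<^sub>C u)) (snd (snd X)) (snd (snd Y))))"
    by (intro ext) (auto split: prod.splits)
  have pair: "cbilinear (\<lambda>x y. (h x y, h' x y))" if "cbilinear h" "cbilinear h'"
    for h :: "('g,'n) toroidal \<Rightarrow> ('g,'n) toroidal \<Rightarrow> 'c::complex_vector" and h' :: "('g,'n) toroidal \<Rightarrow> ('g,'n) toroidal \<Rightarrow> 'd::complex_vector"
    using that by (simp add: cbilinear_def clinear_iff scaleC_prod_def)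
  have 1: "cbilinear (pm_conv (\<lambda>k x l y. single (k + l) (brk S x y)) :: (int ^ 'n option \<Rightarrow>\<^sub>0 'g) \<Rightarrow> _)"
    by (rule cbilinear_pm_conv, rule cbilinear_single) (rule cbilinear_brk)
  have 2: "cbilinear (pm_conv (\<lambda>k x l y. frm S x y *\<^sub>C tK (k + l) (cvec k)) :: (int ^ 'n option \<Rightarrow>\<^sub>0 'g) \<Rightarrow> _)"
    by (rule cbilinear_pm_conv, rule cbilinear_scaled) (rule cbilinear_frm)
  have 3: "cbilinear (pm_conv (\<lambda>r u s v. (coc2 S * (dot u (cvec r) * dot v (cvec s)) - coc1 S * (dot u (cvec s) * dot v (cvec r)))
          *\<^sub>C tK (r + s) (cvec r)) :: 'n option derivations \<Rightarrow> _)"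
    by (rule cbilinear_pm_conv, rule cbilinear_scaled)
       (simp add: cbilinear_def clinear_iff dot_linear scaleC_complex_def algebra_simps)
  have 4: "cbilinear (pm_conv (\<lambda>r u s v. single (r + s) (dot u (cvec s) *\<^sub>C v - dot v (cvec r) *\<^sub>C u)) :: 'n option derivations \<Rightarrow> _)"
    by (rule cbilinear_pm_conv, rule cbilinear_single)
       (simp add: cbilinear_def clinear_iff dot_linear scaleC_add_left scaleC_add_right scaleC_scaleC
          complex_vector.scale_right_diff_distrib algebra_simps)
  show ?thesis
    unfolding eq
    by (intro pair cbilinear_add cbilinear_diff cbilinear_compose [OF 1] cbilinear_compose [OF 2] cbilinear_compose [OF 3]
        cbilinear_compose [OF 4] cbilinear_compose [OF cbilinear_der_L] cbilinear_compose [OF cbilinear_der_K]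
        cbilinear_swap [OF cbilinear_compose [OF cbilinear_der_L]] cbilinear_swap [OF cbilinear_compose [OF cbilinear_der_K]]
        clinear_projections)
qed

text \<open>Spanning vectors of the part of \<open>\<tau>\<close> on which \<open>d\<^sub>0\<close> has eigenvalue \<open>c\<close>.\<close>

definition deg_gens :: "int \<Rightarrow> ('g, 'n) toroidal set" where
  "deg_gens c = {loopX k x | k x. x \<in> eigen S k \<and> k $ None = c} \<union>
     {(0, tK r w, 0) | r w. r \<in> full_lattice S \<and> r $ None = c} \<union>
     {(0, 0, single r u) | r u. r \<in> full_lattice S \<and> r $ None = c}"

lemma tau_span_deg_gens: "tau S \<subseteq> cspan (\<Union>c. deg_gens c)"
proof
  fix X assume "X \<in> tau S"
  then obtain f z D where X: "X = (f, z, D)" "\<And>k. lookup f k \<in> eigen S k"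
      "z \<in> cspan {tK r (axis i 1) | r i. r \<in> full_lattice S}" "keys D \<subseteq> full_lattice S"
    by (auto simp: tau_def)
  let ?N = "cspan (\<Union>c. deg_gens c)"
  have L: "loopX k x \<in> ?N" if "x \<in> eigen S k" for k x
  proof -
    have "loopX k x \<in> deg_gens (k $ None)" using that by (auto simp: deg_gens_def)
    then show ?thesis by (intro cspan_base) blast
  qed
  have f: "(f, 0, 0) \<in> ?N"
    by (rule clinear_span_subset [of "\<lambda>f. (f, 0, 0)", OF _ poly_mapping_in_span_singles [OF X(2)]])
       (use L in \<open>auto simp: clinear_iff scaleC_prod_def loopX_def\<close>)
  have K: "(0, tK r w, 0) \<in> ?N" if "r \<in> full_lattice S" for r w
  proof -
    have "(0, tK r w, 0) \<in> deg_gens (r $ None)" using that by (auto simp: deg_gens_def)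
    then show ?thesis by (intro cspan_base) blast
  qed
  have z: "(0, z, 0) \<in> ?N"
    by (rule clinear_span_subset [of "\<lambda>z. (0, z, 0)", OF _ X(3)])
       (use K in \<open>auto simp: clinear_iff scaleC_prod_def\<close>)
  have D: "(0, 0, single r u) \<in> ?N" if "r \<in> full_lattice S \<or> u = 0" for r u
  proof (cases "u = 0")
    case True
    then show ?thesis using cspan_zero [of "\<Union>c. deg_gens c"] by (simp add: zero_prod_def)
  next
    case False
    then have "(0, 0, single r u) \<in> deg_gens (r $ None)" using that by (auto simp: deg_gens_def)
    then show ?thesis by (intro cspan_base) blast
  qed
  have d: "(0, 0, D) \<in> ?N"
  proof (rule clinear_span_subset [of "\<lambda>D. (0, 0, D)", OF _ poly_mapping_in_span_singles])
    show "lookup D k \<in> {u. k \<in> full_lattice S \<or> u = 0}" for k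
      using X(4) by (auto simp: in_keys_iff)
  qed (use D in \<open>auto simp: clinear_iff scaleC_prod_def\<close>)
  have "(f, 0, 0) + (0, z, 0) + (0, 0, D) \<in> ?N"
    by (rule cspan_add [OF cspan_add [OF f z] d])
  then show "X \<in> ?N" by (simp add: X(1))
qed

lemma ad_d0_deg_gens:
  assumes "X \<in> deg_gens c" shows "tau_bracket S (tdi 0 None) X = of_int c *\<^sub>C X"
  using assms
  by (auto simp: deg_gens_def tdi_def loopX_def der_L_def pm_conv_single dot_linear dot_axis scaleC_prod_def cvec_nth
      der_K_single single_clinear tK_scaleC)

lemma deg_gens_tau: "deg_gens c \<subseteq> tau S"
proof -
  have "0 \<in> eigen S k" for k by (simp add: eigen_def clinear_0 [OF clinear_aut])
  then have "loopX k x \<in> tau S" if "x \<in> eigen S k" for k x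
    using that by (auto simp: tau_def loopX_def lookup_single when_def cspan_zero)
  moreover have "(0, tK r w, 0) \<in> tau S" if "r \<in> full_lattice S" for r w
  proof -
    have "tK r w \<in> cspan {tK r (axis i 1) | r i. r \<in> full_lattice S}"
      unfolding tK_expand [of r w]
      by (intro cspan_sum complex_vector.span_scale cspan_base) (use that in blast)
    then show ?thesis by (simp add: tau_def eigen_def clinear_0 [OF clinear_aut])
  qed
  moreover have "(0, 0, single r u) \<in> tau S" if "r \<in> full_lattice S" for r u
    using that by (simp add: tau_def eigen_def clinear_0 [OF clinear_aut] cspan_zero)
  ultimately show ?thesis by (auto simp: deg_gens_def)
qed

text \<open>The generators of degree \<open>c\<close> are eigenvectors of \<open>d\<^sub>0\<close> for \<open>c\<close>, so the kernel of \<open>d\<^sub>0\<close> is spanned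
  by those of degree \<open>0\<close>.\<close>

lemma tau0_span_deg_gens: "tau0 S \<subseteq> cspan (deg_gens 0)"
proof
  fix X assume X: "X \<in> tau0 S"
  have "X \<in> cspan (\<Union>c\<in>{c\<in>UNIV. \<forall>j\<in>(UNIV :: unit set). of_int c = (0::complex)}. deg_gens c)"
  proof (rule joint_eigenvector_in_span [where J = "UNIV :: unit set" and T = "\<lambda>_. tau_bracket S (tdi 0 None)"
        and \<mu> = "\<lambda>c _. of_int c" and \<nu> = "\<lambda>_. 0"])
    show "clinear (tau_bracket S (tdi 0 None))"
      using cbilinear_tau_bracket unfolding cbilinear_def by blast
    show "X \<in> cspan (\<Union>c\<in>UNIV. deg_gens c)" using X tau_span_deg_gens by (auto simp: tau0_def)
  qed (use X ad_d0_deg_gens in \<open>auto simp: tau0_def\<close>)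
  then show "X \<in> cspan (deg_gens 0)" by simp
qed

lemma deg_gens0_tau0: "deg_gens 0 \<subseteq> tau0 S"
  using deg_gens_tau ad_d0_deg_gens [of _ 0] by (auto simp: tau0_def)

end

section \<open>The loop module over the degree zero part\<close>

lemma clinear_tensor_map_left:
  assumes "\<And>x. clinear (h x)" "\<And>v. clinear (\<lambda>x. h x v)"
  shows "clinear (\<lambda>x. tensor_map (h x) id w)"
proof -
  have lin: "h (x + y) v = h x v + h y v" "h (c *\<^sub>C x) v = c *\<^sub>C h x v" for x y c v
    using assms(2) by (simp_all add: clinear_iff)
  note t = tensor_map_tensor [OF assms(1) clinear_id]
  show ?thesis
    unfolding clinear_iff
  proof (intro conjI allI)
    show "tensor_map (h (x + y)) id w = tensor_map (h x) id w + tensor_map (h y) id w" for x y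
      by (rule clinear_eq_on_tensors [where f = "tensor_map (h (x + y)) id" and g = "\<lambda>w. tensor_map (h x) id w + tensor_map (h y) id w"])
         (simp_all add: clinear_iff tensor_map_add tensor_map_scaleC t lin tensor_linear scaleC_add_right)
    show "tensor_map (h (c *\<^sub>C x)) id w = c *\<^sub>C tensor_map (h x) id w" for c x
      by (rule clinear_eq_on_tensors [where f = "tensor_map (h (c *\<^sub>C x)) id" and g = "\<lambda>w. c *\<^sub>C tensor_map (h x) id w"])
         (simp_all add: clinear_iff tensor_map_add tensor_map_scaleC t lin tensor_linear scaleC_add_right
            scaleC_scaleC mult.commute)
  qed
qed

lemma clinear_tensor_map_right:
  assumes "\<And>x. clinear (h x)" "\<And>v. clinear (\<lambda>x. h x v)"
  shows "clinear (\<lambda>x. tensor_map id (h x) w)"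
proof -
  have lin: "h (x + y) v = h x v + h y v" "h (c *\<^sub>C x) v = c *\<^sub>C h x v" for x y c v
    using assms(2) by (simp_all add: clinear_iff)
  note t = tensor_map_tensor [OF clinear_id assms(1)]
  show ?thesis
    unfolding clinear_iff
  proof (intro conjI allI)
    show "tensor_map id (h (x + y)) w = tensor_map id (h x) w + tensor_map id (h y) w" for x y
      by (rule clinear_eq_on_tensors [where f = "tensor_map id (h (x + y))" and g = "\<lambda>w. tensor_map id (h x) w + tensor_map id (h y) w"])
         (simp_all add: clinear_iff tensor_map_add tensor_map_scaleC t lin tensor_linear scaleC_add_right)
    show "tensor_map id (h (c *\<^sub>C x)) w = c *\<^sub>C tensor_map id (h x) w" for c x
      by (rule clinear_eq_on_tensors [where f = "tensor_map id (h (c *\<^sub>C x))" and g = "\<lambda>w. c *\<^sub>C tensor_map id (h x) w"])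
         (simp_all add: clinear_iff tensor_map_add tensor_map_scaleC t lin tensor_linear scaleC_add_right
            scaleC_scaleC mult.commute)
  qed
qed

lemma tensor_diff:
  "(a - a') \<otimes>\<^sub>C b = a \<otimes>\<^sub>C b - a' \<otimes>\<^sub>C b" "a \<otimes>\<^sub>C (b - b') = a \<otimes>\<^sub>C b - a \<otimes>\<^sub>C b'"
proof -
  show "(a - a') \<otimes>\<^sub>C b = a \<otimes>\<^sub>C b - a' \<otimes>\<^sub>C b"
    using tensor_linear(1) [of "a - a'" a' b] by simp
  show "a \<otimes>\<^sub>C (b - b') = a \<otimes>\<^sub>C b - a \<otimes>\<^sub>C b'"
    using tensor_linear(2) [of a "b - b'" b'] by (simp add: eq_diff_eq)
qed

lemma tensor_map_commutator_left:
  assumes "clinear f" "clinear g" "clinear h" "\<And>v. h v = f (g v) - g (f v)"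
  shows "tensor_map h id w = tensor_map f id (tensor_map g id w) - tensor_map g id (tensor_map f id w)"
proof (rule clinear_eq_on_tensors [where f = "tensor_map h id"
      and g = "\<lambda>w. tensor_map f id (tensor_map g id w) - tensor_map g id (tensor_map f id w)"])
  show "clinear (\<lambda>w. tensor_map f id (tensor_map g id w) - tensor_map g id (tensor_map f id w))"
    by (simp add: clinear_iff tensor_map_add tensor_map_scaleC complex_vector.scale_right_diff_distrib)
qed (use assms in \<open>simp_all add: clinear_tensor_map tensor_map_tensor [OF _ clinear_id] tensor_diff\<close>)

lemma tensor_map_commutator_right:
  assumes "clinear f" "clinear g" "clinear h" "\<And>v. h v = f (g v) - g (f v)"
  shows "tensor_map id h w = tensor_map id f (tensor_map id g w) - tensor_map id g (tensor_map id f w)"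
proof (rule clinear_eq_on_tensors [where f = "tensor_map id h"
      and g = "\<lambda>w. tensor_map id f (tensor_map id g w) - tensor_map id g (tensor_map id f w)"])
  show "clinear (\<lambda>w. tensor_map id f (tensor_map id g w) - tensor_map id g (tensor_map id f w))"
    by (simp add: clinear_iff tensor_map_add tensor_map_scaleC complex_vector.scale_right_diff_distrib)
qed (use assms in \<open>simp_all add: clinear_tensor_map tensor_map_tensor [OF clinear_id] tensor_diff\<close>)

lemma tensor_map_id_swap:
  assumes "clinear f" "clinear g"
  shows "tensor_map f id (tensor_map id g w) = tensor_map id g (tensor_map f id w)"
  by (rule clinear_eq_on_tensors [where f = "\<lambda>w. tensor_map f id (tensor_map id g w)"
        and g = "\<lambda>w. tensor_map id g (tensor_map f id w)"])
     (use assms in \<open>simp_all add: clinear_iff [of "\<lambda>w. tensor_map _ _ (tensor_map _ _ w)"]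
        tensor_map_add tensor_map_scaleC tensor_map_tensor [OF clinear_id] tensor_map_tensor [OF _ clinear_id]\<close>)

text \<open>The matrix \<open>r u\<^sup>T\<close> (the entry of \<open>u\<close> at \<open>None\<close>, the coefficient of \<open>d\<^sub>0\<close>, is left out); it
  is \<open>\<Sum>\<^sub>i\<^sub>j u\<^sub>i r\<^sub>j E\<^sub>j\<^sub>i\<close>, the matrix by which \<open>D(u, r)\<close> acts on the first tensor factor.\<close>

definition outer :: "int ^ 'n \<Rightarrow> complex ^ 'n option \<Rightarrow> complex ^ 'n ^ 'n" where
  "outer r u = (\<chi> a b. of_int (r $ a) * u $ Some b)"

definition zdot :: "complex ^ 'n option \<Rightarrow> int ^ 'n::finite \<Rightarrow> complex" where
  "zdot u r = (\<Sum>i\<in>UNIV. u $ Some i * of_int (r $ i))"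

lemma outer_commutator:
  "gl_bracket (outer r u) (outer s v) =
     zdot u s *\<^sub>C outer r v - zdot v r *\<^sub>C outer s u"
  by (simp add: gl_bracket_def outer_def zdot_def matrix_matrix_mult_def vec_eq_iff scaleC_vec_def scaleC_complex_def
      sum_distrib_left sum_distrib_right mult_ac)

lemma dot_emb: "dot u (cvec (emb r)) = zdot u r"
proof -
  have "dot u (cvec (emb r)) = (\<Sum>i\<in>insert None (range Some). u $ i * cvec (emb r) $ i)"
    unfolding dot_def by (rule sum.cong) (auto simp: UNIV_option_conv)
  also have "\<dots> = zdot u r"
    by (subst sum.insert) (auto simp: zdot_def cvec_def emb_def sum.reindex)
  finally show ?thesis .
qed

lemma zdot_0 [simp]: "zdot 0 r = 0"
  by (simp add: zdot_def)

lemma emb_add: "emb (k + l) = emb k + emb l"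
  by (simp add: emb_def vec_eq_iff split: option.splits)

locale sigma0_module = toroidal b S
  for b :: nat and S :: "('g::complex_vector, 'n::finite) toroidal_data" +
  fixes act :: "'g \<Rightarrow> 'w::complex_vector \<Rightarrow> 'w" and G :: "(int ^ 'n) set \<Rightarrow> 'w set"
  assumes act: "graded_module S (g_sigma0 S) act G"
begin

lemma act_module: "lie_module (brk S) (g_sigma0 S) act UNIV"
  and act_ds: "direct_sum UNIV (Lambda S) G"
  and act_grade: "x \<in> g_sigma0 S \<Longrightarrow> x \<in> eigen_n S k \<Longrightarrow> v \<in> G (coset S l) \<Longrightarrow> act x v \<in> G (coset S (k + l))"
  using act by (auto simp: graded_module_def)

lemma clinear_act: "x \<in> g_sigma0 S \<Longrightarrow> clinear (act x)"
  and clinear_on_act: "clinear_on (g_sigma0 S) (\<lambda>x. act x v)"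
  and act_commutator: "x \<in> g_sigma0 S \<Longrightarrow> y \<in> g_sigma0 S \<Longrightarrow> act (brk S x y) v = act x (act y v) - act y (act x v)"
  using act_module by (simp_all add: lie_module_def clinear_on_UNIV)

text \<open>The given action is linear only on \<open>\<gg>(\<sigma>\<^sub>0)\<close>; this one is bilinear on the whole type and agrees with
  it there, so that bilinear extension from generators becomes available.\<close>

definition proj_act :: "'g \<Rightarrow> 'w \<Rightarrow> 'w" where
  "proj_act x = act (sigma0_proj x)"

lemma proj_act: "x \<in> g_sigma0 S \<Longrightarrow> proj_act x = act x"
  by (simp add: proj_act_def sigma0_proj_id)

lemma clinear_proj_act: "clinear (proj_act x)" "clinear (\<lambda>x. proj_act x v)"
  using clinear_act [OF sigma0_proj_in] clinear_on_act [of v] sigma0_proj_in clinear_sigma0_proj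
  by (auto simp: proj_act_def clinear_iff clinear_on_def)

lemma proj_act_commutator: "x \<in> g_sigma0 S \<Longrightarrow> y \<in> g_sigma0 S \<Longrightarrow> proj_act (brk S x y) v = proj_act x (proj_act y v) - proj_act y (proj_act x v)"
  by (simp add: proj_act g_sigma0_brk act_commutator)

lemma coset_Lambda: "coset S k \<in> Lambda S"
  by (auto simp: Lambda_def)

lemma G_subspace: "csubspace (G (coset S k))"
  using act_ds coset_Lambda by (auto simp: direct_sum_def)

lemma coset_eq_iff: "coset S k = coset S l \<longleftrightarrow> (\<forall>i. int (per S (Some i)) dvd k $ i - l $ i)"
proof
  assume "coset S k = coset S l"
  moreover have "k \<in> coset S k" by (simp add: coset_def)
  ultimately have "k \<in> coset S l" by simp
  then show "\<forall>i. int (per S (Some i)) dvd k $ i - l $ i" by (simp add: coset_def)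
next
  assume kl: "\<forall>i. int (per S (Some i)) dvd k $ i - l $ i"
  have "int (per S (Some i)) dvd p $ i - k $ i \<longleftrightarrow> int (per S (Some i)) dvd p $ i - l $ i" for p i
  proof -
    have "p $ i - l $ i = (p $ i - k $ i) + (k $ i - l $ i)" by simp
    then show ?thesis using kl by (metis dvd_add_left_iff)
  qed
  then show "coset S k = coset S l" by (simp add: coset_def)
qed

lemma coset_add: "coset S r = coset S 0 \<Longrightarrow> coset S (k + r) = coset S k"
  by (simp add: coset_eq_iff)


end

locale loop_module = sigma0_module b S act G
  for b :: nat and S :: "('g::complex_vector, 'n::finite) toroidal_data"
    and act :: "'g \<Rightarrow> 'w::complex_vector \<Rightarrow> 'w" and G :: "(int ^ 'n) set \<Rightarrow> 'w set" +
  fixes gl :: "complex ^ 'n ^ 'n \<Rightarrow> 'w1::complex_vector \<Rightarrow> 'w1"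
    and \<alpha> :: "complex ^ 'n" and d C0 :: complex
  assumes gl: "lie_module gl_bracket UNIV gl UNIV"
begin

lemma clinear_gl: "clinear (gl A)" "clinear (\<lambda>A. gl A v)"
  and gl_commutator: "gl (gl_bracket A B) v = gl A (gl B v) - gl B (gl A v)"
  using gl by (simp_all add: lie_module_def clinear_on_UNIV)

abbreviation lin_act :: "('g, 'n) toroidal \<Rightarrow> (int ^ 'n \<Rightarrow>\<^sub>0 ('w1, 'w) tensor) \<Rightarrow> (int ^ 'n \<Rightarrow>\<^sub>0 ('w1, 'w) tensor)" where
  "lin_act \<equiv> loop_act gl proj_act \<alpha> d C0"

text \<open>On these elements the actions built from \<open>act\<close> and from \<open>proj_act\<close> coincide; they contain \<open>\<tau>\<^sub>0\<close>.\<close>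

definition sigma0_vals :: "('g, 'n) toroidal set" where
  "sigma0_vals = {X. \<forall>k. lookup (fst X) k \<in> g_sigma0 S}"

lemma sigma0_vals_subspace: "csubspace sigma0_vals"
  by (rule csubspaceI)
     (use g_sigma0_subspace in \<open>auto simp: sigma0_vals_def lookup_add lookup_scaleC scaleC_prod_def csubspace_zero
        csubspace_add csubspace_scale\<close>)

lemma lin_act_eq: "X \<in> sigma0_vals \<Longrightarrow> loop_act gl act \<alpha> d C0 X = lin_act X"
proof -
  assume "X \<in> sigma0_vals"
  then obtain f z D where X: "X = (f, z, D)" "\<And>k. lookup f k \<in> g_sigma0 S"
    by (cases X) (auto simp: sigma0_vals_def)
  show ?thesis
    by (rule ext) (use X(2) in \<open>simp add: X(1) pm_conv_def pm_sum_def [of _ "Poly_Mapping.map_key emb f"] lookup_map_key_emb proj_act\<close>)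
qed

lemma lin_act_D_eq:
  "(\<Sum>i\<in>UNIV. \<Sum>j\<in>UNIV. (u $ Some i * of_int (r $ j)) *\<^sub>C tensor_map (gl (matrix_unit j i)) id v) =
     tensor_map (gl (outer r u)) id v"
proof -
  interpret t: Vector_Spaces.linear scaleC scaleC "\<lambda>A. tensor_map (gl A) id v"
    by (rule clinear_tensor_map_left) (rule clinear_gl)+
  have "outer r u = (\<Sum>i\<in>UNIV. \<Sum>j\<in>UNIV. (u $ Some i * of_int (r $ j)) *\<^sub>C matrix_unit j i)"
  proof -
    have 1: "(\<Sum>i\<in>UNIV. \<Sum>j\<in>UNIV. (u $ Some i * of_int (r $ j)) *\<^sub>C matrix_unit j i) $ a $ b =
       (\<Sum>i\<in>UNIV. \<Sum>j\<in>UNIV. if a = j \<and> b = i then u $ Some i * of_int (r $ j) else 0)" for a b :: 'n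
      by (simp add: matrix_unit_def scaleC_vec_def scaleC_complex_def if_distrib [of "(*) _"] cong: if_cong)
    have "(\<Sum>j\<in>UNIV. if a = j \<and> b = i then u $ Some i * of_int (r $ j) else 0) =
       (if b = i then u $ Some i * of_int (r $ a) else 0)" for a b i :: 'n
      by (cases "b = i") simp_all
    then show ?thesis
      by (simp only: vec_eq_iff 1) (simp add: outer_def)
  qed
  then show ?thesis by (simp add: t.sum t.scale)
qed

lemma lin_act_L: "lin_act (loopX (emb l) x) (single k w) = single (k + l) (tensor_map id (proj_act x) w)"
  by (simp add: loopX_def map_key_emb_single pm_conv_single tensor_map_zero tensor_0
      clinear_0 [OF clinear_proj_act(1)] clinear_0 [OF clinear_proj_act(2)])

lemma lin_act_K: "lin_act (0, tK (emb r) u, 0) (single k w) = single (k + r) ((C0 * u $ None) *\<^sub>C w)"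
  by (simp add: K0_part_tK pm_conv_single)

text \<open>The scalar by which \<open>D(u, r)\<close> acts on degree \<open>k\<close>, apart from its matrix part.\<close>

definition d_coeff :: "complex ^ 'n option \<Rightarrow> int ^ 'n \<Rightarrow> complex" where
  "d_coeff u k = (\<Sum>i\<in>UNIV. u $ Some i * (of_int (k $ i) + \<alpha> $ i)) + d * u $ None"

lemma lin_act_D:
  "lin_act (0, 0, single (emb r) u) (single k w) =
     single (k + r) (d_coeff u k *\<^sub>C w + tensor_map (gl (outer r u)) id w)"
  unfolding loop_act.simps lin_act_D_eq
  by (simp add: map_key_emb_single pm_conv_single d_coeff_def scaleC_add_left tensor_map_zero tensor_0 algebra_simps
      outer_def clinear_0 [OF clinear_gl(2)] zero_vec_def [symmetric])

lemma d_coeff_add: "d_coeff u (k + s) = d_coeff u k + zdot u s"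
  by (simp add: d_coeff_def zdot_def algebra_simps sum.distrib)

lemma cbilinear_lin_act: "cbilinear lin_act"
proof (rule cbilinearI)
  show "clinear (lin_act X)" for X by (rule loop_act_linear_vector)
  show "clinear (\<lambda>X. lin_act X v)" for v
  proof -
    let ?A = "pm_conv (\<lambda>l x k v. single (k + l) (tensor_map id (proj_act x) v))"
    let ?B = "pm_conv (\<lambda>r c k v. single (k + r) ((C0 * c) *\<^sub>C v))"
    let ?C = "pm_conv (\<lambda>r u k v. single (k + r)
         ((\<Sum>i\<in>UNIV. u $ Some i * (of_int (k $ i) + \<alpha> $ i)) *\<^sub>C v
          + tensor_map (gl (outer r u)) id v
          + (d * u $ None) *\<^sub>C v))"
    have A: "cbilinear (?A :: _ \<Rightarrow> (int ^ 'n \<Rightarrow>\<^sub>0 ('w1, 'w) tensor) \<Rightarrow> _)"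
      by (rule cbilinear_pm_conv, rule cbilinear_single, rule cbilinearI, rule clinear_tensor_map,
          rule clinear_tensor_map_right) (rule clinear_proj_act)+
    have B: "cbilinear (?B :: _ \<Rightarrow> (int ^ 'n \<Rightarrow>\<^sub>0 ('w1, 'w) tensor) \<Rightarrow> _)"
      by (rule cbilinear_pm_conv, rule cbilinear_single)
         (simp add: cbilinear_def clinear_iff scaleC_add_left scaleC_add_right scaleC_scaleC scaleC_complex_def algebra_simps)
    have gb: "cbilinear (\<lambda>u v. tensor_map (gl (outer r u)) id v)" for r
    proof (rule cbilinearI, rule clinear_tensor_map)
      fix v
      have "clinear (\<lambda>A. tensor_map (gl A) id v)" by (rule clinear_tensor_map_left) (rule clinear_gl)+
      moreover have "outer r (u + u') = outer r u + outer r u'" "outer r (c *\<^sub>C u) = c *\<^sub>C outer r u" for u u' c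
        by (simp_all add: outer_def vec_eq_iff scaleC_vec_def scaleC_complex_def algebra_simps)
      ultimately show "clinear (\<lambda>u. tensor_map (gl (outer r u)) id v)" by (simp add: clinear_iff)
    qed
    have C: "cbilinear (?C :: _ \<Rightarrow> (int ^ 'n \<Rightarrow>\<^sub>0 ('w1, 'w) tensor) \<Rightarrow> _)"
      by (rule cbilinear_pm_conv, rule cbilinear_single, intro cbilinear_add gb)
         (simp_all add: cbilinear_def clinear_iff scaleC_add_left scaleC_add_right scaleC_scaleC scaleC_complex_def
            scaleC_vec_def algebra_simps sum.distrib sum_distrib_left)
    have eq: "lin_act X v = ?A (Poly_Mapping.map_key emb (fst X)) v + ?B (K0_part (fst (snd X))) v +
        ?C (Poly_Mapping.map_key emb (snd (snd X))) v" for X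
      by (cases X) (simp only: loop_act.simps lin_act_D_eq fst_conv snd_conv)
    show ?thesis
      unfolding eq using A B C
      by (simp add: cbilinear_def clinear_iff map_key_emb_linear K0_part_linear scaleC_prod_def
          scaleC_add_right)
  qed
qed

lemma deg_gens0_cases:
  assumes "X \<in> deg_gens 0"
  obtains (L) l x where "X = loopX (emb l) x" "x \<in> g_sigma0 S" "x \<in> eigen_n S l"
    | (K) r u where "X = (0, tK (emb r) u, 0)" "coset S r = coset S 0"
    | (D) r u where "X = (0, 0, single (emb r) u)" "coset S r = coset S 0"
proof -
  have e: "\<exists>l. k = emb l" if "k $ None = 0" for k :: "int ^ 'n option"
    by (rule exI [of _ "\<chi> i. k $ Some i"]) (use that in \<open>auto simp: emb_def vec_eq_iff split: option.splits\<close>)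
  have c: "coset S r = coset S 0" if "emb r \<in> full_lattice S" for r
  proof -
    have r: "int (per S (Some i)) dvd r $ i" for i
      using that by (auto simp: full_lattice_def emb_def dest: spec [of _ "Some i"])
    show ?thesis using dvd_diff_left_iff [OF r] by (auto simp: coset_def dvd_diff_right_iff)
  qed
  have g: "x \<in> g_sigma0 S \<and> x \<in> eigen_n S l" if "x \<in> eigen S (emb l)" for x l
    using that by (auto simp: eigen_def g_sigma0_def eigen_n_def emb_def scaleC_one dest: spec [of _ None] spec [of _ "Some _"])
  show thesis
    using assms e c g that unfolding deg_gens_def by blast
qed

lemma deg_gens0_sigma0_vals: "deg_gens 0 \<subseteq> sigma0_vals"
proof
  fix X assume "X \<in> deg_gens 0"
  then show "X \<in> sigma0_vals"
    by (cases rule: deg_gens0_cases)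
       (use g_sigma0_subspace csubspace_zero in \<open>auto simp: sigma0_vals_def loopX_def lookup_single when_def\<close>)
qed

lemma tau0_sigma0_vals: "tau0 S \<subseteq> sigma0_vals"
  using tau0_span_deg_gens cspan_minimal [OF deg_gens0_sigma0_vals sigma0_vals_subspace] by blast

abbreviation "K_mon r u \<equiv> (0, tK (emb r) u, 0) :: ('g, 'n) toroidal"
abbreviation "D_mon r u \<equiv> (0, 0, single (emb r) u) :: ('g, 'n) toroidal"

lemma frm_0: "frm S 0 y = 0" "frm S x 0 = 0"
  using cbilinear_frm clinear_0 unfolding cbilinear_def by auto

lemma bracket_LL: "tau_bracket S (loopX (emb l) x) (loopX (emb l') y) =
    loopX (emb (l + l')) (brk S x y) + K_mon (l + l') (frm S x y *\<^sub>C cvec (emb l))"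
  by (simp add: loopX_def pm_conv_single brk_0 frm_0 emb_add tK_scaleC)

lemma bracket_LK: "tau_bracket S (loopX (emb l) x) (K_mon r u) = 0" "tau_bracket S (K_mon r u) (loopX (emb l) x) = 0"
   "tau_bracket S (K_mon r u) (K_mon s v) = 0"
  by (simp_all add: loopX_def zero_prod_def)

lemma bracket_LD:
  "tau_bracket S (D_mon r u) (loopX (emb l) x) = loopX (emb (r + l)) (zdot u l *\<^sub>C x)"
  "tau_bracket S (loopX (emb l) x) (D_mon r u) = loopX (emb (r + l)) ((- zdot u l) *\<^sub>C x)"
  by (simp_all add: loopX_def der_L_def pm_conv_single dot_linear dot_emb emb_add single_uminus)

lemma bracket_KD:
  "tau_bracket S (D_mon r u) (K_mon s w) = K_mon (r + s) (zdot u s *\<^sub>C w + dot u w *\<^sub>C cvec (emb r))"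
  "tau_bracket S (K_mon s w) (D_mon r u) = K_mon (r + s) (- (zdot u s *\<^sub>C w + dot u w *\<^sub>C cvec (emb r)))"
proof -
  have "tK r (- w) = - tK r w" "tK r (v - w) = tK r v - tK r w" for r and v w :: "complex ^ 'n option"
    using tK_scaleC [of r "-1" w] tK_add [of r "v - w" w] by simp_all
  then show "tau_bracket S (D_mon r u) (K_mon s w) = K_mon (r + s) (zdot u s *\<^sub>C w + dot u w *\<^sub>C cvec (emb r))"
    "tau_bracket S (K_mon s w) (D_mon r u) = K_mon (r + s) (- (zdot u s *\<^sub>C w + dot u w *\<^sub>C cvec (emb r)))"
    by (simp_all add: der_K_single dot_emb emb_add tK_linear)
qed

text \<open>The cocycle contributes a multiple of \<open>\<Sum>\<^sub>p r\<^sub>p t\<^bsup>r+s\<^esup> K\<^sub>p\<close>.  As \<open>r\<^sub>0 = 0\<close>, any such multiple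
  acts by zero.\<close>

lemma bracket_DD:
  "\<exists>c. tau_bracket S (D_mon r u) (D_mon s v) = D_mon (r + s) (zdot u s *\<^sub>C v - zdot v r *\<^sub>C u) + K_mon (r + s) (c *\<^sub>C cvec (emb r))"
  by (rule exI [of _ "coc2 S * (zdot u r * zdot v s) - coc1 S * (zdot u s * zdot v r)"])
     (simp add: pm_conv_single dot_linear dot_emb emb_add tK_scaleC)

text \<open>The failure of the module axiom.  It is linear in each of the three arguments.\<close>

definition defect where
  "defect X Y v = lin_act (tau_bracket S X Y) v - (lin_act X (lin_act Y v) - lin_act Y (lin_act X v))"

lemma lin_act_add: "lin_act (X + Y) v = lin_act X v + lin_act Y v"
  using cbilinear_lin_act unfolding cbilinear_def clinear_iff by blast

lemma lin_act_scaleC: "lin_act (c *\<^sub>C X) v = c *\<^sub>C lin_act X v"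
  using cbilinear_lin_act unfolding cbilinear_def clinear_iff by blast

lemma lin_act_0: "lin_act 0 v = 0"
  using cbilinear_lin_act clinear_0 [of "\<lambda>X. lin_act X v"] unfolding cbilinear_def by blast

lemma deg_gens_sigma0_vals:
  "x \<in> g_sigma0 S \<Longrightarrow> loopX (emb l) x \<in> sigma0_vals" "K_mon r u \<in> sigma0_vals" "D_mon r u \<in> sigma0_vals" "0 \<in> sigma0_vals"
  using g_sigma0_subspace csubspace_zero by (auto simp: sigma0_vals_def loopX_def lookup_single when_def)

text \<open>The brackets with \<open>D(u, r)\<close> match by \<open>d_coeff_add\<close>: shifting the
  degree by \<open>s\<close> changes the scalar by \<open>\<Sum>\<^sub>i u\<^sub>i s\<^sub>i\<close>.  For two derivations the remaining matrix parts match
  by \<open>outer_commutator\<close>.\<close>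

lemma deg_gens_defect:
  assumes "X \<in> deg_gens 0" "Y \<in> deg_gens 0"
  shows "tau_bracket S X Y \<in> sigma0_vals \<and> defect X Y (single k w) = 0"
proof -
  note [simp del] = loop_act.simps tau_bracket.simps
  have z: "cvec (emb r) $ None = 0" for r :: "int ^ 'n" by (simp add: cvec_def emb_def)
  have sigma0_vals_add: "X + Y \<in> sigma0_vals" if "X \<in> sigma0_vals" "Y \<in> sigma0_vals" for X Y
    using sigma0_vals_subspace that by (rule csubspace_add)
  have scx: "c *\<^sub>C x \<in> g_sigma0 S" if "x \<in> g_sigma0 S" for c x
    using g_sigma0_subspace that by (rule csubspace_scale)
  have proj_act_scale: "tensor_map id (proj_act (c *\<^sub>C x)) w = c *\<^sub>C tensor_map id (proj_act x) w" for c x w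
    by (rule clinear_scaleC [OF clinear_tensor_map_right]) (rule clinear_proj_act)+
  have proj_act_neg: "tensor_map id (proj_act (- x)) w = - tensor_map id (proj_act x) w" for x w
    using proj_act_scale [of "-1"] by simp
  have negx: "- x \<in> g_sigma0 S" if "x \<in> g_sigma0 S" for x
    using g_sigma0_subspace that by (rule complex_vector.subspace_neg)
  have gld: "tensor_map (gl (A - B)) id w = tensor_map (gl A) id w - tensor_map (gl B) id w"
    "tensor_map (gl (A + B)) id w = tensor_map (gl A) id w + tensor_map (gl B) id w"
    "tensor_map (gl (c *\<^sub>C A)) id w = c *\<^sub>C tensor_map (gl A) id w" for A B c and w :: "('w1, 'w) tensor"
  proof -
    interpret t: Vector_Spaces.linear scaleC scaleC "\<lambda>A. tensor_map (gl A) id w"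
      by (rule clinear_tensor_map_left) (rule clinear_gl)+
    show "tensor_map (gl (A - B)) id w = tensor_map (gl A) id w - tensor_map (gl B) id w"
      "tensor_map (gl (A + B)) id w = tensor_map (gl A) id w + tensor_map (gl B) id w"
      "tensor_map (gl (c *\<^sub>C A)) id w = c *\<^sub>C tensor_map (gl A) id w"
      by (rule t.diff t.add t.scale)+
  qed
  note act_simps = lin_act_L lin_act_K lin_act_D lin_act_add lin_act_0 z
  note lin = tensor_map_add tensor_map_scaleC
  show ?thesis
    using assms(1)
  proof (cases rule: deg_gens0_cases)
    case X: (L l x)
    from assms(2) show ?thesis
    proof (cases rule: deg_gens0_cases)
      case Y: (L l' y)
      have "tensor_map id (proj_act (brk S x y)) w = tensor_map id (proj_act x) (tensor_map id (proj_act y) w) -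
          tensor_map id (proj_act y) (tensor_map id (proj_act x) w)"
        by (rule tensor_map_commutator_right) (use X Y in \<open>auto intro: clinear_proj_act proj_act_commutator\<close>)
      then show ?thesis
        using X Y
        by (simp add: defect_def bracket_LL act_simps sigma0_vals_add deg_gens_sigma0_vals g_sigma0_brk scaleC_vec_def scaleC_complex_def
            add.assoc add.commute [of l l'] single_diff)
    next
      case Y: (K r u)
      then show ?thesis using X
        by (simp add: defect_def bracket_LK act_simps deg_gens_sigma0_vals lin add_ac)
    next
      case Y: (D r u)
      have "tensor_map (gl (outer r u)) id (tensor_map id (proj_act x) w) = tensor_map id (proj_act x) (tensor_map (gl (outer r u)) id w)"
        by (rule tensor_map_id_swap) (rule clinear_gl clinear_proj_act)+
      then show ?thesis using X Y
        by (simp add: defect_def bracket_LD act_simps deg_gens_sigma0_vals lin scx negx proj_act_neg proj_act_scale d_coeff_add scaleC_add_left add_ac single_diff [symmetric] single_uminus)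
    qed
  next
    case X: (K r u)
    from assms(2) show ?thesis
    proof (cases rule: deg_gens0_cases)
      case Y: (L l' y)
      then show ?thesis using X
        by (simp add: defect_def bracket_LK act_simps deg_gens_sigma0_vals lin add_ac)
    next
      case Y: (K s v)
      then show ?thesis using X
        by (simp add: defect_def bracket_LK act_simps deg_gens_sigma0_vals lin add_ac scaleC_scaleC mult_ac)
    next
      case Y: (D s v)
      then show ?thesis using X
        by (simp add: defect_def bracket_KD act_simps deg_gens_sigma0_vals lin add_ac scaleC_scaleC mult_ac d_coeff_add
            scaleC_add_left scaleC_add_right scaleC_vec_def scaleC_complex_def single_diff [symmetric] single_uminus)
           (simp add: algebra_simps single_uminus)
    qed
  next
    case X: (D r u)
    from assms(2) show ?thesis
    proof (cases rule: deg_gens0_cases)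
      case Y: (L l x)
      have "tensor_map (gl (outer r u)) id (tensor_map id (proj_act x) w) = tensor_map id (proj_act x) (tensor_map (gl (outer r u)) id w)"
        by (rule tensor_map_id_swap) (rule clinear_gl clinear_proj_act)+
      then show ?thesis using X Y
        by (simp add: defect_def bracket_LD act_simps deg_gens_sigma0_vals lin scx negx proj_act_neg proj_act_scale d_coeff_add scaleC_add_left add_ac single_diff [symmetric])
    next
      case Y: (K s v)
      then show ?thesis using X
        by (simp add: defect_def bracket_KD act_simps deg_gens_sigma0_vals lin add_ac scaleC_scaleC mult_ac d_coeff_add
            scaleC_add_left scaleC_add_right scaleC_vec_def scaleC_complex_def single_diff [symmetric])
           (simp add: algebra_simps)
    next
      case Y: (D s v)
      obtain c where c: "tau_bracket S (D_mon r u) (D_mon s v) =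
          D_mon (r + s) (zdot u s *\<^sub>C v - zdot v r *\<^sub>C u) + K_mon (r + s) (c *\<^sub>C cvec (emb r))"
        using bracket_DD by blast
      let ?t = "\<lambda>r u. tensor_map (gl (outer r u)) id"
      have o: "outer (r + s) (zdot u s *\<^sub>C v - zdot v r *\<^sub>C u) =
          gl_bracket (outer r u) (outer s v) + zdot u s *\<^sub>C outer s v - zdot v r *\<^sub>C outer r u"
        unfolding outer_commutator
        by (simp add: outer_def vec_eq_iff scaleC_vec_def scaleC_complex_def algebra_simps)
      have "tensor_map (gl (gl_bracket (outer r u) (outer s v))) id w = ?t r u (?t s v w) - ?t s v (?t r u w)"
        by (rule tensor_map_commutator_left) (rule clinear_gl gl_commutator)+
      then have t: "?t (r + s) (zdot u s *\<^sub>C v - zdot v r *\<^sub>C u) w =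
          ?t r u (?t s v w) - ?t s v (?t r u w) + zdot u s *\<^sub>C ?t s v w - zdot v r *\<^sub>C ?t r u w"
        by (simp add: o gld)
      have cc: "d_coeff (zdot u s *\<^sub>C v - zdot v r *\<^sub>C u) k = zdot u s * d_coeff v k - zdot v r * d_coeff u k"
        by (simp add: d_coeff_def scaleC_vec_def scaleC_complex_def algebra_simps sum_subtractf sum_distrib_left)
      have kz: "(c *\<^sub>C cvec (emb r)) $ None = 0" by (simp add: z scaleC_vec_def)
      have "lin_act (tau_bracket S (D_mon r u) (D_mon s v)) (single k w) =
          single (k + (r + s)) ((zdot u s * d_coeff v k - zdot v r * d_coeff u k) *\<^sub>C w +
            (?t r u (?t s v w) - ?t s v (?t r u w) + zdot u s *\<^sub>C ?t s v w - zdot v r *\<^sub>C ?t r u w))"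
        unfolding c lin_act_add lin_act_D lin_act_K kz t cc by simp
      moreover have "lin_act (D_mon r u) (lin_act (D_mon s v) (single k w)) - lin_act (D_mon s v) (lin_act (D_mon r u) (single k w)) =
          single (k + (r + s)) (d_coeff u (k + s) *\<^sub>C (d_coeff v k *\<^sub>C w + ?t s v w) + ?t r u (d_coeff v k *\<^sub>C w + ?t s v w) -
            (d_coeff v (k + r) *\<^sub>C (d_coeff u k *\<^sub>C w + ?t r u w) + ?t s v (d_coeff u k *\<^sub>C w + ?t r u w)))"
        unfolding lin_act_D single_diff by (simp only: add.assoc add.commute [of s r])
      ultimately have "defect (D_mon r u) (D_mon s v) (single k w) = 0"
        unfolding defect_def d_coeff_add lin
        by (simp add: algebra_simps scaleC_add_left scaleC_scaleC complex_vector.scale_left_diff_distrib scaleC_add_right)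
      moreover have "tau_bracket S (D_mon r u) (D_mon s v) \<in> sigma0_vals"
        unfolding c by (intro sigma0_vals_add deg_gens_sigma0_vals)
      ultimately show ?thesis using X Y by simp
    qed
  qed
qed

lemma loop_space_subspace: "csubspace (loop_space S G)"
  by (rule csubspaceI)
     (auto simp: loop_space_def lookup_add lookup_scaleC cspan_zero cspan_add
        complex_vector.span_scale)

lemma tvec_loop_space: "v2 \<in> G (coset S k) \<Longrightarrow> tvec v1 v2 k \<in> loop_space S G"
  by (auto simp: loop_space_def lookup_single when_def cspan_zero intro!: cspan_base)

lemma loop_space_span: "(loop_space S G :: (int ^ 'n \<Rightarrow>\<^sub>0 ('w1, 'w) tensor) set) \<subseteq> cspan {tvec v1 v2 k | v1 v2 k. v2 \<in> G (coset S k)}"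
proof
  fix s :: "int ^ 'n \<Rightarrow>\<^sub>0 ('w1, 'w) tensor"
  assume s: "s \<in> loop_space S G"
  let ?N = "cspan {tvec v1 v2 k | v1 v2 k. v2 \<in> G (coset S k)}"
  have "id s \<in> ?N"
  proof (rule clinear_span_subset [OF clinear_id poly_mapping_in_span_singles])
    show "lookup s k \<in> cspan {v1 \<otimes>\<^sub>C v2 | v1 v2. v2 \<in> G (coset S k)}" for k
      using s by (simp add: loop_space_def)
    fix a assume "a \<in> {single k x | k x. x \<in> cspan {v1 \<otimes>\<^sub>C v2 | v1 v2. v2 \<in> G (coset S k)}}"
    then obtain k x where a: "a = single k x" "x \<in> cspan {v1 \<otimes>\<^sub>C v2 | v1 v2. v2 \<in> G (coset S k)}"
      by blast
    have "single k x \<in> ?N"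
      by (rule clinear_span_subset [OF clinear_single a(2)]) (auto intro: cspan_base)
    then show "id a \<in> ?N" by (simp add: a)
  qed simp
  then show "s \<in> ?N" by simp
qed

lemma lin_act_loop_space:
  assumes "X \<in> tau0 S" "s \<in> loop_space S G"
  shows "lin_act X s \<in> loop_space S G"
proof (rule cbilinear_span_subset [OF cbilinear_lin_act])
  show "X \<in> cspan (deg_gens 0)" using assms(1) tau0_span_deg_gens by blast
  show "s \<in> cspan {tvec v1 v2 k | v1 v2 k. v2 \<in> G (coset S k)}" using assms(2) loop_space_span by blast
  show "csubspace (loop_space S G)" by (rule loop_space_subspace)
  fix X and s :: "int ^ 'n \<Rightarrow>\<^sub>0 ('w1, 'w) tensor" assume X: "X \<in> deg_gens 0"
    and "s \<in> {tvec v1 v2 k | v1 v2 k. v2 \<in> G (coset S k)}"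
  then obtain v1 v2 k where s: "s = tvec v1 v2 k" "v2 \<in> G (coset S k)" by blast
  show "lin_act X s \<in> loop_space S G"
    using X
  proof (cases rule: deg_gens0_cases)
    case (L l x)
    have "act x v2 \<in> G (coset S (k + l))"
      using act_grade [OF L(2,3) s(2)] by (simp add: add.commute)
    then show ?thesis
      unfolding L(1) s(1) lin_act_L tensor_map_tensor [OF clinear_id clinear_proj_act(1)]
      by (simp add: proj_act L tvec_loop_space)
  next
    case (K r u)
    then show ?thesis
      unfolding K(1) s(1) lin_act_K
      using s(2) by (simp add: tvec_loop_space coset_add single_clinear csubspace_scale [OF loop_space_subspace])
  next
    case (D r u)
    then show ?thesis
      unfolding D(1) s(1) lin_act_D
      using s(2) by (simp add: tvec_loop_space coset_add single_clinear tensor_map_tensor [OF clinear_gl(1) clinear_id]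
          csubspace_scale [OF loop_space_subspace] csubspace_add [OF loop_space_subspace])
  qed
qed

lemma tau0_bracket:
  assumes X: "X \<in> tau0 S" and Y: "Y \<in> tau0 S"
  shows "tau_bracket S X Y \<in> sigma0_vals" "defect X Y v = 0"
proof -
  have br: "clinear (\<lambda>X. tau_bracket S X Y)" "clinear (tau_bracket S X)" for X Y
    using cbilinear_tau_bracket unfolding cbilinear_def by blast+
  have ra: "clinear (\<lambda>X. lin_act X v)" "clinear (lin_act X)" for X v
    using cbilinear_lin_act unfolding cbilinear_def by blast+
  have cmp: "clinear (\<lambda>x. f (g x))" if "clinear f" "clinear g"
    for f :: "'b::complex_vector \<Rightarrow> 'c::complex_vector" and g :: "'a::complex_vector \<Rightarrow> 'b"
    using that by (simp add: clinear_iff)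
  have XY: "X \<in> cspan (deg_gens 0)" "Y \<in> cspan (deg_gens 0)" using X Y tau0_span_deg_gens by blast+
  show "tau_bracket S X Y \<in> sigma0_vals"
    by (rule cbilinear_span_subset [OF cbilinear_tau_bracket XY sigma0_vals_subspace]) (use deg_gens_defect in blast)
  have v: "v \<in> cspan {single k w | k w. w \<in> UNIV}"
    by (rule poly_mapping_in_span_singles) simp
  have "cbilinear (\<lambda>X Y. defect X Y v)" for v
    unfolding defect_def
    by (rule cbilinearI; rule clinear_diff; (rule clinear_diff)?)
       (rule cmp [OF ra(1) br(1)] cmp [OF ra(1) br(2)] ra(1) cmp [OF ra(2) ra(1)])+
  then have bil: "defect X Y v \<in> {0}" if "\<And>X Y. X \<in> deg_gens 0 \<Longrightarrow> Y \<in> deg_gens 0 \<Longrightarrow> defect X Y v = 0" for v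
    by (rule cbilinear_span_subset [OF _ XY csubspace_0]) (use that in simp)
  have lin: "clinear (defect X Y)" for X Y
    unfolding defect_def [abs_def]
    by (rule clinear_diff, rule ra(2), rule clinear_diff) (rule cmp [OF ra(2) ra(2)])+
  have "defect X Y v \<in> {0}"
    by (rule clinear_span_subset [OF lin v csubspace_0]) (use bil deg_gens_defect in blast)
  then show "defect X Y v = 0" by simp
qed

abbreviation "tau0_act \<equiv> loop_act gl act \<alpha> d C0"

lemma tau0_act_eq: "X \<in> tau0 S \<Longrightarrow> tau0_act X = lin_act X"
  using tau0_sigma0_vals lin_act_eq by blast

lemma tau0_subspace: "csubspace (tau0 S)"
proof (rule csubspaceI)
  have ad: "clinear (tau_bracket S (tdi 0 None))"
    using cbilinear_tau_bracket unfolding cbilinear_def by blast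
  have e: "csubspace (eigen S k)" for k
    by (rule csubspaceI)
       (auto simp: eigen_def aut_lin clinear_0 [OF clinear_aut] scaleC_add_right scaleC_scaleC mult.commute)
  have taus: "csubspace (tau S)"
  proof -
    have "tau S = {X. \<forall>k. lookup (fst X) k \<in> eigen S k} \<inter>
        {X. fst (snd X) \<in> cspan {tK r (axis i 1) | r i. r \<in> full_lattice S}} \<inter>
        {X. \<forall>k. k \<notin> full_lattice S \<longrightarrow> lookup (snd (snd X)) k = 0}"
      by (auto simp: tau_def in_keys_iff subset_iff)
    moreover have "csubspace {X :: ('g, 'n) toroidal. \<forall>k. lookup (fst X) k \<in> eigen S k}"
      by (rule csubspaceI)
         (use e in \<open>auto simp: lookup_add lookup_scaleC scaleC_prod_def csubspace_zero
            csubspace_add csubspace_scale\<close>)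
    moreover have "csubspace {X :: ('g, 'n) toroidal. fst (snd X) \<in> cspan {tK r (axis i 1) | r i. r \<in> full_lattice S}}"
      by (rule csubspaceI)
         (simp_all add: scaleC_prod_def cspan_zero cspan_add complex_vector.span_scale)
    moreover have "csubspace {X :: ('g, 'n) toroidal. \<forall>k. k \<notin> full_lattice S \<longrightarrow> lookup (snd (snd X)) k = 0}"
      by (rule csubspaceI) (simp_all add: lookup_add lookup_scaleC scaleC_prod_def)
    ultimately show ?thesis by (simp add: complex_vector.subspace_inter)
  qed
  show "0 \<in> tau0 S"
    using clinear_0 [OF ad] csubspace_zero [OF taus] by (simp add: tau0_def)
  show "X + Y \<in> tau0 S" if "X \<in> tau0 S" "Y \<in> tau0 S" for X Y
    using that clinear_add [OF ad, of X Y] csubspace_add [OF taus] by (simp add: tau0_def)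
  show "c *\<^sub>C X \<in> tau0 S" if "X \<in> tau0 S" for X c
    using that clinear_scaleC [OF ad, of c X] csubspace_scale [OF taus] by (simp add: tau0_def)
qed

theorem lie_module_loop: "lie_module (tau_bracket S) (tau0 S) tau0_act (loop_space S G)"
  unfolding lie_module_def
proof (intro conjI ballI)
  show "csubspace (loop_space S G)" by (rule loop_space_subspace)
  show "tau0_act X v \<in> loop_space S G" if "X \<in> tau0 S" "v \<in> loop_space S G" for X v
    using that by (simp add: tau0_act_eq lin_act_loop_space)
  show "clinear_on (loop_space S G) (tau0_act X)" for X
    using loop_act_linear_vector [of gl act \<alpha> d C0 X] by (simp add: clinear_on_def clinear_iff)
  show "clinear_on (tau0 S) (\<lambda>X. tau0_act X v)" for v
    using tau0_subspace
    by (simp add: clinear_on_def tau0_act_eq csubspace_add csubspace_scale lin_act_add lin_act_scaleC)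
  show "tau0_act (tau_bracket S X Y) v = tau0_act X (tau0_act Y v) - tau0_act Y (tau0_act X v)" if "X \<in> tau0 S" "Y \<in> tau0 S" for X Y v
    using tau0_bracket(2) [OF that, of v] by (simp add: tau0_act_eq that lin_act_eq [OF tau0_bracket(1) [OF that]] defect_def)
qed

end

section \<open>Irreducibility of the loop module\<close>

context sigma0_module
begin

lemma coset_shift: "coset S k' = coset S (k + l) \<Longrightarrow> coset S (k' - l) = coset S k"
  by (simp add: coset_eq_iff algebra_simps)

lemma cbilinear_proj_act: "cbilinear proj_act"
  by (rule cbilinearI) (rule clinear_proj_act)+

lemma act_wvecs_grade: "x \<in> wvecs a k \<Longrightarrow> v \<in> G (coset S l) \<Longrightarrow> act x v \<in> G (coset S (k + l))"
  by (rule act_grade) (auto intro: wvecs_sigma0 wvecs_eigen_n)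

text \<open>Stability under \<open>\<gg>(\<sigma>\<^sub>0)\<close> can be tested on weight vectors.\<close>

lemma act_in_subspace:
  assumes x: "x \<in> g_sigma0 S" and v: "v \<in> cspan M" and N: "csubspace N"
    and "\<And>a k y w. a \<in> enlarged_roots0 b S \<Longrightarrow> y \<in> wvecs a k \<Longrightarrow> w \<in> M \<Longrightarrow> act y w \<in> N"
  shows "act x v \<in> N"
proof -
  have "proj_act x v \<in> N"
    by (rule cbilinear_span_subset [OF cbilinear_proj_act g_sigma0_span [OF x] v N])
       (use assms(4) wvecs_sigma0 in \<open>auto simp: proj_act\<close>)
  then show ?thesis by (simp add: proj_act x)
qed

text \<open>Graded irreducibility, restated for subspaces given by homogeneous spanning sets \<open>P q\<close>.\<close>

lemma graded_submodule_trivial: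
  assumes irr: "graded_irreducible S (g_sigma0 S) act G"
    and P: "\<And>q. q \<in> Lambda S \<Longrightarrow> P q \<subseteq> G q"
    and stable: "\<And>a k y q w. a \<in> enlarged_roots0 b S \<Longrightarrow> y \<in> wvecs a k \<Longrightarrow> q \<in> Lambda S \<Longrightarrow> w \<in> P q \<Longrightarrow>
       act y w \<in> cspan (\<Union>q\<in>Lambda S. P q)"
  shows "cspan (\<Union>q\<in>Lambda S. P q) = {0} \<or> cspan (\<Union>q\<in>Lambda S. P q) = UNIV"
proof -
  let ?M = "cspan (\<Union>q\<in>Lambda S. P q)"
  have "submodule (g_sigma0 S) act UNIV ?M"
    unfolding submodule_def
  proof (intro conjI ballI)
    show "act x v \<in> ?M" if "x \<in> g_sigma0 S" "v \<in> ?M" for x v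
      by (rule act_in_subspace [OF that]) (use stable in auto)
  qed simp_all
  moreover have "?M = cspan (\<Union>q\<in>Lambda S. ?M \<inter> G q)"
  proof
    show "?M \<subseteq> cspan (\<Union>q\<in>Lambda S. ?M \<inter> G q)"
    proof (rule cspan_mono, rule UN_mono)
      show "P q \<subseteq> ?M \<inter> G q" if q: "q \<in> Lambda S" for q
      proof
        fix v assume v: "v \<in> P q"
        then have "v \<in> ?M" by (rule cspan_base [OF UN_I [OF q]])
        with P [OF q] v show "v \<in> ?M \<inter> G q" by blast
      qed
    qed simp
    show "cspan (\<Union>q\<in>Lambda S. ?M \<inter> G q) \<subseteq> ?M"
      by (rule cspan_minimal) auto
  qed
  moreover have "\<forall>N. submodule (g_sigma0 S) act UNIV N \<and> N = cspan (\<Union>q\<in>Lambda S. N \<inter> G q) \<longrightarrow> N = {0} \<or> N = UNIV"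
    using irr unfolding graded_irreducible_def by (elim conjE)
  ultimately show ?thesis by (elim allE [of _ ?M]) (elim mp, intro conjI)
qed

end

context loop_module
begin

lemma deg_gens0_intros:
  "x \<in> wvecs a l \<Longrightarrow> loopX (emb l) x \<in> deg_gens 0"
  "coset S r = coset S 0 \<Longrightarrow> K_mon r u \<in> deg_gens 0"
  "coset S r = coset S 0 \<Longrightarrow> D_mon r u \<in> deg_gens 0"
proof -
  have e: "emb k $ None = 0" for k :: "int ^ 'n" by (simp add: emb_def)
  show "loopX (emb l) x \<in> deg_gens 0" if "x \<in> wvecs a l"
    using that e unfolding deg_gens_def wvecs_def weight_space_def by blast
  have f: "emb r \<in> full_lattice S" if "coset S r = coset S 0"
    using that by (auto simp: coset_eq_iff full_lattice_def emb_def split: option.splits)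
  show "K_mon r u \<in> deg_gens 0" "D_mon r u \<in> deg_gens 0" if "coset S r = coset S 0"
    using f [OF that] e unfolding deg_gens_def by blast+
qed

lemma tau0_act_deg_gens0: "X \<in> deg_gens 0 \<Longrightarrow> tau0_act X = lin_act X"
  using deg_gens0_tau0 tau0_act_eq by blast

lemma irreducible_ops_gl:
  assumes "irreducible_module gl_bracket UNIV gl UNIV"
  shows "irreducible_ops (range gl)"
  using assms clinear_gl(1) unfolding irreducible_module_def irreducible_ops_def submodule_def by blast

lemma matrix_span: "A \<in> cspan {matrix_unit j i | i j. True}" for A :: "complex ^ 'n ^ 'n"
proof -
  have "A = (\<Sum>j\<in>UNIV. \<Sum>i\<in>UNIV. (A $ j $ i) *\<^sub>C matrix_unit j i)"
  proof -
    have 1: "(\<Sum>j\<in>UNIV. \<Sum>i\<in>UNIV. (A $ j $ i) *\<^sub>C matrix_unit j i) $ a $ c =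
       (\<Sum>j\<in>UNIV. \<Sum>i\<in>UNIV. if a = j \<and> c = i then A $ j $ i else 0)" for a c
      by (simp add: matrix_unit_def scaleC_vec_def scaleC_complex_def if_distrib [of "(*) _"] cong: if_cong)
    have "(\<Sum>i\<in>UNIV. if a = j \<and> c = i then A $ j $ i else 0) = (if a = j then A $ j $ c else 0)" for a c j
      by (cases "a = j") simp_all
    then show ?thesis by (simp only: vec_eq_iff 1) simp
  qed
  also have "\<dots> \<in> cspan {matrix_unit j i | i j. True}"
    by (intro cspan_sum complex_vector.span_scale cspan_base) blast
  finally show ?thesis .
qed

lemma tcoord_in:
  assumes B: "finite B" "complex_vector.independent B" "cspan B = UNIV"
    and w: "w \<in> cspan {v1 \<otimes>\<^sub>C v2 | v1 v2. v2 \<in> G (coset S k)}"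
  shows "tcoord B b0 w \<in> G (coset S k)"
  by (rule clinear_span_subset [OF clinear_tcoord w G_subspace])
     (auto simp: tcoord_tensor [OF B] csubspace_scale [OF G_subspace])

context
  fixes N :: "(int ^ 'n \<Rightarrow>\<^sub>0 ('w1, 'w) tensor) set"
  assumes N: "submodule (tau0 S) tau0_act (loop_space S G) N" and C0: "C0 \<noteq> 0"
begin

lemma N_sub: "csubspace N" "N \<subseteq> loop_space S G"
  and N_lin_act: "X \<in> deg_gens 0 \<Longrightarrow> s \<in> N \<Longrightarrow> lin_act X s \<in> N"
  using N deg_gens0_tau0 tau0_act_deg_gens0 unfolding submodule_def by (auto, metis subsetD)

text \<open>The operators \<open>d\<^sub>i\<close> act on degree \<open>k\<close> by \<open>k\<^sub>i + \<alpha>\<^sub>i\<close>, and these scalars separate the degrees.\<close>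

lemma N_components:
  assumes "s \<in> N" shows "single k (lookup s k) \<in> N"
proof (cases "k \<in> keys s")
  case False
  then show ?thesis using N_sub(1) by (simp add: in_keys_iff csubspace_zero)
next
  case True
  let ?T = "\<lambda>i. lin_act (D_mon 0 (axis (Some i) 1))"
  have gl0: "tensor_map (gl (outer 0 u)) id w = 0" for u w
  proof -
    have "outer 0 u = 0" by (simp add: outer_def vec_eq_iff)
    then show ?thesis by (simp add: tensor_map_zero clinear_0 [OF clinear_gl(2)] tensor_0)
  qed
  have "\<forall>k\<in>keys s. single k (lookup s k) \<in> N"
  proof (rule stable_subspace_components [where J = UNIV and T = ?T and \<mu> = "\<lambda>k i. d_coeff (axis (Some i) 1) k"])
    show "lin_act (D_mon 0 (axis (Some i) 1)) w \<in> N" if "w \<in> N" for i w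
      by (rule N_lin_act [OF deg_gens0_intros(3) that]) simp
    show "clinear (?T i)" for i by (rule loop_act_linear_vector)
    show "?T i (single k (lookup s k)) =
        d_coeff (axis (Some i) 1) k *\<^sub>C single k (lookup s k)" for i k
      unfolding lin_act_D gl0 by (simp add: single_clinear(2))
    have c: "d_coeff (axis (Some i) 1) k = of_int (k $ i) + \<alpha> $ i" for i k
      by (simp add: d_coeff_def axis_def if_distrib [of "\<lambda>c. c * _"] cong: if_cong)
    show "\<exists>i\<in>UNIV. d_coeff (axis (Some i) 1) k \<noteq> d_coeff (axis (Some i) 1) l" if "k \<noteq> l" for k l
      using that by (auto simp: c vec_eq_iff)
    have "(\<Sum>k\<in>keys s. single k (lookup s k)) = s"
      by (rule poly_mapping_eqI) (simp add: lookup_sum lookup_single when_def in_keys_iff if_distrib cong: if_cong)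
    then show "(\<Sum>k\<in>keys s. single k (lookup s k)) \<in> N"
      using assms by simp
  qed (use N_sub in auto)
  with True show ?thesis by blast
qed

lemma N_shift:
  assumes "single k w \<in> N" "coset S r = coset S 0"
  shows "single (k + r) w \<in> N"
proof -
  have "lin_act (K_mon r (axis None 1)) (single k w) \<in> N"
    by (rule N_lin_act [OF deg_gens0_intros(2)]) (use assms in auto)
  then have "C0 *\<^sub>C single (k + r) w \<in> N"
    unfolding lin_act_K by (simp add: axis_def single_clinear(2))
  then have "inverse C0 *\<^sub>C C0 *\<^sub>C single (k + r) w \<in> N"
    by (rule csubspace_scale [OF N_sub(1)])
  then show ?thesis using C0 by (simp add: scaleC_scaleC scaleC_one)
qed

text \<open>For \<open>r\<close> in \<open>\<Gamma>\<close>, \<open>D(u, r)\<close> and \<open>t\<^sup>r K\<^sub>0\<close> both shift the degree by \<open>r\<close>; a suitable combination followed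
  by the shift back leaves only the matrix part \<open>r u\<^sup>T\<close>.  With \<open>r = m\<^sub>j e\<^sub>j\<close> and \<open>u = e\<^sub>i\<close> it is \<open>m\<^sub>j E\<^sub>j\<^sub>i\<close>.\<close>

lemma N_gl:
  assumes w: "single k w \<in> N"
  shows "single k (tensor_map (gl A) id w) \<in> N"
proof (rule clinear_span_subset [of "\<lambda>A. single k (tensor_map (gl A) id w)", OF _ matrix_span N_sub(1)])
  show lin: "clinear (\<lambda>A. single k (tensor_map (gl A) id w))"
    by (intro clinear_single_comp clinear_tensor_map_left clinear_gl)
  fix E :: "complex ^ 'n ^ 'n" assume "E \<in> {matrix_unit j i | i j. True}"
  then obtain i j where E: "E = matrix_unit j i" by blast
  let ?m = "per S (Some j)"
  define r :: "int ^ 'n" where "r = (\<chi> a. if a = j then int ?m else 0)"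
  let ?u = "axis (Some i) (1 :: complex)"
  have r: "coset S r = coset S 0" "coset S (- r) = coset S 0" by (auto simp: coset_eq_iff r_def)
  have o: "outer r ?u = of_nat ?m *\<^sub>C E"
    by (auto simp: outer_def E matrix_unit_def r_def axis_def vec_eq_iff scaleC_vec_def scaleC_complex_def)
  have "lin_act (D_mon r ?u) (single k w) - d_coeff ?u k *\<^sub>C single (k + r) w \<in> N"
    by (intro complex_vector.subspace_diff [OF N_sub(1)] csubspace_scale [OF N_sub(1)]
        N_shift N_lin_act deg_gens0_intros w r)
  then have "single (k + r) (tensor_map (gl (of_nat ?m *\<^sub>C E)) id w) \<in> N"
    unfolding lin_act_D o by (simp add: single_clinear)
  then have "single (k + r + - r) (tensor_map (gl (of_nat ?m *\<^sub>C E)) id w) \<in> N"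
    by (rule N_shift [OF _ r(2)])
  then have "of_nat ?m *\<^sub>C single k (tensor_map (gl E) id w) \<in> N"
    using clinear_scaleC [OF lin] by simp
  then have "inverse (of_nat ?m) *\<^sub>C of_nat ?m *\<^sub>C single k (tensor_map (gl E) id w) \<in> N"
    by (rule csubspace_scale [OF N_sub(1)])
  then show "single k (tensor_map (gl E) id w) \<in> N"
    using per_pos [of "Some j"] by (simp add: scaleC_scaleC scaleC_one)
qed

text \<open>The degree \<open>q\<close> part of the space \<open>P\<close> for which \<open>N\<close> turns out to be \<open>W\<^sub>1 \<otimes> P\<close> in each degree.  Asking for
  all \<open>k\<close> in the class \<open>q\<close> makes it depend only on the degree modulo \<open>\<Gamma>\<close>.\<close>

definition W2_part where
  "W2_part q = {u \<in> G q. \<forall>k a. coset S k = q \<longrightarrow> tvec a u k \<in> N}"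

lemma W2_part_stable:
  assumes "x \<in> wvecs a l" "u \<in> W2_part (coset S k)"
  shows "act x u \<in> W2_part (coset S (l + k))"
  unfolding W2_part_def
proof safe
  show "act x u \<in> G (coset S (l + k))" using assms by (auto simp: W2_part_def intro: act_wvecs_grade)
  fix k' a' assume k': "coset S k' = coset S (l + k)"
  have "tvec a' u (k' - l) \<in> N"
    using assms(2) coset_shift [of k' k l] k' by (auto simp: W2_part_def add.commute)
  then have "lin_act (loopX (emb l) x) (tvec a' u (k' - l)) \<in> N"
    by (rule N_lin_act [OF deg_gens0_intros(1) [OF assms(1)]])
  then show "tvec a' (act x u) k' \<in> N"
    unfolding lin_act_L tensor_map_tensor [OF clinear_id clinear_proj_act(1)]
    by (simp add: proj_act wvecs_sigma0 [OF assms(1)])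
qed

lemma W2_part_subspace: "csubspace (W2_part (coset S k))"
  by (rule csubspaceI)
     (auto simp: W2_part_def tensor_linear tensor_0 single_clinear csubspace_zero [OF G_subspace]
        csubspace_add [OF G_subspace] csubspace_scale [OF G_subspace]
        csubspace_zero [OF N_sub(1)] csubspace_add [OF N_sub(1)]
        csubspace_scale [OF N_sub(1)])

text \<open>By density the coordinates of the elements of \<open>N\<close> lie in \<open>W2_part\<close>, which spans a graded submodule of
  the second factor.  If it is zero, so is \<open>N\<close>; if it is everything, \<open>N\<close> contains all pure tensors.\<close>

lemma N_trivial:
  assumes irr1: "irreducible_module gl_bracket UNIV gl UNIV" and fd: "fin_dim (UNIV :: 'w1 set)"
    and irr: "graded_irreducible S (g_sigma0 S) act G"
  shows "N = {0} \<or> N = loop_space S G"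
proof -
  obtain B :: "'w1 set" where B: "finite B" "complex_vector.independent B" "cspan B = UNIV"
    by (rule exists_basis [OF fd])
  have coord: "tcoord B b0 (lookup s k) \<in> W2_part (coset S k)" if s: "s \<in> N" and b0: "b0 \<in> B" for s k b0
  proof -
    let ?w = "lookup s k"
    let ?Nk = "{w. single k w \<in> N}"
    have "a \<otimes>\<^sub>C tcoord B b0 ?w \<in> ?Nk" for a
    proof (rule tensor_stable_coordinates [OF B irreducible_ops_gl [OF irr1] _ _ _ b0])
      show "csubspace ?Nk"
        by (rule csubspaceI)
           (simp_all add: single_clinear csubspace_zero [OF N_sub(1)] csubspace_add [OF N_sub(1)]
              csubspace_scale [OF N_sub(1)])
      show "tensor_map f id w \<in> ?Nk" if "f \<in> range gl" "w \<in> ?Nk" for f w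
        using that N_gl by auto
      show "?w \<in> ?Nk" using N_components [OF s] by simp
    qed
    then have "tvec a (tcoord B b0 ?w) k' \<in> N" if "coset S k' = coset S k" for a k'
    proof -
      have "coset S (k' - k) = coset S 0" using that by (simp add: coset_eq_iff)
      from N_shift [OF _ this, of k] \<open>\<And>a. a \<otimes>\<^sub>C tcoord B b0 ?w \<in> ?Nk\<close> show ?thesis by simp
    qed
    moreover have "tcoord B b0 ?w \<in> G (coset S k)"
      by (rule tcoord_in [OF B]) (use s N_sub(2) in \<open>auto simp: loop_space_def\<close>)
    ultimately show ?thesis by (simp add: W2_part_def)
  qed
  have PG: "W2_part q \<subseteq> G q" for q by (auto simp: W2_part_def)
  have "cspan (\<Union>q\<in>Lambda S. W2_part q) = {0} \<or> cspan (\<Union>q\<in>Lambda S. W2_part q) = UNIV"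
  proof (rule graded_submodule_trivial [OF irr PG])
    fix a k y q w assume y: "y \<in> wvecs a k" and "q \<in> Lambda S" "w \<in> W2_part q"
    then obtain l where "w \<in> W2_part (coset S l)" by (auto simp: Lambda_def)
    from W2_part_stable [OF y this] show "act y w \<in> cspan (\<Union>q\<in>Lambda S. W2_part q)"
      using coset_Lambda by (blast intro: cspan_base)
  qed
  then show ?thesis
  proof
    assume zero: "cspan (\<Union>q\<in>Lambda S. W2_part q) = {0}"
    have "s = 0" if s: "s \<in> N" for s
    proof (rule poly_mapping_eqI)
      fix k
      have "tcoord B b0 (lookup s k) = 0" if "b0 \<in> B" for b0
      proof -
        have "tcoord B b0 (lookup s k) \<in> cspan (\<Union>q\<in>Lambda S. W2_part q)"
          using coord [OF s that, of k] coset_Lambda [of k] by (blast intro: cspan_base)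
        then show ?thesis using zero by simp
      qed
      then show "lookup s k = lookup 0 k"
        using tensor_expand [OF B, of "lookup s k"] by (simp add: tensor_0)
    qed
    then show ?thesis using csubspace_zero [OF N_sub(1)] by blast
  next
    assume all: "cspan (\<Union>q\<in>Lambda S. W2_part q) = UNIV"
    have "u \<in> W2_part (coset S k)" if "u \<in> G (coset S k)" for u k
    proof -
      have "u \<in> cspan (W2_part (coset S k))"
        by (rule direct_sum_in_span [OF act_ds PG _ that coset_Lambda]) (use all in simp)
      then show ?thesis using W2_part_subspace complex_vector.span_eq_iff by metis
    qed
    then have "{tvec v1 v2 k | v1 v2 k. v2 \<in> G (coset S k)} \<subseteq> N" by (auto simp: W2_part_def)
    then have "cspan {tvec v1 v2 k | v1 v2 k. v2 \<in> G (coset S k)} \<subseteq> N"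
      by (rule cspan_minimal [OF _ N_sub(1)])
    then show ?thesis using loop_space_span N_sub(2) by blast
  qed
qed

end

lemma tvec_nonzero:
  assumes fd: "fin_dim (UNIV :: 'w1 set)" and "v \<noteq> (0::'w1)" "u \<noteq> (0::'w)"
  shows "tvec v u k \<noteq> 0"
proof -
  obtain B :: "'w1 set" where B: "finite B" "complex_vector.independent B" "cspan B = UNIV"
    by (rule exists_basis [OF fd])
  have "v = (\<Sum>b\<in>B. complex_vector.representation B v b *\<^sub>C b)"
    by (rule complex_vector.sum_representation_eq [symmetric]) (use B in auto)
  with assms(2) obtain b where "complex_vector.representation B v b \<noteq> 0"
    by (metis (no_types, lifting) scaleC_zero_left sum.neutral)
  then have "tcoord B b (v \<otimes>\<^sub>C u) \<noteq> 0" using assms(3) by (simp add: tcoord_tensor [OF B])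
  then have "v \<otimes>\<^sub>C u \<noteq> 0" using clinear_0 [OF clinear_tcoord] by metis
  then show ?thesis by (metis lookup_single_eq lookup_zero)
qed

theorem irreducible_loop:
  assumes "C0 \<noteq> 0" and irr1: "irreducible_module gl_bracket UNIV gl UNIV" and fd: "fin_dim (UNIV :: 'w1 set)"
    and irr: "graded_irreducible S (g_sigma0 S) act G"
  shows "irreducible_module (tau_bracket S) (tau0 S) tau0_act (loop_space S G)"
  unfolding irreducible_module_def
proof (intro conjI allI impI)
  show "lie_module (tau_bracket S) (tau0 S) tau0_act (loop_space S G)" by (rule lie_module_loop)
  show "N = {0} \<or> N = loop_space S G" if "submodule (tau0 S) tau0_act (loop_space S G) N" for N
    by (rule N_trivial [OF that assms])
  obtain v :: 'w1 where v: "v \<noteq> 0" using irr1 by (auto simp: irreducible_module_def)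
  have "\<exists>k. G (coset S k) \<noteq> {0}"
  proof (rule ccontr)
    assume "\<not> ?thesis"
    then have "(\<Union>q\<in>Lambda S. G q) \<subseteq> {0}" by (auto simp: Lambda_def)
    then have "cspan (\<Union>q\<in>Lambda S. G q) \<subseteq> {0}" by (rule cspan_minimal) (rule csubspace_0)
    then show False using direct_sum_span_UN [OF act_ds] irr by (auto simp: graded_irreducible_def)
  qed
  then obtain k u where "u \<in> G (coset S k)" "u \<noteq> 0" using csubspace_zero [OF G_subspace] by blast
  then show "(loop_space S G :: (int ^ 'n \<Rightarrow>\<^sub>0 ('w1, 'w) tensor) set) \<noteq> {0}"
    using tvec_loop_space tvec_nonzero [OF fd v] by blast
qed

end

section \<open>Singular vectors of the irreducible quotient\<close>

text \<open>Homogeneous vectors, paired with their degrees, which arise from those in \<open>K\<close> by repeatedly acting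
  with weight vectors whose weight is in \<open>A\<close>.  For the negative weights this describes \<open>U(\<gg>(\<sigma>\<^sub>0)\<^sub>-) K\<close>.\<close>

inductive_set lower_closure ::
  "('g::complex_vector, 'n::finite) toroidal_data \<Rightarrow> ('g \<Rightarrow> 'w \<Rightarrow> 'w) \<Rightarrow> ('g \<Rightarrow> complex) set \<Rightarrow>
    ((int ^ 'n) set \<times> 'w) set \<Rightarrow> ((int ^ 'n) set \<times> 'w) set"
  for S act A K where
  base: "p \<in> K \<Longrightarrow> p \<in> lower_closure S act A K"
| step: "(coset S l, v) \<in> lower_closure S act A K \<Longrightarrow> a \<in> A \<Longrightarrow>
    x \<in> weight_space (brk S) (csa0 S) a (eigen S (emb k)) \<Longrightarrow> (coset S (k + l), act x v) \<in> lower_closure S act A K"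

locale induced_quotient = sigma0_module b S act G
  for b :: nat and S :: "('g::complex_vector, 'n::finite) toroidal_data"
    and act :: "'g \<Rightarrow> 'w::complex_vector \<Rightarrow> 'w" and G :: "(int ^ 'n) set \<Rightarrow> 'w set" +
  fixes act2 :: "'g \<Rightarrow> 'w2::complex_vector \<Rightarrow> 'w2" and G2 :: "(int ^ 'n) set \<Rightarrow> 'w2 set"
    and \<pi> :: "('g list \<times> 'w2 \<Rightarrow>\<^sub>0 complex) \<Rightarrow> 'w"
  assumes irr2: "graded_irreducible S (g_circ S) act2 G2" and fd2: "fin_dim (UNIV :: 'w2 set)"
    and quot: "irreducible_quotient S act2 G2 act G \<pi>"
begin

lemma irr: "graded_irreducible S (g_sigma0 S) act G"
  and pi_linear: "clinear_on (ind_free S) \<pi>"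
  and pi_rel: "r \<in> ind_rel S act2 \<Longrightarrow> \<pi> r = 0"
  and pi_onto: "\<pi> ` ind_free S = UNIV"
  and pi_act: "x \<in> g_sigma0 S \<Longrightarrow> f \<in> ind_free S \<Longrightarrow> \<pi> (ind_act x f) = act x (\<pi> f)"
  and pi_grade: "q \<in> Lambda S \<Longrightarrow> \<pi> ` ind_grade S G2 q = G q"
  using quot by (auto simp: irreducible_quotient_def)

lemma circ_module: "lie_module (brk S) (g_circ S) act2 UNIV"
  and ds2: "direct_sum UNIV (Lambda S) G2"
  and act2_grade: "x \<in> g_circ S \<Longrightarrow> x \<in> eigen_n S k \<Longrightarrow> v \<in> G2 (coset S l) \<Longrightarrow> act2 x v \<in> G2 (coset S (k + l))"
  and nontrivial2: "(UNIV :: 'w2 set) \<noteq> {0}"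
  and irr2_sub: "submodule (g_circ S) act2 UNIV N \<Longrightarrow> N = cspan (\<Union>q\<in>Lambda S. N \<inter> G2 q) \<Longrightarrow> N = {0} \<or> N = UNIV"
  using irr2 unfolding graded_irreducible_def graded_module_def by blast+

lemma clinear_act2: "x \<in> g_circ S \<Longrightarrow> clinear (act2 x)"
  using circ_module by (simp add: lie_module_def clinear_on_UNIV)

text \<open>The canonical map of \<open>W\<^sub>2\<close> to the irreducible quotient, \<open>w \<mapsto> 1 \<otimes> w\<close>.\<close>

definition incl :: "'w2 \<Rightarrow> 'w" where
  "incl w = \<pi> (ind_gen [] w)"

lemma ind_gen_free: "set xs \<subseteq> g_sigma0 S \<Longrightarrow> ind_gen xs w \<in> ind_free S"
  unfolding ind_free_def by (rule cspan_base) blast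

lemma ind_free_subspace: "csubspace (ind_free S)"
  by (simp add: ind_free_def)

lemma pi_scaleC: "f \<in> ind_free S \<Longrightarrow> \<pi> (c *\<^sub>C f) = c *\<^sub>C \<pi> f"
  using pi_linear by (simp add: clinear_on_def)

lemma pi_lin:
  assumes "f \<in> ind_free S" "g \<in> ind_free S"
  shows "\<pi> (f + g) = \<pi> f + \<pi> g" "\<pi> (f - g) = \<pi> f - \<pi> g"
proof -
  show "\<pi> (f + g) = \<pi> f + \<pi> g"
    using pi_linear assms by (auto simp: clinear_on_def)
  have "f - g \<in> ind_free S" using ind_free_subspace assms by (rule complex_vector.subspace_diff)
  then have "\<pi> (f - g + g) = \<pi> (f - g) + \<pi> g" using pi_linear assms(2) unfolding clinear_on_def by blast
  then show "\<pi> (f - g) = \<pi> f - \<pi> g" by simp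
qed

lemma ind_rel_simple:
  assumes "set xs \<subseteq> g_sigma0 S"
  shows "ind_gen xs (w + w') - ind_gen xs w - ind_gen xs w' \<in> ind_rel S act2"
    "ind_gen xs (c *\<^sub>C w) - c *\<^sub>C ind_gen xs w \<in> ind_rel S act2"
    "x \<in> g_circ S \<Longrightarrow> ind_gen (xs @ [x]) w - ind_gen xs (act2 x w) \<in> ind_rel S act2"
    "x \<in> g_sigma0_plus S \<Longrightarrow> ind_gen (xs @ [x]) w \<in> ind_rel S act2"
  unfolding ind_rel_def Let_def using assms by blast+

lemma incl_linear: "clinear incl"
proof -
  note f = ind_gen_free [of "[]", simplified]
  have fd: "f - g \<in> ind_free S" if "f \<in> ind_free S" "g \<in> ind_free S" for f g
    using ind_free_subspace that by (rule complex_vector.subspace_diff)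
  have "incl (w + w') = incl w + incl w'" for w w'
  proof -
    have "ind_gen [] (w + w') - ind_gen [] w - ind_gen [] w' \<in> ind_rel S act2" by (rule ind_rel_simple) simp
    from pi_rel [OF this] show ?thesis by (simp add: pi_lin fd f incl_def diff_eq_eq add.commute)
  qed
  moreover have "incl (c *\<^sub>C w) = c *\<^sub>C incl w" for c w
  proof -
    have "ind_gen [] (c *\<^sub>C w) - c *\<^sub>C ind_gen [] w \<in> ind_rel S act2" by (rule ind_rel_simple) simp
    moreover have cf: "c *\<^sub>C ind_gen [] w \<in> ind_free S" using ind_free_subspace f by (rule csubspace_scale)
    ultimately have "\<pi> (ind_gen [] (c *\<^sub>C w) - c *\<^sub>C ind_gen [] w) = 0" by (intro pi_rel)
    then show ?thesis using cf by (simp add: pi_lin pi_scaleC f incl_def)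
  qed
  ultimately show ?thesis by (simp add: clinear_iff)
qed

lemma ind_act_gen: "ind_act x (ind_gen xs w) = ind_gen (x # xs) w"
  unfolding ind_act_def ind_gen_def by (subst pm_sum_single) simp_all

lemma pi_gen_Cons: "x \<in> g_sigma0 S \<Longrightarrow> set xs \<subseteq> g_sigma0 S \<Longrightarrow> \<pi> (ind_gen (x # xs) w) = act x (\<pi> (ind_gen xs w))"
  using pi_act [of x "ind_gen xs w"] by (simp add: ind_act_gen ind_gen_free)

lemma incl_act:
  assumes x: "x \<in> g_circ S" shows "act x (incl w) = incl (act2 x w)"
proof -
  have x0: "x \<in> g_sigma0 S" using x by (simp add: g_circ_def)
  have "ind_gen ([] @ [x]) w - ind_gen [] (act2 x w) \<in> ind_rel S act2"
    by (rule ind_rel_simple) (use x in simp_all)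
  from pi_rel [OF this] show ?thesis
    using pi_gen_Cons [OF x0, of "[]" w] x0 by (simp add: pi_lin ind_gen_free incl_def)
qed

lemma wvecs_plus: "a \<in> pos S \<Longrightarrow> x \<in> wvecs a k \<Longrightarrow> x \<in> g_sigma0_plus S"
  unfolding g_sigma0_plus_def
  by (rule cspan_base) (auto simp: weight_space_def intro: wvecs_sigma0 wvecs_weight)

lemma incl_plus:
  assumes "a \<in> pos S" "x \<in> wvecs a k" shows "act x (incl w) = 0"
proof -
  have x0: "x \<in> g_sigma0 S" using assms(2) by (rule wvecs_sigma0)
  have "ind_gen ([] @ [x]) w \<in> ind_rel S act2"
    by (rule ind_rel_simple) (use wvecs_plus [OF assms] in simp_all)
  from pi_rel [OF this] show ?thesis
    using pi_gen_Cons [OF x0, of "[]" w] by (simp add: incl_def)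
qed

lemma incl_grade:
  assumes "w \<in> G2 (coset S l)" shows "incl w \<in> G (coset S l)"
proof -
  have "ind_gen [] w \<in> ind_grade S G2 (coset S l)"
    unfolding ind_grade_def
    by (rule cspan_base) (use assms in \<open>auto intro!: exI [of _ "[]"] exI [of _ l]\<close>)
  then show ?thesis using pi_grade [OF coset_Lambda, of l] by (auto simp: incl_def)
qed

text \<open>The induced module is generated by \<open>W\<^sub>2\<close>, so its quotient would be zero together with the image of
  \<open>W\<^sub>2\<close>.\<close>

lemma incl_nonzero: "\<exists>l. \<exists>w\<in>G2 (coset S l). incl w \<noteq> 0"
proof (rule ccontr)
  assume "\<not> ?thesis"
  then have zero: "incl w \<in> {0}" if "w \<in> (\<Union>q\<in>Lambda S. G2 q)" for w using that by (auto simp: Lambda_def)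
  have "incl w \<in> {0}" for w
    by (rule clinear_span_subset [OF incl_linear, where A = "\<Union>q\<in>Lambda S. G2 q"])
       (use zero csubspace_0 in \<open>auto simp: direct_sum_span_UN [OF ds2]\<close>)
  then have "\<pi> (ind_gen xs w) = 0" if "set xs \<subseteq> g_sigma0 S" for xs w
    using that
  proof (induction xs)
    case Nil
    then show ?case by (simp add: incl_def)
  next
    case (Cons x xs)
    then show ?case using clinear_0 [OF clinear_act, of x] by (simp add: pi_gen_Cons)
  qed
  then have "{ind_gen xs w | xs w. set xs \<subseteq> g_sigma0 S} \<subseteq> {f \<in> ind_free S. \<pi> f = 0}"
    using ind_gen_free by auto
  moreover have "csubspace {f \<in> ind_free S. \<pi> f = 0}"
  proof (rule csubspaceI)
    have "(0 :: 'g list \<times> 'w2 \<Rightarrow>\<^sub>0 complex) \<in> ind_free S"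
      by (rule csubspace_zero [OF ind_free_subspace])
    then show "0 \<in> {f \<in> ind_free S. \<pi> f = 0}"
      using pi_scaleC [of 0 0] by simp
  qed (simp_all add: pi_lin(1) pi_scaleC csubspace_add [OF ind_free_subspace]
      csubspace_scale [OF ind_free_subspace])
  ultimately have "ind_free S \<subseteq> {f \<in> ind_free S. \<pi> f = 0}"
    unfolding ind_free_def by (rule cspan_minimal)
  then have "(UNIV :: 'w set) = {0}" using pi_onto by force
  then show False using irr by (simp add: graded_irreducible_def)
qed

text \<open>Schur's lemma for graded modules.  \<open>h\<close> has an eigenvector in the finite dimensional \<open>W\<^sub>2\<close>.  It has
  degree zero and commutes with \<open>g_circ\<close>, so its eigenspaces are graded submodules.\<close>

lemma csa0_scalar:
  assumes h: "h \<in> csa0 S" shows "\<exists>c. \<forall>w. act2 h w = c *\<^sub>C w"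
proof -
  have hc: "h \<in> g_circ S" "h \<in> eigen_n S 0"
    using csa0_wvecs [OF h] by (auto intro: wvecs_zero_g_circ wvecs_eigen_n)
  note lin = clinear_act2 [OF hc(1)]
  obtain c v where v: "v \<noteq> 0" "act2 h v = c *\<^sub>C v"
    by (rule exists_eigenvector [OF lin fd2 nontrivial2])
  let ?N = "{w. act2 h w = c *\<^sub>C w}"
  have sub: "csubspace ?N"
    by (rule csubspaceI)
       (simp_all add: clinear_0 [OF lin] clinear_add [OF lin] clinear_scaleC [OF lin] scaleC_add_right scaleC_scaleC mult.commute)
  have "submodule (g_circ S) act2 UNIV ?N"
    unfolding submodule_def
  proof (intro conjI ballI sub)
    fix x w assume x: "x \<in> g_circ S" and w: "w \<in> ?N"
    have "act2 0 w = 0"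
      using circ_module hc(1) unfolding lie_module_def clinear_on_def by (metis UNIV_I scaleC_zero_left)
    moreover have "act2 (brk S h x) w = act2 h (act2 x w) - act2 x (act2 h w)"
      using circ_module hc(1) x by (simp add: lie_module_def)
    moreover have "brk S h x = 0" using x h by (simp add: g_circ_def)
    ultimately show "act2 x w \<in> ?N" using w by (simp add: clinear_scaleC [OF clinear_act2 [OF x]])
  qed simp
  moreover have "?N = cspan (\<Union>q\<in>Lambda S. ?N \<inter> G2 q)"
  proof
    show "cspan (\<Union>q\<in>Lambda S. ?N \<inter> G2 q) \<subseteq> ?N"
      by (rule cspan_minimal [OF _ sub]) blast
    obtain p where p: "\<And>q. clinear (p q)" "\<And>q v. q \<in> Lambda S \<Longrightarrow> p q v \<in> G2 q"
      "\<And>q v. q \<in> Lambda S \<Longrightarrow> v \<in> G2 q \<Longrightarrow> p q v = v"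
      "\<And>q q' v. q' \<in> Lambda S \<Longrightarrow> q \<noteq> q' \<Longrightarrow> v \<in> G2 q' \<Longrightarrow> p q v = 0"
      "\<And>v. v \<in> cspan ((\<lambda>q. p q v) ` Lambda S)"
      by (rule direct_sum_projections [OF ds2]) blast
    have comm: "act2 h (p q w) = p q (act2 h w)" if q: "q \<in> Lambda S" for q w
    proof -
      have "act2 h (p q w) - p q (act2 h w) \<in> {0}"
      proof (rule clinear_span_subset [of "\<lambda>w. act2 h (p q w) - p q (act2 h w)"])
        show "clinear (\<lambda>w. act2 h (p q w) - p q (act2 h w))"
          using lin p(1) [of q] by (simp add: clinear_iff complex_vector.scale_right_diff_distrib)
        show "w \<in> cspan (\<Union>q\<in>Lambda S. G2 q)" by (simp add: direct_sum_span_UN [OF ds2])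
        fix w assume "w \<in> (\<Union>q\<in>Lambda S. G2 q)"
        then obtain q' where q': "q' \<in> Lambda S" "w \<in> G2 q'" by blast
        then have "act2 h w \<in> G2 q'" using act2_grade [OF hc] by (auto simp: Lambda_def)
        then show "act2 h (p q w) - p q (act2 h w) \<in> {0}"
          using p(3,4) q q' clinear_0 [OF lin] by (cases "q = q'") auto
      qed (rule csubspace_0)
      then show ?thesis by simp
    qed
    show "?N \<subseteq> cspan (\<Union>q\<in>Lambda S. ?N \<inter> G2 q)"
    proof
      fix w assume w: "w \<in> ?N"
      have "p q w \<in> ?N" if "q \<in> Lambda S" for q
        using comm [OF that, of w] w by (simp add: clinear_scaleC [OF p(1)])
      then have "(\<lambda>q. p q w) ` Lambda S \<subseteq> (\<Union>q\<in>Lambda S. ?N \<inter> G2 q)" using p(2) by blast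
      then show "w \<in> cspan (\<Union>q\<in>Lambda S. ?N \<inter> G2 q)"
        using cspan_mono p(5) by blast
    qed
  qed
  ultimately have "?N = {0} \<or> ?N = UNIV" by (rule irr2_sub)
  with v show ?thesis by blast
qed

definition top_weight :: "'g \<Rightarrow> complex" where
  "top_weight h = (SOME c. \<forall>w. act2 h w = c *\<^sub>C w)"

lemma act_csa0_incl: "h \<in> csa0 S \<Longrightarrow> act h (incl w) = top_weight h *\<^sub>C incl w"
proof -
  assume h: "h \<in> csa0 S"
  have "\<forall>w. act2 h w = top_weight h *\<^sub>C w" unfolding top_weight_def by (rule someI_ex) (rule csa0_scalar [OF h])
  moreover have "h \<in> g_circ S" using csa0_wvecs [OF h] by (rule wvecs_zero_g_circ)
  ultimately show ?thesis by (simp add: incl_act clinear_scaleC [OF incl_linear])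
qed

abbreviation lc where "lc \<equiv> lower_closure S act"

lemma lc_step: "(coset S l, v) \<in> lc A K \<Longrightarrow> a \<in> A \<Longrightarrow> x \<in> wvecs a k \<Longrightarrow> (coset S (k + l), act x v) \<in> lc A K"
  using lower_closure.step [of S l v act A K a x k] by (simp add: wvecs_def)

lemma lc_mem: "(q, v) \<in> lc A K \<Longrightarrow> v \<in> cspan (snd ` lc A K)"
  by (rule cspan_base, rule image_eqI [of _ _ "(q, v)"]) simp_all

lemma lc_base: "(q, v) \<in> K \<Longrightarrow> v \<in> cspan (snd ` lc A K)"
  by (rule lc_mem, rule lower_closure.base)

lemma lc_grade:
  assumes "\<And>q v. (q, v) \<in> K \<Longrightarrow> q \<in> Lambda S \<and> v \<in> G q" "(q, v) \<in> lc A K"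
  shows "q \<in> Lambda S \<and> v \<in> G q"
  using assms(2)
proof (induction q v rule: lower_closure.induct [split_format (complete)])
  case (base q v)
  then show ?case using assms(1) by blast
next
  case (step l v a x k)
  then show ?case using coset_Lambda act_wvecs_grade [of x a k v l] by (simp add: wvecs_def)
qed

context
  fixes A :: "('g \<Rightarrow> complex) set" and K :: "((int ^ 'n) set \<times> 'w) set"
  assumes K_grade: "\<And>q v. (q, v) \<in> K \<Longrightarrow> q \<in> Lambda S \<and> v \<in> G q"
    and K_stable: "\<And>q v a k x. (q, v) \<in> K \<Longrightarrow> a \<in> enlarged_roots0 b S \<Longrightarrow> x \<in> wvecs a k \<Longrightarrow>
       act x v \<in> cspan (snd ` lc A K)"
begin

lemma lc_act: "a \<in> A \<Longrightarrow> x \<in> wvecs a k \<Longrightarrow> v \<in> cspan (snd ` lc A K) \<Longrightarrow> act x v \<in> cspan (snd ` lc A K)"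
proof (rule clinear_span_subset [OF clinear_act])
  fix w assume a: "a \<in> A" "x \<in> wvecs a k" and "w \<in> snd ` lc A K"
  then obtain p where p: "(p, w) \<in> lc A K" by auto
  then obtain l where "p = coset S l" using lc_grade [OF K_grade p] by (auto simp: Lambda_def)
  with p have "(coset S (k + l), act x w) \<in> lc A K" using lc_step [OF _ a] by blast
  then show "act x w \<in> cspan (snd ` lc A K)" by (rule lc_mem)
qed (auto intro: wvecs_sigma0)

text \<open>The part of the Poincare-Birkhoff-Witt theorem that is needed: if the action of \<open>\<gg>(\<sigma>\<^sub>0)\<close> on \<open>K\<close> does
  not lead out of \<open>U(\<gg>(\<sigma>\<^sub>0)\<^sub>-) K\<close>, then that space is a submodule.  In \<open>x y v = y x v + [x, y] v\<close>
  both \<open>x v\<close> and \<open>[x, y] v\<close> are covered by the induction hypothesis, which is about all \<open>x\<close>.\<close>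

lemma lc_stable:
  assumes "(q, v) \<in> lc A K" "x \<in> g_sigma0 S"
  shows "act x v \<in> cspan (snd ` lc A K)"
  using assms
proof (induction q v arbitrary: x rule: lower_closure.induct [split_format (complete)])
  case (base q v)
  show ?case
    by (rule act_in_subspace [OF base(2), of v "{v}"])
       (use base K_stable in \<open>auto simp: cspan_base\<close>)
next
  case (step l v a y k)
  then have y: "y \<in> wvecs a k" by (simp add: wvecs_def)
  note y0 = wvecs_sigma0 [OF y]
  let ?M = "cspan (snd ` lc A K)"
  have "act x (act y v) = act y (act x v) + act (brk S x y) v"
    using step.prems y0 by (simp add: act_commutator)
  moreover have "act y (act x v) \<in> ?M"
    by (rule lc_act [OF step.hyps(2) y step.IH [OF step.prems]])
  moreover have "act (brk S x y) v \<in> ?M"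
    by (rule step.IH) (rule g_sigma0_brk [OF step.prems y0])
  ultimately show ?case by (simp add: cspan_add)
qed

lemma lc_UN: "snd ` lc A K = (\<Union>q\<in>Lambda S. {v. (q, v) \<in> lc A K})"
  using lc_grade [OF K_grade] by force

lemma lc_trivial: "cspan (snd ` lc A K) = {0} \<or> cspan (snd ` lc A K) = UNIV"
  unfolding lc_UN
proof (rule graded_submodule_trivial [OF irr])
  show "{v. (q, v) \<in> lc A K} \<subseteq> G q" for q using lc_grade [OF K_grade] by blast
  fix a k y q w assume "y \<in> wvecs a k" "w \<in> {v. (q, v) \<in> lc A K}"
  then show "act y w \<in> cspan (\<Union>q\<in>Lambda S. {v. (q, v) \<in> lc A K})"
    unfolding lc_UN [symmetric] by (auto intro: lc_stable wvecs_sigma0)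
qed

end

text \<open>The argument uses \<open>lc_trivial\<close> twice with the negative weights \<open>A\<close>.  For the image \<open>K1\<close> of \<open>W\<^sub>2\<close> it
  yields that the module is \<open>U(\<gg>(\<sigma>\<^sub>0)\<^sub>-) W\<^sub>2\<close>, so \<open>u\<close> is the sum of an element of \<open>W\<^sub>2\<close> and a singular
  vector in \<open>R\<close>, the span of what negative weight vectors produce.  For the set \<open>K2\<close> of singular vectors
  in \<open>R\<close> it yields a graded submodule inside \<open>R\<close>, which is zero since \<open>R\<close> meets the image of
  \<open>W\<^sub>2\<close> only in zero.\<close>

theorem singular_vectors_are_incl:
  assumes u: "u \<in> G (coset S l0)" and sing: "\<And>a k x. a \<in> pos S \<Longrightarrow> x \<in> wvecs a k \<Longrightarrow> act x u = 0"
  shows "u \<in> incl ` G2 (coset S l0)"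
proof -
  obtain f :: "('g \<Rightarrow> complex) \<Rightarrow> real" where "height f" using height_exists by blast
  then have f: "f (\<lambda>x. a x + a' x) = f a + f a'" "f (\<lambda>x. 0) = 0"
      "a \<in> enlarged_roots0 b S \<Longrightarrow> a = (\<lambda>x. 0) \<or> a \<in> pos S \<or> f a < 0" for a a'
    by (simp_all add: height_def)
  define A where "A = {a \<in> enlarged_roots0 b S. f a < 0}"
  have cases: "a = (\<lambda>x. 0) \<or> a \<in> pos S \<or> a \<in> A" if "a \<in> enlarged_roots0 b S" for a
    using f(3) [OF that] that by (auto simp: A_def)
  define K1 where "K1 = {(q, incl w) | q w. q \<in> Lambda S \<and> w \<in> G2 q}"
  have K1_grade: "q \<in> Lambda S \<and> v \<in> G q" if "(q, v) \<in> K1" for q v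
    using that incl_grade by (auto simp: K1_def Lambda_def)
  have K1_stable: "act x v \<in> cspan (snd ` lc A K1)"
    if K: "(q, v) \<in> K1" and a: "a \<in> enlarged_roots0 b S" and x: "x \<in> wvecs a k" for q v a k x
  proof -
    from K obtain l w where v: "v = incl w" "w \<in> G2 (coset S l)" "q = coset S l" by (auto simp: K1_def Lambda_def)
    from cases [OF a] consider "a = (\<lambda>x. 0)" | "a \<in> pos S" | "a \<in> A" by blast
    then show ?thesis
    proof cases
      case 1
      then have x': "x \<in> g_circ S" using x wvecs_zero_g_circ by blast
      then have "(coset S (k + l), incl (act2 x w)) \<in> K1"
        using act2_grade [OF x' wvecs_eigen_n [OF x] v(2)] coset_Lambda by (auto simp: K1_def)
      then show ?thesis unfolding v(1) incl_act [OF x'] by (rule lc_base)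
    next
      case 2
      then show ?thesis using incl_plus [OF _ x] v(1) by (simp add: cspan_zero)
    next
      case 3
      have "(coset S l, v) \<in> lc A K1" using K unfolding v(3) by (rule lower_closure.base)
      then show ?thesis by (rule lc_mem [OF lc_step [OF _ 3 x]])
    qed
  qed
  have all: "cspan (snd ` lc A K1) = UNIV"
  proof -
    obtain l w where "w \<in> G2 (coset S l)" "incl w \<noteq> 0" using incl_nonzero by blast
    moreover from this have "(coset S l, incl w) \<in> K1" using coset_Lambda by (auto simp: K1_def)
    then have "incl w \<in> cspan (snd ` lc A K1)" by (rule lc_base)
    moreover have "cspan (snd ` lc A K1) = {0} \<or> cspan (snd ` lc A K1) = UNIV"
      by (rule lc_trivial, erule K1_grade, erule (2) K1_stable)
    ultimately show ?thesis by blast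
  qed
  define R where "R = cspan {act y v | y v a k. a \<in> A \<and> y \<in> wvecs a k}"
  have R_step: "act y v \<in> R" if "a \<in> A" "y \<in> wvecs a k" for a k y v
    unfolding R_def by (rule cspan_base) (use that in blast)
  have R_sub: "csubspace R" by (simp add: R_def)
  \<comment> \<open>\<open>[x, y]\<close> has the same negative weight as \<open>y\<close>.\<close>
  have R_circ: "act x r \<in> R" if x: "x \<in> wvecs (\<lambda>h. 0) k" and r: "r \<in> R" for x k r
  proof (rule clinear_span_subset [OF clinear_act [OF wvecs_sigma0 [OF x]] r [unfolded R_def] R_sub])
    fix s assume "s \<in> {act y v | y v a k. a \<in> A \<and> y \<in> wvecs a k}"
    then obtain y v a l where s: "s = act y v" "a \<in> A" "y \<in> wvecs a l" by blast
    have "act x (act y v) = act y (act x v) + act (brk S x y) v"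
      using wvecs_sigma0 [OF x] wvecs_sigma0 [OF s(3)] by (simp add: act_commutator)
    moreover have "brk S x y \<in> wvecs a (k + l)" using wvecs_brk [OF x s(3)] by simp
    ultimately show "act x s \<in> R"
      using R_step [OF s(2)] s csubspace_add [OF R_sub] by metis
  qed
  \<comment> \<open>\<open>R\<close> is spanned by vectors of weight \<open>top_weight + \<mu>\<close> with \<open>\<mu>\<close> of negative height, but
    \<open>W\<^sub>2\<close> has weight \<open>top_weight\<close>, and \<open>\<mu> = 0\<close> has height \<open>0\<close>.\<close>
  have incl_R: "incl w = 0" if w: "incl w \<in> R" for w
  proof -
    let ?I = "{\<mu>. f \<mu> < 0 \<and> (\<forall>h. h \<notin> csa0 S \<longrightarrow> \<mu> h = 0)}"
    let ?X = "\<lambda>\<mu>. {v. \<forall>h\<in>csa0 S. act h v = (top_weight h + \<mu> h) *\<^sub>C v}"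
    note h0 = wvecs_sigma0 [OF csa0_wvecs]
    have X_step: "act y v \<in> ?X (\<lambda>h. a h + \<mu> h)" if y: "y \<in> wvecs a k" and v: "v \<in> ?X \<mu>" for y a k v \<mu>
    proof safe
      fix h assume h: "h \<in> csa0 S"
      have "act h (act y v) = act y (act h v) + act (brk S h y) v"
        using h0 [OF h] wvecs_sigma0 [OF y] by (simp add: act_commutator)
      also have "act h v = (top_weight h + \<mu> h) *\<^sub>C v" using v h by blast
      also have "brk S h y = a h *\<^sub>C y" by (rule wvecs_weight [OF y h])
      also have "act (a h *\<^sub>C y) v = a h *\<^sub>C act y v"
        using clinear_on_act [of v] wvecs_sigma0 [OF y] by (simp add: clinear_on_def)
      finally show "act h (act y v) = (top_weight h + (a h + \<mu> h)) *\<^sub>C act y v"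
        by (simp add: clinear_scaleC [OF clinear_act [OF wvecs_sigma0 [OF y]]]
            clinear_add [OF clinear_act [OF wvecs_sigma0 [OF y]]] scaleC_add_left algebra_simps)
    qed
    have wt: "\<exists>\<mu>. f \<mu> \<le> 0 \<and> (\<forall>h. h \<notin> csa0 S \<longrightarrow> \<mu> h = 0) \<and> v \<in> ?X \<mu>" if "(q, v) \<in> lc A K1" for q v
      using that
    proof (induction q v rule: lower_closure.induct [split_format (complete)])
      case (base q v)
      then show ?case by (intro exI [of _ "\<lambda>h. 0"]) (auto simp: K1_def f(2) act_csa0_incl)
    next
      case (step l v a y k)
      then obtain \<mu> where \<mu>: "f \<mu> \<le> 0" "\<forall>h. h \<notin> csa0 S \<longrightarrow> \<mu> h = 0" "v \<in> ?X \<mu>" by blast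
      have y: "y \<in> wvecs a k" using step.hyps by (simp add: wvecs_def)
      show ?case
        using X_step [OF y \<mu>(3)] \<mu> step.hyps(2) roots_dual
        by (intro exI [of _ "\<lambda>h. a h + \<mu> h"] conjI) (auto simp: f(1) A_def)
    qed
    have "act y v \<in> cspan (\<Union>\<mu>\<in>?I. ?X \<mu>)" if a: "a \<in> A" and y: "y \<in> wvecs a k" for a k y v
    proof (rule clinear_span_subset [OF clinear_act [OF wvecs_sigma0 [OF y]]])
      show "v \<in> cspan (snd ` lc A K1)" by (simp add: all)
      fix v assume "v \<in> snd ` lc A K1"
      then obtain \<mu> where \<mu>: "f \<mu> \<le> 0" "\<forall>h. h \<notin> csa0 S \<longrightarrow> \<mu> h = 0" "v \<in> ?X \<mu>" using wt by force
      have "(\<lambda>h. a h + \<mu> h) \<in> ?I" using \<mu> a roots_dual by (auto simp: f(1) A_def)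
      with X_step [OF y \<mu>(3)] show "act y v \<in> cspan (\<Union>\<mu>\<in>?I. ?X \<mu>)"
        by (intro cspan_base) blast
    qed simp
    then have "R \<subseteq> cspan (\<Union>\<mu>\<in>?I. ?X \<mu>)"
      unfolding R_def by (intro cspan_minimal) auto
    with w have "incl w \<in> cspan (\<Union>\<mu>\<in>?I. ?X \<mu>)" by blast
    then have "incl w \<in> cspan (\<Union>\<mu>\<in>{\<mu>\<in>?I. \<forall>h\<in>csa0 S. top_weight h + \<mu> h = top_weight h}. ?X \<mu>)"
    proof (rule joint_eigenvector_in_span [where T = act and J = "csa0 S" and \<mu> = "\<lambda>\<mu> h. top_weight h + \<mu> h" and \<nu> = top_weight, rotated 3])
      show "clinear (act h)" if "h \<in> csa0 S" for h by (rule clinear_act [OF h0 [OF that]])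
      show "act h (incl w) = top_weight h *\<^sub>C incl w" if "h \<in> csa0 S" for h by (rule act_csa0_incl [OF that])
      fix \<mu> \<mu>' assume \<mu>: "\<mu> \<in> ?I" "\<mu>' \<in> ?I" "\<mu> \<noteq> \<mu>'"
      then obtain h where h: "\<mu> h \<noteq> \<mu>' h" by blast
      with \<mu> have "h \<in> csa0 S" by (metis (mono_tags, lifting) mem_Collect_eq)
      with h show "\<exists>h\<in>csa0 S. top_weight h + \<mu> h \<noteq> top_weight h + \<mu>' h" by auto
    qed auto
    moreover have "{\<mu>\<in>?I. \<forall>h\<in>csa0 S. top_weight h + \<mu> h = top_weight h} = {}"
    proof -
      have "\<mu> = (\<lambda>h. 0)" if "\<mu> \<in> ?I" "\<forall>h\<in>csa0 S. top_weight h + \<mu> h = top_weight h" for \<mu>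
        by (rule ext) (use that in auto)
      then show ?thesis using f(2) by fastforce
    qed
    ultimately show ?thesis by simp
  qed
  have R_proper: "R \<noteq> UNIV" using incl_R incl_nonzero by blast
  define K2 where "K2 = {(q, v). q \<in> Lambda S \<and> v \<in> G q \<and> v \<in> R \<and> (\<forall>a\<in>pos S. \<forall>k. \<forall>x\<in>wvecs a k. act x v = 0)}"
  have K2_grade: "q \<in> Lambda S \<and> v \<in> G q" if "(q, v) \<in> K2" for q v
    using that by (auto simp: K2_def)
  have K2_stable: "act x v \<in> cspan (snd ` lc A K2)"
    if K: "(q, v) \<in> K2" and a: "a \<in> enlarged_roots0 b S" and x: "x \<in> wvecs a k" for q v a k x
  proof -
    from K obtain l where q: "q = coset S l" by (auto simp: K2_def Lambda_def)
    from cases [OF a] consider "a = (\<lambda>x. 0)" | "a \<in> pos S" | "a \<in> A" by blast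
    then show ?thesis
    proof cases
      case 1
      have "act z (act x v) = 0" if z: "a' \<in> pos S" "z \<in> wvecs a' k'" for z a' k'
      proof -
        have "act z (act x v) = act x (act z v) + act (brk S z x) v"
          using wvecs_sigma0 [OF x] wvecs_sigma0 [OF z(2)] by (simp add: act_commutator)
        moreover have "brk S z x \<in> wvecs a' (k' + k)" using wvecs_brk [OF z(2) x] 1 by simp
        ultimately show ?thesis using K z clinear_0 [OF clinear_act [OF wvecs_sigma0 [OF x]]] by (auto simp: K2_def)
      qed
      then have "(coset S (k + l), act x v) \<in> K2"
        using K R_circ [of x k v] x 1 act_wvecs_grade [OF x, of v l] coset_Lambda q by (auto simp: K2_def)
      then show ?thesis by (rule lc_base)
    next
      case 2
      then show ?thesis using K x by (auto simp: K2_def cspan_zero)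
    next
      case 3
      have "(coset S l, v) \<in> lc A K2" using K unfolding q by (rule lower_closure.base)
      then show ?thesis by (rule lc_mem [OF lc_step [OF _ 3 x]])
    qed
  qed
  have "v \<in> R" if "(q, v) \<in> lc A K2" for q v
    using that
  proof cases
    case base
    then show ?thesis by (simp add: K2_def)
  next
    case (step l v' a x k)
    then show ?thesis using R_step [of a x k] by (simp add: wvecs_def)
  qed
  then have "cspan (snd ` lc A K2) \<subseteq> R" by (intro cspan_minimal [OF _ R_sub]) auto
  moreover have "cspan (snd ` lc A K2) = {0} \<or> cspan (snd ` lc A K2) = UNIV"
    by (rule lc_trivial, erule K2_grade, erule (2) K2_stable)
  ultimately have zero: "cspan (snd ` lc A K2) = {0}" using R_proper by blast
  let ?q = "coset S l0"
  have grade1: "q \<in> Lambda S \<and> v \<in> G q" if "(q, v) \<in> lc A K1" for q v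
    by (rule lc_grade [OF _ that]) (rule K1_grade)
  have "snd ` lc A K1 = (\<Union>q\<in>Lambda S. {v. (q, v) \<in> lc A K1})"
    by (rule lc_UN, erule K1_grade, erule (2) K1_stable)
  then have "u \<in> cspan (\<Union>q\<in>Lambda S. {v. (q, v) \<in> lc A K1})" using all by simp
  then have "u \<in> cspan {v. (?q, v) \<in> lc A K1}"
    by (rule direct_sum_in_span [OF act_ds _ _ u coset_Lambda, rotated]) (use grade1 in blast)
  moreover have "{v. (?q, v) \<in> lc A K1} \<subseteq> incl ` G2 ?q \<union> (R \<inter> G ?q)"
  proof clarify
    fix v assume v: "(?q, v) \<in> lc A K1" "v \<notin> R \<inter> G ?q"
    have "v \<in> G ?q" using grade1 [OF v(1)] by simp
    with v(2) have nR: "v \<notin> R" by blast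
    from v(1) show "v \<in> incl ` G2 ?q"
    proof cases
      case base
      then show ?thesis by (auto simp: K1_def)
    next
      case (step l v' a x k)
      then have "v \<in> R" using R_step [of a x k] by (simp add: wvecs_def)
      with nR show ?thesis by blast
    qed
  qed
  ultimately have "u \<in> cspan (incl ` G2 ?q \<union> (R \<inter> G ?q))"
    using cspan_mono by blast
  then obtain p r where pr: "p \<in> cspan (incl ` G2 ?q)" "r \<in> cspan (R \<inter> G ?q)" "u = p + r"
    unfolding complex_vector.span_Un by blast
  have G2_sub: "csubspace (G2 ?q)" using ds2 coset_Lambda by (auto simp: direct_sum_def)
  have "csubspace (incl ` G2 ?q)"
  proof (rule csubspaceI; (elim imageE)?)
    show "0 \<in> incl ` G2 ?q"
      using clinear_0 [OF incl_linear] csubspace_zero [OF G2_sub] by force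
    show "x + y \<in> incl ` G2 ?q" if "x = incl v" "v \<in> G2 ?q" "y = incl w" "w \<in> G2 ?q" for x y v w
      unfolding that(1,3) clinear_add [OF incl_linear, symmetric]
      by (rule imageI) (rule csubspace_add [OF G2_sub that(2,4)])
    show "c *\<^sub>C x \<in> incl ` G2 ?q" if "x = incl v" "v \<in> G2 ?q" for c x v
      unfolding that(1) clinear_scaleC [OF incl_linear, symmetric]
      by (rule imageI) (rule csubspace_scale [OF G2_sub that(2)])
  qed
  then have "p \<in> incl ` G2 ?q" using pr(1) by (simp add: complex_vector.span_eq_iff [THEN iffD2])
  then obtain w where w: "p = incl w" "w \<in> G2 ?q" by blast
  have "r \<in> R \<inter> G ?q"
    using pr(2) complex_vector.subspace_inter [OF R_sub G_subspace] by (simp add: complex_vector.span_eq_iff [THEN iffD2])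
  then have r: "r \<in> R" "r \<in> G ?q" by auto
  have "act x r = 0" if "a \<in> pos S" "x \<in> wvecs a k" for a x k
    using sing [OF that] incl_plus [OF that] pr(3) w(1) clinear_add [OF clinear_act [OF wvecs_sigma0 [OF that(2)]]] by simp
  with r have "(?q, r) \<in> K2" using coset_Lambda by (auto simp: K2_def)
  then have "r \<in> cspan (snd ` lc A K2)" by (rule lc_base)
  with zero have "r = 0" by simp
  with pr(3) w show ?thesis by simp
qed

end

section \<open>The top space\<close>

lemma lookup_loop_map:
  "lookup (loop_map f s) k = tensor_map id f (lookup s k)"
  by (simp add: loop_map_def map.rep_eq when_def)

context loop_module
begin

lemma lookup_lin_act_L:
  assumes "x \<in> g_sigma0 S"
  shows "lookup (lin_act (loopX (emb l) x) v) (k + l) = tensor_map id (act x) (lookup v k)"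
proof -
  let ?d = "\<lambda>v. lookup (lin_act (loopX (emb l) x) v) (k + l) - tensor_map id (act x) (lookup v k)"
  have "?d v \<in> {0}"
  proof (rule clinear_span_subset [of ?d, OF _ poly_mapping_in_span_singles [of v "\<lambda>_. UNIV"]])
    show "clinear ?d"
      using loop_act_linear_vector [of gl proj_act \<alpha> d C0 "loopX (emb l) x"]
      by (simp add: clinear_iff lookup_add lookup_scaleC tensor_map_add tensor_map_scaleC
          complex_vector.scale_right_diff_distrib)
    fix a :: "int ^ 'n \<Rightarrow>\<^sub>0 ('w1, 'w) tensor" assume "a \<in> {single k x | k x. x \<in> UNIV}"
    then obtain k' w where "a = single k' w" by blast
    then show "?d a \<in> {0}"
      unfolding lin_act_L using assms by (auto simp: lin_act_L proj_act lookup_single when_def)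
  qed (auto intro: csubspace_0)
  then show ?thesis by simp
qed

lemma tcoord_tensor_map:
  assumes B: "finite B" "complex_vector.independent B" "cspan B = UNIV" and f: "clinear f"
  shows "tcoord B c (tensor_map id f w) = f (tcoord B c w)"
  by (rule clinear_eq_on_tensors [where f = "\<lambda>w. tcoord B c (tensor_map id f w)" and g = "\<lambda>w. f (tcoord B c w)"])
     (use f in \<open>simp_all add: clinear_iff tcoord_add tcoord_scaleC tensor_map_add tensor_map_scaleC
        tensor_map_tensor [OF clinear_id f] tcoord_tensor [OF B]\<close>)

end

locale loop_quotient = loop_module b S act G gl \<alpha> d C0 + induced_quotient b S act G act2 G2 \<pi>
  for b :: nat and S :: "('g::complex_vector, 'n::finite) toroidal_data"
    and act :: "'g \<Rightarrow> 'w::complex_vector \<Rightarrow> 'w" and G :: "(int ^ 'n) set \<Rightarrow> 'w set"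
    and gl :: "complex ^ 'n ^ 'n \<Rightarrow> 'w1::complex_vector \<Rightarrow> 'w1"
    and \<alpha> :: "complex ^ 'n" and d C0 :: complex
    and act2 :: "'g \<Rightarrow> 'w2::complex_vector \<Rightarrow> 'w2" and G2 :: "(int ^ 'n) set \<Rightarrow> 'w2 set"
    and \<pi> :: "('g list \<times> 'w2 \<Rightarrow>\<^sub>0 complex) \<Rightarrow> 'w"
begin

lemma tau0_plus_kills_iff:
  "(\<forall>X\<in>tau0_plus S. tau0_act X v = 0) \<longleftrightarrow> (\<forall>a\<in>pos S. \<forall>k. \<forall>x\<in>wvecs a k. lin_act (loopX (emb k) x) v = 0)"
proof
  assume l: "\<forall>X\<in>tau0_plus S. tau0_act X v = 0"
  show "\<forall>a\<in>pos S. \<forall>k. \<forall>x\<in>wvecs a k. lin_act (loopX (emb k) x) v = 0"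
  proof (intro ballI allI)
    fix a k x assume a: "a \<in> pos S" and x: "x \<in> wvecs a k"
    have "loopX (emb k) x \<in> tau0_plus S"
      unfolding tau0_plus_def by (rule cspan_base) (use a x in \<open>auto simp: wvecs_def\<close>)
    with l have "tau0_act (loopX (emb k) x) v = 0" by (rule bspec)
    then show "lin_act (loopX (emb k) x) v = 0" by (simp only: tau0_act_deg_gens0 [OF deg_gens0_intros(1) [OF x]])
  qed
next
  assume r: "\<forall>a\<in>pos S. \<forall>k. \<forall>x\<in>wvecs a k. lin_act (loopX (emb k) x) v = 0"
  let ?L = "{loopX (emb k) x | k x. \<exists>a\<in>pos S. x \<in> weight_space (brk S) (csa0 S) a (eigen S (emb k))}"
  have "?L \<subseteq> deg_gens 0" using deg_gens0_intros(1) by (auto simp: wvecs_def)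
  then have "tau0_plus S \<subseteq> sigma0_vals"
    unfolding tau0_plus_def using deg_gens0_sigma0_vals by (intro cspan_minimal [OF _ sigma0_vals_subspace]) blast
  moreover have "lin_act X v \<in> {0}" if "X \<in> tau0_plus S" for X
  proof (rule clinear_span_subset [OF _ that [unfolded tau0_plus_def] csubspace_0])
    show "clinear (\<lambda>X. lin_act X v)" using cbilinear_lin_act unfolding cbilinear_def by blast
    show "lin_act X v \<in> {0}" if "X \<in> ?L" for X using that r by (auto simp: wvecs_def)
  qed
  ultimately show "\<forall>X\<in>tau0_plus S. tau0_act X v = 0" using lin_act_eq by auto
qed

text \<open>The coordinates of a vector killed by \<open>\<tau>\<^sub>0(+)\<close> are singular vectors, hence come from \<open>W\<^sub>2\<close>;
  their preimages are the coordinates of a preimage in \<open>T'\<close>.\<close>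

theorem top_space_loop:
  assumes fd: "fin_dim (UNIV :: 'w1 set)"
  shows "{v \<in> loop_space S G. \<forall>X\<in>tau0_plus S. tau0_act X v = 0} = loop_map incl ` loop_space S G2"
proof (intro subset_antisym subsetI)
  fix v assume "v \<in> {v \<in> loop_space S G. \<forall>X\<in>tau0_plus S. tau0_act X v = 0}"
  then have v: "v \<in> loop_space S G" and kill: "\<And>a k x. a \<in> pos S \<Longrightarrow> x \<in> wvecs a k \<Longrightarrow> lin_act (loopX (emb k) x) v = 0"
    by (auto simp: tau0_plus_kills_iff)
  obtain B :: "'w1 set" where B: "finite B" "complex_vector.independent B" "cspan B = UNIV"
    by (rule exists_basis [OF fd])
  have preimage: "tcoord B c (lookup v k) \<in> incl ` G2 (coset S k)" for c k
  proof (rule singular_vectors_are_incl)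
    show "tcoord B c (lookup v k) \<in> G (coset S k)"
      by (rule tcoord_in [OF B]) (use v in \<open>simp add: loop_space_def\<close>)
    fix a l x assume a: "a \<in> pos S" and x: "x \<in> wvecs a l"
    have "tensor_map id (act x) (lookup v k) = 0"
      using lookup_lin_act_L [OF wvecs_sigma0 [OF x], of l v k] kill [OF a x] by simp
    then show "act x (tcoord B c (lookup v k)) = 0"
      using tcoord_tensor_map [OF B clinear_act [OF wvecs_sigma0 [OF x]], of c "lookup v k"]
      by (simp add: clinear_0 [OF clinear_tcoord])
  qed
  define w where "w c k = (SOME w. w \<in> G2 (coset S k) \<and> incl w = tcoord B c (lookup v k))" for c k
  have "w c k \<in> G2 (coset S k) \<and> incl (w c k) = tcoord B c (lookup v k)" for c k
    unfolding w_def by (rule someI_ex) (use preimage [of c k] in \<open>elim imageE; auto\<close>)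
  then have w: "w c k \<in> G2 (coset S k)" "incl (w c k) = tcoord B c (lookup v k)" for c k
    by simp_all
  define s where "s = (\<Sum>k\<in>keys v. single k (\<Sum>c\<in>B. c \<otimes>\<^sub>C w c k))"
  have s: "lookup s k = (if k \<in> keys v then \<Sum>c\<in>B. c \<otimes>\<^sub>C w c k else 0)" for k
    by (simp add: s_def lookup_sum lookup_single when_def if_distrib cong: if_cong)
  have "(\<Sum>c\<in>B. c \<otimes>\<^sub>C w c k) \<in> cspan {v1 \<otimes>\<^sub>C v2 | v1 v2. v2 \<in> G2 (coset S k)}" for k
    by (intro cspan_sum cspan_base) (use w(1) in blast)
  then have "s \<in> loop_space S G2"
    by (simp add: loop_space_def s cspan_zero)
  moreover have "loop_map incl s = v"
  proof (rule poly_mapping_eqI)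
    fix k
    interpret t: Vector_Spaces.linear scaleC scaleC "tensor_map id incl" by (rule clinear_tensor_map)
    show "lookup (loop_map incl s) k = lookup v k"
    proof (cases "k \<in> keys v")
      case True
      then have "lookup (loop_map incl s) k = (\<Sum>c\<in>B. c \<otimes>\<^sub>C tcoord B c (lookup v k))"
        by (simp add: lookup_loop_map s t.sum tensor_map_tensor [OF clinear_id incl_linear] w(2))
      then show ?thesis using tensor_expand [OF B, of "lookup v k"] by simp
    next
      case False
      then show ?thesis by (simp add: lookup_loop_map s in_keys_iff)
    qed
  qed
  ultimately show "v \<in> loop_map incl ` loop_space S G2" by blast
next
  fix v :: "int ^ 'n \<Rightarrow>\<^sub>0 ('w1, 'w) tensor" assume "v \<in> loop_map incl ` loop_space S G2"
  then obtain s :: "int ^ 'n \<Rightarrow>\<^sub>0 ('w1, 'w2) tensor" where s: "s \<in> loop_space S G2" "v = loop_map incl s" by blast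
  have "lookup v k \<in> cspan {v1 \<otimes>\<^sub>C v2 | v1 v2. v2 \<in> G (coset S k)}" for k
    unfolding s(2) lookup_loop_map
  proof (rule clinear_span_subset [OF clinear_tensor_map])
    show "lookup s k \<in> cspan {v1 \<otimes>\<^sub>C v2 | v1 v2. v2 \<in> G2 (coset S k)}"
      using s(1) by (simp add: loop_space_def)
    show "tensor_map id incl a \<in> cspan {v1 \<otimes>\<^sub>C v2 | v1 v2. v2 \<in> G (coset S k)}"
      if "a \<in> {v1 \<otimes>\<^sub>C v2 | v1 v2. v2 \<in> G2 (coset S k)}" for a
    proof -
      from that obtain v1 v2 where a: "a = v1 \<otimes>\<^sub>C v2" "v2 \<in> G2 (coset S k)" by blast
      show ?thesis
        unfolding a(1) tensor_map_tensor [OF clinear_id incl_linear]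
        by (rule cspan_base) (use incl_grade [OF a(2)] in auto)
    qed
  qed simp
  then have "v \<in> loop_space S G" by (simp add: loop_space_def)
  moreover have "lin_act (loopX (emb l) x) v = 0" if a: "a \<in> pos S" and x: "x \<in> wvecs a l" for a l x
  proof (rule poly_mapping_eqI)
    fix k
    note ax = clinear_act [OF wvecs_sigma0 [OF x]]
    have "tensor_map id (act x) (tensor_map id incl w) = 0" for w :: "('w1, 'w2) tensor"
      by (rule clinear_eq_on_tensors [where f = "\<lambda>w. tensor_map id (act x) (tensor_map id incl w)" and g = "\<lambda>w. 0"])
         (simp_all add: clinear_iff tensor_map_add tensor_map_scaleC tensor_map_tensor [OF clinear_id incl_linear]
            tensor_map_tensor [OF clinear_id ax] incl_plus [OF a x] tensor_0)
    then show "lookup (lin_act (loopX (emb l) x) v) k = lookup 0 k"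
      using lookup_lin_act_L [OF wvecs_sigma0 [OF x], of l v "k - l"] by (simp add: s(2) lookup_loop_map)
  qed
  ultimately show "v \<in> {v \<in> loop_space S G. \<forall>X\<in>tau0_plus S. tau0_act X v = 0}"
    by (simp add: tau0_plus_kills_iff)
qed

end

theorem proposition5p4:
  fixes S :: "('g::complex_vector, 'n::finite) toroidal_data" and b :: nat
    and \<rho> :: "('g, 'n) toroidal \<Rightarrow> 'v::complex_vector \<Rightarrow> 'v"
    and \<psi> :: "('g, 'n) toroidal \<Rightarrow> complex" and C0 d :: complex and \<alpha> :: "complex ^ 'n"
    and gl :: "complex ^ 'n ^ 'n \<Rightarrow> 'w1::complex_vector \<Rightarrow> 'w1"
    and act2 :: "'g \<Rightarrow> 'w2::complex_vector \<Rightarrow> 'w2" and G2 :: "(int ^ 'n) set \<Rightarrow> 'w2 set"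
    and actS :: "'g \<Rightarrow> 'ws::complex_vector \<Rightarrow> 'ws" and GS :: "(int ^ 'n) set \<Rightarrow> 'ws set"
    and \<pi> :: "('g list \<times> 'w2 \<Rightarrow>\<^sub>0 complex) \<Rightarrow> 'ws"
  assumes "b = 1 \<or> b = 2" and "toroidal_setting b S"
    and "clinear_on (lie_centre (tau_bracket S) (tau S)) \<psi>"
    and "category_B S \<psi> \<rho>" and "irreducible_module (tau_bracket S) (tau S) \<rho> UNIV"
    and "\<And>v. \<rho> (tKi 0 None) v = C0 *\<^sub>C v" and "C0 \<noteq> 0"
    and "irreducible_module gl_bracket UNIV gl UNIV" and "fin_dim (UNIV :: 'w1 set)"
    and "graded_irreducible S (g_circ S) act2 G2" and "fin_dim (UNIV :: 'w2 set)"
    and "lie_module_iso (tau_bracket S) (tau0_weight0 S) \<rho> (top_space b S \<rho>)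
           (loop_act gl act2 \<alpha> d C0) (loop_space S G2)"
    and "irreducible_quotient S act2 G2 actS GS \<pi>"
  shows "(lie_module (tau_bracket S) (tau0 S) (loop_act gl actS \<alpha> d C0) (loop_space S GS) \<and>
          irreducible_module (tau_bracket S) (tau0 S) (loop_act gl actS \<alpha> d C0) (loop_space S GS)) \<and>
         {v \<in> loop_space S GS. \<forall>X\<in>tau0_plus S. loop_act gl actS \<alpha> d C0 X v = 0} =
           loop_map (\<lambda>w. \<pi> (ind_gen [] w)) ` loop_space S G2"
proof -
  interpret loop_quotient b S actS GS gl \<alpha> d C0 act2 G2 \<pi>
    by unfold_locales
       (use assms(2,8,10,11,13) in \<open>auto simp: irreducible_module_def irreducible_quotient_def graded_irreducible_def\<close>)
  have "incl = (\<lambda>w. \<pi> (ind_gen [] w))" by (rule ext) (simp add: incl_def)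
  then show ?thesis
    using lie_module_loop irreducible_loop [OF assms(7-9) irr] top_space_loop [OF assms(9)] by simp
qed

end
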